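(* Let $N\ge1$. Let $W:(0,\infty)\to(0,\infty)$ be a non-decreasing function such that $\lim_{x\to\infty}W(x)=\infty$ and $\lim_{x\to\infty}W(x)/x=0$. Then, for any $\boldsymbol{\xi}\in(\overline{\mathbb{Q}}^{\times})^N$ and any $F\in\mathcal{A}$, we have $$\mathcal{E}(F,\boldsymbol{\xi})\le 2\big(\sqrt{8\pi}+\sqrt{6}\big)\sqrt{h_{\mathcal{D}}(\boldsymbol{\xi})\,W\big(h_{\mathcal{D}}(\boldsymbol{\xi})^{-1}\big)}\;\big\|\widehat{F}\big\|_{L^1(\mathbb{Z}^N\times\mathbb{R}^N)}+3\,\nu_{\widehat{F}}\Big(W\big(h_{\mathcal{D}}(\boldsymbol{\xi})^{-1}\big)\Big),$$ where, for $y>0$, $$\nu_{\widehat{F}}(y):=\sum_{\boldsymbol{n}\in\mathbb{Z}^N}\int_{\{\boldsymbol{t}\in\mathbb{R}^N:\ \|\boldsymbol{n}\|_1+\|\boldsymbol{t}\|_1>y\}}\big|\widehat{F}(\boldsymbol{n},\boldsymbol{t})\big|\,d\boldsymbol{t}.$$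
   Context: Fix $\overline{\mathbb{Q}}\subset\mathbb{C}$, the algebraic closure of $\mathbb{Q}$; $\overline{\mathbb{Q}}^\times$, $\mathbb{C}^\times$ are the multiplicative groups. Heights. For $\xi\in\overline{\mathbb{Q}}$ let $P_\xi(x)=c_d\prod_{j=1}^d(x-\alpha_j)\in\mathbb{Z}[x]$ be its minimal polynomial (primitive, with integer coefficients), $d=\deg(\xi)=[\mathbb{Q}(\xi):\mathbb{Q}]$. Its Weil height is $h(\xi)=\frac1d\big(\log|c_d|+\sum_{j=1}^d\log^+|\alpha_j|\big)$, where $\log^+x=\max\{0,\log x\}$ (and $\log^+0=0$). For $\boldsymbol{\xi}=(\xi_1,\dots,\xi_N)\in(\overline{\mathbb{Q}}^\times)^N$, $h(\boldsymbol{\xi}):=h(\xi_1)+\dots+h(\xi_N)$. For $\boldsymbol{n}\in\mathbb{Z}^N$, $\chi^{\boldsymbol{n}}(\boldsymbol{\xi}):=\xi_1^{n_1}\cdots\xi_N^{n_N}$. The generalized degree is $\mathcal{D}(\boldsymbol{\xi}):=\min_{\boldsymbol{n}\in\mathbb{Z}^N\setminus\{\boldsymbol{0}\}}\{\|\boldsymbol{n}\|_1\deg(\chi^{\boldsymbol{n}}(\boldsymbol{\xi}))\}$, and $h_{\mathcal{D}}(\boldsymbol{\xi}):=h(\boldsymbol{\xi})+\frac{\log(2\mathcal{D}(\boldsymbol{\xi}))}{3\mathcal{D}(\boldsymbol{\xi})}$. Here $\|\cdot\|_1$ is the sum of the absolute values of the coordinates. Equidistribution error. Let $\mathbb{T}=\mathbb{R}/\mathbb{Z}$.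 The space $\mathbb{T}^N\times\mathbb{R}^N$ is identified with $(\mathbb{C}^\times)^N$ via $(\boldsymbol{\theta},\boldsymbol{s})\mapsto(e^{2\pi i\theta_1+s_1},\dots,e^{2\pi i\theta_N+s_N})$, and test functions are viewed as functions $F(\boldsymbol{\theta},\boldsymbol{s})$ on $\mathbb{T}^N\times\mathbb{R}^N$. Let $S=\{(\sigma\xi_1,\dots,\sigma\xi_N):\sigma\in\mathrm{Gal}(\overline{\mathbb{Q}}/\mathbb{Q})\}$ be the (finite) Galois orbit of $\boldsymbol{\xi}$. For $\boldsymbol{\alpha}\in S$ let $(\boldsymbol{\theta}(\boldsymbol{\alpha}),\boldsymbol{s}(\boldsymbol{\alpha}))$ be the corresponding point of $\mathbb{T}^N\times\mathbb{R}^N$, i.e. $\boldsymbol{\theta}(\boldsymbol{\alpha})=(\arg(\alpha_j)/2\pi)_j$, $\boldsymbol{s}(\boldsymbol{\alpha})=(\log|\alpha_j|)_j$. Then $$\mathcal{E}(F,\boldsymbol{\xi}):=\Big|\frac1{|S|}\sum_{\boldsymbol{\alpha}\in S}F(\boldsymbol{\theta}(\boldsymbol{\alpha}),\boldsymbol{s}(\boldsymbol{\alpha}))-\int_{\mathbb{T}^N}F(\boldsymbol{\theta},\boldsymbol{0})\,d\boldsymbol{\theta}\Big|,$$ that is, the absolute difference of the integrals of $F$ against the uniform probability measure on $S$ and the Haar probability measure on the unit polycircle $(\mathbb{S}^1)^N$. Fourier transform. For $F\in L^1(\mathbb{T}^N\times\mathbb{R}^N)$, $\widehat{F}(\boldsymbol{n},\boldsymbol{t})=\int_{\mathbb{T}^N}\int_{\mathbb{R}^N}F(\boldsymbol{\theta},\boldsymbol{s})e^{-2\pi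 i\boldsymbol{n}\cdot\boldsymbol{\theta}}e^{-2\pi i\boldsymbol{t}\cdot\boldsymbol{s}}\,d\boldsymbol{s}\,d\boldsymbol{\theta}$ for $(\boldsymbol{n},\boldsymbol{t})\in\mathbb{Z}^N\times\mathbb{R}^N$, extended to $L^2$ by Plancherel. Class of test functions. $\mathcal{A}$ is the set of continuous $F:\mathbb{T}^N\times\mathbb{R}^N\to\mathbb{C}$ with $F\in L^2(\mathbb{T}^N\times\mathbb{R}^N)$ and $\widehat{F}\in L^1(\mathbb{Z}^N\times\mathbb{R}^N)$ (counting measure times Lebesgue measure). *)

theory Defs
  imports "HOL-Analysis.Analysis" "HOL-Computational_Algebra.Computational_Algebra"
begin

definition algebraic_numbers :: "complex set" where
  "algebraic_numbers = {x. algebraic x}"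

text \<open>The minimal polynomial over the integers: primitive, of least degree among the nonzero
  annihilating polynomials; positivity of the leading coefficient fixes the sign.\<close>

definition int_min_poly :: "complex \<Rightarrow> int poly" where
  "int_min_poly x = (THE p. content p = 1 \<and> lead_coeff p > 0 \<and> poly (map_poly of_int p) x = 0 \<and>
     (\<forall>q. q \<noteq> 0 \<and> poly (map_poly of_int q) x = 0 \<longrightarrow> degree p \<le> degree q))"

definition alg_degree :: "complex \<Rightarrow> nat" where
  "alg_degree x = degree (int_min_poly x)"

definition log_plus :: "real \<Rightarrow> real" where
  "log_plus x = (if x = 0 then 0 else max 0 (ln x))"

definition weil_height :: "complex \<Rightarrow> real" where
  "weil_height x =
     (ln \<bar>real_of_int (lead_coeff (int_min_poly x))\<bar>
        + (\<Sum>\<alpha>\<in>#proots (map_poly of_int (int_min_poly x) :: complex poly). log_plus (norm \<alpha>)))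
     / real (alg_degree x)"

definition height :: "complex ^ 'n \<Rightarrow> real" where
  "height \<xi> = (\<Sum>j\<in>UNIV. weil_height (\<xi> $ j))"

definition l1_norm :: "'a::{comm_monoid_add,abs} ^ 'n \<Rightarrow> 'a" where
  "l1_norm x = (\<Sum>j\<in>UNIV. \<bar>x $ j\<bar>)"

definition monomial :: "int ^ 'n \<Rightarrow> complex ^ 'n \<Rightarrow> complex" where
  "monomial n \<xi> = (\<Prod>j\<in>UNIV. (\<xi> $ j) powi (n $ j))"

definition gen_degree :: "complex ^ 'n \<Rightarrow> nat" where
  "gen_degree \<xi> = (INF n\<in>{n. n \<noteq> 0}. nat (l1_norm n) * alg_degree (monomial n \<xi>))"

definition height_D :: "complex ^ 'n \<Rightarrow> real" where
  "height_D \<xi> = height \<xi> + ln (2 * real (gen_degree \<xi>)) / (3 * real (gen_degree \<xi>))"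

text \<open>Elements of the absolute Galois group are represented by functions on \<open>\<complex>\<close>;
  only their values on the algebraic numbers matter.\<close>

definition galois_group :: "(complex \<Rightarrow> complex) set" where
  "galois_group = {\<sigma>. bij_betw \<sigma> algebraic_numbers algebraic_numbers \<and>
     (\<forall>x\<in>algebraic_numbers. \<forall>y\<in>algebraic_numbers. \<sigma> (x + y) = \<sigma> x + \<sigma> y \<and> \<sigma> (x * y) = \<sigma> x * \<sigma> y) \<and>
     (\<forall>q\<in>\<rat>. \<sigma> q = q)}"

definition galois_orbit :: "complex ^ 'n \<Rightarrow> (complex ^ 'n) set" where
  "galois_orbit \<xi> = (\<lambda>\<sigma>. \<chi> j. \<sigma> (\<xi> $ j)) ` galois_group"

text \<open>A function on \<open>(\<real>/\<int>)\<^sup>N \<times> \<real>\<^sup>N\<close> is a function on \<open>\<real>\<^sup>N \<times> \<real>\<^sup>N\<close> that is \<open>\<int>\<^sup>N\<close>-periodic in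
  the first argument (so continuity upstairs is continuity on the quotient). Integration over
  the torus is integration over a fundamental domain.\<close>

definition torus_periodic :: "((real ^ 'n) \<times> (real ^ 'n) \<Rightarrow> complex) \<Rightarrow> bool" where
  "torus_periodic F \<longleftrightarrow> (\<forall>(k :: int ^ 'n) \<theta> s. F (\<theta> + (\<chi> j. of_int (k $ j)), s) = F (\<theta>, s))"

definition torus :: "(real ^ 'n) measure" where
  "torus = restrict_space lborel {\<theta>. \<forall>j. 0 \<le> \<theta> $ j \<and> \<theta> $ j < 1}"

text \<open>The choice of branch of the argument is immaterial for periodic test functions.\<close>

definition angle_vec :: "complex ^ 'n \<Rightarrow> real ^ 'n" where
  "angle_vec \<alpha> = (\<chi> j. Arg (\<alpha> $ j) / (2 * pi))"

definition log_vec :: "complex ^ 'n \<Rightarrow> real ^ 'n" where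
  "log_vec \<alpha> = (\<chi> j. ln (norm (\<alpha> $ j)))"

definition equidist_error :: "((real ^ 'n) \<times> (real ^ 'n) \<Rightarrow> complex) \<Rightarrow> complex ^ 'n \<Rightarrow> real" where
  "equidist_error F \<xi> =
     norm ((\<Sum>\<alpha>\<in>galois_orbit \<xi>. F (angle_vec \<alpha>, log_vec \<alpha>)) / of_nat (card (galois_orbit \<xi>))
           - (LINT \<theta>|torus. F (\<theta>, 0)))"

abbreviation physical_measure :: "((real ^ 'n) \<times> (real ^ 'n)) measure" where
  "physical_measure \<equiv> torus \<Otimes>\<^sub>M lborel"

abbreviation frequency_measure :: "((int ^ 'n) \<times> (real ^ 'n)) measure" where
  "frequency_measure \<equiv> count_space UNIV \<Otimes>\<^sub>M lborel"

definition square_integrable :: "'a measure \<Rightarrow> ('a \<Rightarrow> complex) \<Rightarrow> bool" where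
  "square_integrable M f \<longleftrightarrow> f \<in> borel_measurable M \<and> integrable M (\<lambda>z. (norm (f z))\<^sup>2)"

definition tendsto_L2 :: "'a measure \<Rightarrow> (nat \<Rightarrow> 'a \<Rightarrow> complex) \<Rightarrow> ('a \<Rightarrow> complex) \<Rightarrow> bool" where
  "tendsto_L2 M f g \<longleftrightarrow> (\<lambda>k. \<integral>\<^sup>+ z. ennreal ((norm (f k z - g z))\<^sup>2) \<partial>M) \<longlonglongrightarrow> 0"

definition fourier_L1 ::
  "((real ^ 'n) \<times> (real ^ 'n) \<Rightarrow> complex) \<Rightarrow> (int ^ 'n) \<times> (real ^ 'n) \<Rightarrow> complex" where
  "fourier_L1 F = (\<lambda>(n, t). LINT \<theta>|torus. LINT s|lborel.
     F (\<theta>, s) * cis (- 2 * pi * (\<Sum>j\<in>UNIV. of_int (n $ j) * \<theta> $ j)) * cis (- 2 * pi * (t \<bullet> s)))"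

text \<open>The extension to \<open>L\<^sup>2\<close> by density: \<open>G\<close> is a representative of the Fourier transform of
  \<open>F\<close> if the pair \<open>(F, G)\<close> lies in the \<open>L\<^sup>2\<close>-closure of the graph of \<^const>\<open>fourier_L1\<close> on
  \<open>L\<^sup>1 \<inter> L\<^sup>2\<close>. By Plancherel, such a \<open>G\<close> exists for every \<open>F\<close> in \<open>L\<^sup>2\<close> and is unique up to
  null sets.\<close>

definition is_fourier_L2 ::
  "((real ^ 'n) \<times> (real ^ 'n) \<Rightarrow> complex) \<Rightarrow> ((int ^ 'n) \<times> (real ^ 'n) \<Rightarrow> complex) \<Rightarrow> bool" where
  "is_fourier_L2 F G \<longleftrightarrow>
     square_integrable physical_measure F \<and> square_integrable frequency_measure G \<and>
     (\<exists>f. (\<forall>k. integrable physical_measure (f k) \<and> square_integrable physical_measure (f k)) \<and>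
          tendsto_L2 physical_measure f F \<and>
          tendsto_L2 frequency_measure (\<lambda>k. fourier_L1 (f k)) G)"

text \<open>\<open>F\<close> belongs to the class of test functions, and \<open>G\<close> is (a representative of) its Fourier
  transform. Integrability does not depend on the representative.\<close>

definition test_function ::
  "((real ^ 'n) \<times> (real ^ 'n) \<Rightarrow> complex) \<Rightarrow> ((int ^ 'n) \<times> (real ^ 'n) \<Rightarrow> complex) \<Rightarrow> bool" where
  "test_function F G \<longleftrightarrow>
     torus_periodic F \<and> continuous_on UNIV F \<and> square_integrable physical_measure F \<and>
     is_fourier_L2 F G \<and> integrable frequency_measure G"

definition L1_norm_freq :: "((int ^ 'n) \<times> (real ^ 'n) \<Rightarrow> complex) \<Rightarrow> real" where
  "L1_norm_freq G = (LINT z|frequency_measure. norm (G z))"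

definition tail_freq :: "((int ^ 'n) \<times> (real ^ 'n) \<Rightarrow> complex) \<Rightarrow> real \<Rightarrow> real" where
  "tail_freq G y =
     (\<Sum>\<^sub>\<infinity>n. LINT t:{t. of_int (l1_norm n) + l1_norm t > y}|lborel. norm (G (n, t)))"

end

theory Submission
  imports Defs "HOL-Probability.Characteristic_Functions" "HOL-Real_Asymp.Real_Asymp"
begin

text \<open>
  Write \<open>e(n, t)\<close> for the character \<open>exp (2 \<pi> \<i> (n \<bullet> \<theta> + t \<bullet> s))\<close>. Fourier inversion
  (\<open>fourier_inversion\<close>) expresses \<open>F\<close> as the integral of its transform against these characters, so
  the equidistribution error is at most the integral of \<open>\<bar>Fhat\<bar>\<close> times the deviation of the average of
  \<open>e(n, t)\<close> over the Galois orbit from its mean over the unit polycircle, which is 1 for \<open>n = 0\<close> and 0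
  otherwise. The deviation never exceeds 2, so the frequencies with \<open>\<parallel>n\<parallel> + \<parallel>t\<parallel> > y\<close> cost at most twice
  the tail. What remains is a bound for the deviation by a multiple of \<open>sqrt (h y)\<close>, with \<open>h\<close> the
  modified height, when \<open>\<parallel>n\<parallel> + \<parallel>t\<parallel> \<le> y\<close> (\<open>orbit_average_deviation\<close>); it is used with
  \<open>y = W (1 / h)\<close>.

  The factor with \<open>t\<close> is within \<open>2 \<pi> \<bar>t \<bullet> s\<bar>\<close> of 1, and the average of \<open>\<bar>log \<bar>\<alpha>\<^sub>j\<bar>\<bar>\<close> over the orbit is
  at most twice the height of the \<open>j\<close>-th coordinate. The factor with \<open>n\<close> is the average of
  \<open>\<eta> / \<bar>\<eta>\<bar>\<close> over the conjugates \<open>\<eta>\<close> of the monomial \<open>\<chi>\<^sup>n(\<xi>)\<close>, of degree \<open>d\<close> say. It is small because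
  the conjugates repel each other: the discriminant is bounded below, whereas
  \<open>\<Sum> ln \<bar>1 - \<rho> z cnj w\<bar>\<close> over points of the disc is at most \<open>- \<rho> \<bar>\<Sum> z\<bar>\<^sup>2\<close> (\<open>sum_ln_kernel_le\<close>), and the
  two together bound the square of the average by the height plus \<open>log (2 d) / (3 d)\<close>, up to a constant
  (\<open>average_sgn_monomial_le\<close>). Since \<open>\<parallel>n\<parallel> d\<close> is at least the generalized degree, this is of the
  required form.

  The lower bound for the discriminant (\<open>norm_disc_ge_1\<close>) is proved directly in terms of the minimal
  polynomials of the coordinates, so that the height of the monomial never has to be compared with
  theirs. A suitable product of leading coefficients, times the product of the differences
  \<open>\<chi>\<^sup>n(\<alpha>) - \<chi>\<^sup>n(\<beta>)\<close> over the orbit, is a nonzero integer: it is rational because the Galois group fixes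
  it, and integral because it lies in every valuation ring of the complex numbers, by Gauss's lemma.
  The Galois side needs that automorphisms of the algebraic closure act transitively on conjugates
  (\<open>galois_transitive\<close>); the arithmetic side needs a valuation ring above every prime
  (\<open>valuation_ring_above_prime\<close>). Both come from Zorn's lemma.

  Fourier inversion is proved by pairing the transform with a Gaussian times a product of binomial
  coefficients, whose own transform is an explicit nonnegative approximate identity; the multiplication
  formula carries this pairing through the \<open>L\<^sup>2\<close> limit that defines the transform.
\<close>

section \<open>Minimal polynomials over the integers\<close>

abbreviation ipoly :: "int poly \<Rightarrow> complex \<Rightarrow> complex" where
  "ipoly p x \<equiv> poly (map_poly of_int p) x"

abbreviation cpoly :: "int poly \<Rightarrow> complex poly" where
  "cpoly \<equiv> map_poly of_int"

lemma cpoly_diff: "cpoly (p - q) = cpoly p - cpoly q"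
  by (intro poly_eqI) (simp add: coeff_map_poly)

lemma cpoly_mult: "cpoly (p * q) = cpoly p * cpoly q"
  by (intro poly_eqI) (simp add: coeff_map_poly coeff_mult)

lemma cpoly_power: "cpoly (p ^ n) = cpoly p ^ n"
  by (induction n) (simp_all add: cpoly_mult)

lemma cpoly_smult: "cpoly (smult c p) = smult (of_int c) (cpoly p)"
  by (intro poly_eqI) (simp add: coeff_map_poly)

lemma degree_cpoly [simp]: "degree (cpoly p) = degree p"
  by (rule degree_map_poly) simp

lemma cpoly_eq_0_iff [simp]: "cpoly p = 0 \<longleftrightarrow> p = 0"
  by (metis coeff_map_poly leading_coeff_0_iff degree_cpoly of_int_0 of_int_eq_0_iff)

lemma cpoly_pderiv: "cpoly (pderiv p) = pderiv (cpoly p)"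
  by (intro poly_eqI) (simp add: coeff_map_poly coeff_pderiv)

definition minimal_int_poly :: "complex \<Rightarrow> int poly \<Rightarrow> bool" where
  "minimal_int_poly x p \<longleftrightarrow> content p = 1 \<and> lead_coeff p > 0 \<and> ipoly p x = 0 \<and>
     (\<forall>q. q \<noteq> 0 \<and> ipoly q x = 0 \<longrightarrow> degree p \<le> degree q)"

lemma minimal_int_poly_exists:
  assumes "algebraic x"
  shows "\<exists>p. minimal_int_poly x p"
proof -
  define P where "P = (\<lambda>p. p \<noteq> 0 \<and> ipoly p x = 0)"
  have "\<exists>p. P p" using assms unfolding P_def by (elim algebraicE') blast
  then obtain p where p: "P p" and min: "\<And>q. P q \<Longrightarrow> degree p \<le> degree q"
    by (metis arg_min_natI arg_min_nat_le)
  have p0: "p \<noteq> 0" and px: "ipoly p x = 0" using p by (auto simp: P_def)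
  define q where "q = primitive_part p"
  have pq: "p = smult (content p) q" unfolding q_def by simp
  have c0: "content p \<noteq> 0" using p0 by simp
  have q0: "q \<noteq> 0" using pq p0 by auto
  have qx: "ipoly q x = 0" using px c0 by (subst (asm) pq) (simp add: cpoly_smult)
  have dq: "degree q = degree p" unfolding q_def by simp
  have cq: "content q = 1" using p0 by (simp add: q_def content_primitive_part)
  define r where "r = (if lead_coeff q > 0 then q else - q)"
  have "cpoly (- q) = - cpoly q" using cpoly_diff[of 0 q] by simp
  then have rx: "ipoly r x = 0" using qx by (simp add: r_def)
  have "content (- q) = content q"
    using content_smult[of "-1" q] by simp
  then have cr: "content r = 1" using cq by (simp add: r_def)
  have "lead_coeff q > 0 \<or> lead_coeff q < 0" using q0 by (metis leading_coeff_0_iff linorder_neqE)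
  then have "lead_coeff r > 0" by (auto simp: r_def)
  moreover have "degree r = degree p" using dq by (simp add: r_def)
  ultimately have "minimal_int_poly x r"
    using cr rx min by (auto simp: minimal_int_poly_def P_def)
  then show ?thesis ..
qed

lemma minimal_int_poly_unique:
  assumes p: "minimal_int_poly x p" and q: "minimal_int_poly x q"
  shows "p = q"
proof -
  have p0: "p \<noteq> 0" "q \<noteq> 0" using p q by (auto simp: minimal_int_poly_def)
  then have dq: "degree p = degree q" using p q by (intro antisym) (auto simp: minimal_int_poly_def)
  define r where "r = smult (lead_coeff q) p - smult (lead_coeff p) q"
  have rx: "ipoly r x = 0" using p q by (simp add: r_def cpoly_diff cpoly_smult minimal_int_poly_def)
  have "r = 0"
  proof (rule ccontr)
    assume r0: "r \<noteq> 0"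
    have "degree r \<le> degree p" unfolding r_def using dq by (intro degree_diff_le) auto
    moreover have "degree p \<le> degree r" using p rx r0 by (auto simp: minimal_int_poly_def)
    ultimately have "lead_coeff r = coeff r (degree p)" by simp
    also have "\<dots> = 0" by (simp add: r_def dq)
    finally show False using r0 by simp
  qed
  then have *: "smult (lead_coeff q) p = smult (lead_coeff p) q" by (simp add: r_def)
  then have "content (smult (lead_coeff q) p) = content (smult (lead_coeff p) q)" by simp
  then have "lead_coeff q = lead_coeff p" using p q by (simp add: minimal_int_poly_def)
  then have "smult (lead_coeff p) (p - q) = 0" using * by (simp add: smult_diff_right)
  then show "p = q" using p0 by simp
qed

lemma minimal_int_poly_int_min_poly:
  assumes "algebraic x"
  shows "minimal_int_poly x (int_min_poly x)"
proof -
  have "\<exists>!p. minimal_int_poly x p"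
    using minimal_int_poly_exists[OF assms] minimal_int_poly_unique by blast
  then show ?thesis unfolding int_min_poly_def minimal_int_poly_def by (rule theI')
qed

lemma int_min_poly_eqI:
  assumes "minimal_int_poly x p" shows "int_min_poly x = p"
proof -
  have "algebraic x" using assms
    by (intro algebraicI[of "cpoly p"]) (auto simp: minimal_int_poly_def coeff_map_poly)
  then show ?thesis using assms minimal_int_poly_int_min_poly minimal_int_poly_unique by blast
qed

lemma
  assumes "algebraic x"
  shows int_min_poly_root: "ipoly (int_min_poly x) x = 0"
    and int_min_poly_nonzero: "int_min_poly x \<noteq> 0"
    and lead_coeff_int_min_poly: "lead_coeff (int_min_poly x) > 0"
    and degree_int_min_poly_le: "q \<noteq> 0 \<Longrightarrow> ipoly q x = 0 \<Longrightarrow> degree (int_min_poly x) \<le> degree q"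
  using minimal_int_poly_int_min_poly[OF assms] by (auto simp: minimal_int_poly_def)

lemma degree_int_min_poly_pos:
  assumes "algebraic x" shows "degree (int_min_poly x) > 0"
proof (rule ccontr)
  assume "\<not> ?thesis"
  then obtain c where c: "int_min_poly x = [:c:]" by (metis degree_eq_zeroE gr0I)
  with int_min_poly_root[OF assms] int_min_poly_nonzero[OF assms] show False
    by (auto simp: map_poly_pCons)
qed

text \<open>The pseudo-remainder has smaller degree and still vanishes at \<open>x\<close>, so it is zero; pseudo-division
  keeps the coefficients integral.\<close>

lemma int_min_poly_pseudo_dvd:
  assumes x: "algebraic x" and q: "ipoly q x = 0"
  shows "\<exists>a r. a \<noteq> 0 \<and> smult a q = int_min_poly x * r"
proof -
  let ?P = "int_min_poly x"
  define s where "s = pseudo_mod q ?P"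
  obtain a r where a: "a \<noteq> 0" and eq: "smult a q = ?P * r + s"
    using pseudo_mod(1)[OF int_min_poly_nonzero[OF x], of q] unfolding s_def by blast
  have "s = smult a q - ?P * r" using eq by simp
  then have "ipoly s x = 0"
    using q int_min_poly_root[OF x] by (simp add: cpoly_diff cpoly_mult cpoly_smult)
  moreover have "s = 0 \<or> degree s < degree ?P" 
    using pseudo_mod(2)[OF int_min_poly_nonzero[OF x], of q] unfolding s_def .
  ultimately have "s = 0" using degree_int_min_poly_le[OF x, of s] by fastforce
  then show ?thesis using a eq by auto
qed

lemma algebraic_conjugate:
  assumes "algebraic x" "ipoly (int_min_poly x) y = 0" shows "algebraic y"
  using assms(2) int_min_poly_nonzero[OF assms(1)]
  by (intro algebraicI[of "cpoly (int_min_poly x)"]) (auto simp: coeff_map_poly)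

text \<open>The minimal polynomial of \<open>y\<close> pseudo-divides that of \<open>x\<close>, and one of the two factors vanishes at
  \<open>x\<close>; by minimality it cannot be the cofactor.\<close>

lemma int_min_poly_conjugate:
  assumes x: "algebraic x" and y: "ipoly (int_min_poly x) y = 0"
  shows "int_min_poly y = int_min_poly x"
proof -
  have ay: "algebraic y" using algebraic_conjugate[OF x y] .
  let ?P = "int_min_poly x" and ?Q = "int_min_poly y"
  obtain a r where a: "a \<noteq> 0" and eq: "smult a ?P = ?Q * r"
    using int_min_poly_pseudo_dvd[OF ay y] by blast
  have r0: "r \<noteq> 0" using a eq int_min_poly_nonzero[OF x] by auto
  have "degree ?P = degree (?Q * r)" using a eq by (metis degree_smult_eq)
  also have "\<dots> = degree ?Q + degree r" using r0 int_min_poly_nonzero[OF ay] by (simp add: degree_mult_eq)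
  finally have deg: "degree ?P = degree ?Q + degree r" .
  have "ipoly ?Q x * ipoly r x = ipoly (smult a ?P) x" by (simp only: eq cpoly_mult poly_mult)
  also have "\<dots> = 0" using int_min_poly_root[OF x] by (simp add: cpoly_smult)
  finally have "ipoly ?Q x = 0 \<or> ipoly r x = 0" by simp
  moreover have "ipoly r x \<noteq> 0"
    using degree_int_min_poly_le[OF x r0] deg degree_int_min_poly_pos[OF ay] by auto
  ultimately have Qx: "ipoly ?Q x = 0" by simp
  have "degree ?Q \<le> degree q" if "q \<noteq> 0" "ipoly q x = 0" for q
    using degree_int_min_poly_le[OF x that] deg by simp
  then have "minimal_int_poly x ?Q"
    using minimal_int_poly_int_min_poly[OF ay] Qx by (simp add: minimal_int_poly_def)
  then show ?thesis using int_min_poly_eqI by auto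
qed

lemma ipoly_conjugate_iff:
  assumes x: "algebraic x" and y: "ipoly (int_min_poly x) y = 0"
  shows "ipoly q x = 0 \<longleftrightarrow> ipoly q y = 0"
proof -
  have *: "ipoly q v = 0" if u: "algebraic u" and v: "ipoly (int_min_poly u) v = 0" and q: "ipoly q u = 0" for u v
  proof -
    obtain a r where a: "a \<noteq> 0" and eq: "smult a q = int_min_poly u * r"
      using int_min_poly_pseudo_dvd[OF u q] by blast
    have "ipoly (smult a q) v = 0" using v by (simp add: eq cpoly_mult)
    then show ?thesis using a by (simp add: cpoly_smult)
  qed
  have "ipoly (int_min_poly y) x = 0"
    unfolding int_min_poly_conjugate[OF x y] by (rule int_min_poly_root[OF x])
  then show ?thesis
    using *[OF x y] *[OF algebraic_conjugate[OF x y]] by blast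
qed

text \<open>At a double root the derivative vanishes too, which contradicts minimality at that root.\<close>

lemma rsquarefree_int_min_poly:
  assumes x: "algebraic x" shows "rsquarefree (cpoly (int_min_poly x))"
  unfolding rsquarefree_roots
proof (intro allI notI, elim conjE)
  fix y assume y: "ipoly (int_min_poly x) y = 0" and d: "poly (pderiv (cpoly (int_min_poly x))) y = 0"
  let ?D = "pderiv (int_min_poly x)"
  have Dx: "ipoly ?D x = 0" using d ipoly_conjugate_iff[OF x y, of ?D] by (simp add: cpoly_pderiv)
  have "?D \<noteq> 0" using degree_int_min_poly_pos[OF x] by (simp add: pderiv_eq_0_iff)
  then have "degree (int_min_poly x) \<le> degree ?D" using Dx degree_int_min_poly_le[OF x] by blast
  then show False using degree_int_min_poly_pos[OF x] by (simp add: degree_pderiv)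
qed

definition conjugates :: "complex \<Rightarrow> complex set" where
  "conjugates x = {y. ipoly (int_min_poly x) y = 0}"

lemma finite_conjugates: "algebraic x \<Longrightarrow> finite (conjugates x)"
  unfolding conjugates_def by (rule poly_roots_finite) (simp add: int_min_poly_nonzero)

lemma self_mem_conjugates: "algebraic x \<Longrightarrow> x \<in> conjugates x"
  by (simp add: conjugates_def int_min_poly_root)

lemma int_min_poly_decompose:
  assumes "algebraic x"
  shows "cpoly (int_min_poly x) =
    smult (of_int (lead_coeff (int_min_poly x))) (\<Prod>y\<in>conjugates x. [:- y, 1:])"
proof -
  have "lead_coeff (cpoly (int_min_poly x)) = of_int (lead_coeff (int_min_poly x))"
    by (simp add: coeff_map_poly)
  then show ?thesis
    using complex_poly_decompose_rsquarefree[OF rsquarefree_int_min_poly[OF assms]]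
    unfolding conjugates_def by metis
qed

lemma proots_int_min_poly:
  assumes "algebraic x"
  shows "proots (cpoly (int_min_poly x)) = mset_set (conjugates x)"
proof -
  have *: "proots (\<Prod>y\<in>A. [:- y, 1:]) = mset_set A" if "finite A" for A :: "complex set"
    using that
  proof induction
    case (insert a A)
    have "(\<Prod>y\<in>A. [:- y, 1:]) \<noteq> (0 :: complex poly)" using insert.hyps(1) by (simp add: prod_zero_iff)
    moreover have "[:- a, 1:] \<noteq> 0" by simp
    ultimately have "proots ([:- a, 1:] * (\<Prod>y\<in>A. [:- y, 1:])) = add_mset a (mset_set A)"
      by (simp only: proots_mult mult_eq_0_iff simp_thms insert.IH proots_linear_factor minus_minus union_mset_add_mset_left add_0)
    then show ?case
      unfolding prod.insert[OF insert.hyps] mset_set.insert[OF insert.hyps] .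
  qed auto
  have l0: "complex_of_int (lead_coeff (int_min_poly x)) \<noteq> 0"
    using lead_coeff_int_min_poly[OF assms] by (metis of_int_eq_0_iff less_irrefl)
  show ?thesis
    unfolding int_min_poly_decompose[OF assms] proots_smult[OF l0]
    by (rule *[OF finite_conjugates[OF assms]])
qed

lemma card_conjugates: "algebraic x \<Longrightarrow> card (conjugates x) = alg_degree x"
  using size_proots_complex[of "cpoly (int_min_poly x)"] by (simp add: proots_int_min_poly alg_degree_def)

lemma weil_height_conjugates:
  assumes "algebraic x"
  shows "weil_height x = (ln (real_of_int (lead_coeff (int_min_poly x)))
     + (\<Sum>y\<in>conjugates x. log_plus (norm y))) / real (card (conjugates x))"
proof -
  have "\<bar>real_of_int (lead_coeff (int_min_poly x))\<bar> = real_of_int (lead_coeff (int_min_poly x))"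
    using lead_coeff_int_min_poly[OF assms] by linarith
  then show ?thesis
    unfolding weil_height_def proots_int_min_poly[OF assms] card_conjugates[OF assms]
      sum_unfold_sum_mset by (simp only:)
qed

section \<open>Algebraic numbers form a field\<close>

interpretation rat_cvec: vector_space "\<lambda>(q::rat) (x::complex). of_rat q * x"
  by unfold_locales (auto simp: algebra_simps of_rat_add of_rat_mult)

text \<open>The powers of \<open>z\<close> lie in a finite-dimensional rational space, so they are linearly dependent.\<close>

lemma algebraic_if_stable_span:
  assumes B: "finite B" and one: "1 \<in> rat_cvec.span B"
    and stable: "\<And>v. v \<in> rat_cvec.span B \<Longrightarrow> z * v \<in> rat_cvec.span B"
  shows "algebraic z"
proof -
  have pow: "z ^ k \<in> rat_cvec.span B" for k
    by (induction k) (auto simp: one stable)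
  show ?thesis
  proof (cases "inj (\<lambda>k. z ^ k)")
    case False
    then obtain i j where ij: "i < j" "z ^ i = z ^ j"
      by (metis (mono_tags, lifting) injI linorder_neqE_nat)
    show ?thesis
    proof (rule algebraicI[of "monom 1 j - monom 1 i"])
      show "poly (monom 1 j - monom 1 i) z = 0" using ij by (simp add: poly_monom)
      show "monom 1 j - monom 1 i \<noteq> (0 :: complex poly)"
        using ij by (metis degree_monom_eq eq_iff_diff_eq_0 less_irrefl one_neq_zero)
    qed (auto)
  next
    case True
    have "rat_cvec.dependent (range (\<lambda>k. z ^ k))"
    proof (rule ccontr)
      assume "\<not> rat_cvec.dependent (range (\<lambda>k. z ^ k))"
      from rat_cvec.independent_span_bound[OF B this] pow
      have "finite (range (\<lambda>k. z ^ k))" by blast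
      then show False using True by (metis finite_imageD infinite_UNIV_nat)
    qed
    then obtain S u v where S: "finite S" "S \<subseteq> range (\<lambda>k. z ^ k)"
      and v: "v \<in> S" "u v \<noteq> 0" and sum: "(\<Sum>w\<in>S. of_rat (u w) * w) = 0"
      unfolding rat_cvec.dependent_explicit by blast
    obtain K where K: "finite K" "S = (\<lambda>k. z ^ k) ` K" using S by (metis finite_subset_image)
    define p where "p = (\<Sum>k\<in>K. monom (of_rat (u (z ^ k)) :: complex) k)"
    have cp: "coeff p i = (if i \<in> K then of_rat (u (z ^ i)) else 0)" for i
      unfolding p_def using K(1) by (simp add: coeff_sum sum.delta)
    show ?thesis
    proof (rule algebraicI'[of p])
      show "coeff p i \<in> \<rat>" for i by (simp add: cp)
      obtain k where "k \<in> K" "v = z ^ k" using v K by auto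
      then have "coeff p k \<noteq> 0" using v by (simp add: cp)
      then show "p \<noteq> 0" by auto
      have "poly p z = (\<Sum>k\<in>K. of_rat (u (z ^ k)) * z ^ k)"
        by (simp add: p_def poly_sum poly_monom)
      also have "\<dots> = (\<Sum>w\<in>S. of_rat (u w) * w)"
        unfolding K(2) by (subst sum.reindex) (use True in \<open>auto simp: inj_on_def inj_def\<close>)
      finally show "poly p z = 0" using sum by simp
    qed
  qed
qed

text \<open>The span of the products \<open>x ^ i * y ^ j\<close> below the two degrees is stable under \<open>x\<close> and \<open>y\<close>, because
  the minimal polynomials reduce the top powers.\<close>

lemma algebraic_finite_stable_span:
  assumes x: "algebraic x" and y: "algebraic y"
  obtains B where "finite B" "1 \<in> rat_cvec.span B"
    "\<And>v. v \<in> rat_cvec.span B \<Longrightarrow> x * v \<in> rat_cvec.span B"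
    "\<And>v. v \<in> rat_cvec.span B \<Longrightarrow> y * v \<in> rat_cvec.span B"
proof -
  define m where "m = degree (int_min_poly x)"
  define n where "n = degree (int_min_poly y)"
  define B where "B = (\<lambda>(i,j). x ^ i * y ^ j) ` ({..<m} \<times> {..<n})"
  have mn: "m > 0" "n > 0" using degree_int_min_poly_pos x y by (auto simp: m_def n_def)
  have top: "\<exists>c. w ^ degree (int_min_poly w) = (\<Sum>i<degree (int_min_poly w). of_rat (c i) * w ^ i)"
    if w: "algebraic w" for w
  proof -
    let ?P = "int_min_poly w" let ?d = "degree ?P"
    define l where "l = (of_int (lead_coeff ?P) :: complex)"
    have l0: "l \<noteq> 0" using int_min_poly_nonzero[OF w] by (simp add: l_def)
    have "0 = (\<Sum>i\<le>?d. of_int (coeff ?P i) * w ^ i)"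
      using int_min_poly_root[OF w] by (simp add: poly_altdef coeff_map_poly)
    also have "\<dots> = (\<Sum>i<?d. of_int (coeff ?P i) * w ^ i) + l * w ^ ?d"
      by (simp add: lessThan_Suc_atMost[symmetric] l_def)
    finally have "w ^ ?d = - (\<Sum>i<?d. of_int (coeff ?P i) * w ^ i) / l"
      using l0 by (simp add: field_simps add_eq_0_iff)
    also have "\<dots> = (\<Sum>i<?d. of_rat (- of_int (coeff ?P i) / of_int (lead_coeff ?P)) * w ^ i)"
      by (simp add: l_def sum_divide_distrib sum_negf of_rat_divide of_rat_minus)
    finally show ?thesis
      by (rule exI[of _ "\<lambda>i. - of_int (coeff ?P i) / of_int (lead_coeff ?P)"])
  qed
  obtain cx where cx: "x ^ m = (\<Sum>i<m. of_rat (cx i) * x ^ i)" using top[OF x] by (auto simp: m_def)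
  obtain cy where cy: "y ^ n = (\<Sum>i<n. of_rat (cy i) * y ^ i)" using top[OF y] by (auto simp: n_def)
  have base: "x ^ i * y ^ j \<in> rat_cvec.span B" if "i < m" "j < n" for i j
    using that by (intro rat_cvec.span_base) (auto simp: B_def)
  have X: "x * (x ^ i * y ^ j) \<in> rat_cvec.span B" if "i < m" "j < n" for i j
  proof (cases "Suc i = m")
    case True
    have "x * (x ^ i * y ^ j) = (\<Sum>i<m. of_rat (cx i) * (x ^ i * y ^ j))"
      using True cx by (simp add: sum_distrib_right mult.assoc[symmetric] flip: power_Suc)
    also have "\<dots> \<in> rat_cvec.span B"
      by (intro rat_cvec.span_sum rat_cvec.span_scale base) (use that in auto)
    finally show ?thesis .
  next
    case False then show ?thesis using base[of "Suc i" j] that by (simp add: mult.assoc)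
  qed
  have Y: "y * (x ^ i * y ^ j) \<in> rat_cvec.span B" if "i < m" "j < n" for i j
  proof (cases "Suc j = n")
    case True
    have "y * (x ^ i * y ^ j) = x ^ i * y ^ n" using True by auto
    also have "\<dots> = (\<Sum>k<n. of_rat (cy k) * (x ^ i * y ^ k))"
      using cy by (simp add: sum_distrib_left algebra_simps)
    also have "\<dots> \<in> rat_cvec.span B"
      by (intro rat_cvec.span_sum rat_cvec.span_scale base) (use that in auto)
    finally show ?thesis .
  next
    case False then show ?thesis using base[of i "Suc j"] that by (simp add: algebra_simps)
  qed
  have ext: "w * v \<in> rat_cvec.span B"
    if b: "\<And>b. b \<in> B \<Longrightarrow> w * b \<in> rat_cvec.span B" and v: "v \<in> rat_cvec.span B" for w v
    using v
  proof (induction rule: rat_cvec.span_induct_alt)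
    case base then show ?case by (simp add: rat_cvec.span_zero)
  next
    case (step c b z)
    have "w * (of_rat c * b + z) = of_rat c * (w * b) + w * z" by (simp add: algebra_simps)
    then show ?case using step b by (metis rat_cvec.span_add rat_cvec.span_scale)
  qed
  show ?thesis
  proof (rule that[of B])
    show "finite B" by (simp add: B_def)
    show "1 \<in> rat_cvec.span B" using base[of 0 0] mn by simp
    show "x * v \<in> rat_cvec.span B" if "v \<in> rat_cvec.span B" for v
      by (rule ext[OF _ that]) (auto simp: B_def X[unfolded B_def])
    show "y * v \<in> rat_cvec.span B" if "v \<in> rat_cvec.span B" for v
      by (rule ext[OF _ that]) (auto simp: B_def Y[unfolded B_def])
  qed
qed

lemma
  fixes x y :: complex
  assumes "algebraic x" "algebraic y"
  shows algebraic_add: "algebraic (x + y)"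
    and algebraic_mult: "algebraic (x * y)"
proof -
  obtain B where B: "finite B" "1 \<in> rat_cvec.span B"
    "\<And>v. v \<in> rat_cvec.span B \<Longrightarrow> x * v \<in> rat_cvec.span B"
    "\<And>v. v \<in> rat_cvec.span B \<Longrightarrow> y * v \<in> rat_cvec.span B"
    by (rule algebraic_finite_stable_span[OF assms]) (rule that)
  have "(x + y) * v \<in> rat_cvec.span B" if "v \<in> rat_cvec.span B" for v
    unfolding distrib_right by (rule rat_cvec.span_add[OF B(3)[OF that] B(4)[OF that]])
  then show "algebraic (x + y)" by (rule algebraic_if_stable_span[OF B(1,2)])
  have "(x * y) * v \<in> rat_cvec.span B" if "v \<in> rat_cvec.span B" for v
    unfolding mult.assoc by (rule B(3)[OF B(4)[OF that]])
  then show "algebraic (x * y)" by (rule algebraic_if_stable_span[OF B(1,2)])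
qed

lemma algebraic_diff: "algebraic x \<Longrightarrow> algebraic y \<Longrightarrow> algebraic (x - y)" for x y :: complex
  unfolding diff_conv_add_uminus by (intro algebraic_add algebraic_minus)

lemma algebraic_one: "algebraic (1 :: complex)"
  by (rule rat_imp_algebraic[OF Rats_1])

lemma algebraic_prod:
  fixes f :: "'a \<Rightarrow> complex"
  assumes "\<And>i. i \<in> I \<Longrightarrow> algebraic (f i)"
  shows "algebraic (\<Prod>i\<in>I. f i)"
  using assms
proof (induction I rule: infinite_finite_induct)
  case (infinite A)
  then show ?case by (simp add: algebraic_one)
next
  case empty
  show ?case by (simp add: algebraic_one)
next
  case (insert a A)
  then have "algebraic (f a * prod f A)" by (intro algebraic_mult) blast+
  then show ?case using insert.hyps by simp
qed

lemma algebraic_power: "algebraic x \<Longrightarrow> algebraic (x ^ n)" for x :: complex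
  using algebraic_prod[of "{..<n}" "\<lambda>_. x"] by (simp only: prod_constant card_lessThan)

section \<open>Extending field isomorphisms\<close>

definition subring2 :: "(complex \<times> complex) set \<Rightarrow> bool" where
  "subring2 R \<longleftrightarrow> (1, 1) \<in> R \<and>
     (\<forall>x y x' y'. (x, y) \<in> R \<longrightarrow> (x', y') \<in> R \<longrightarrow>
        (x - x', y - y') \<in> R \<and> (x * x', y * y') \<in> R)"

text \<open>The graph of an isomorphism between two subrings: in a subring of \<open>\<complex> \<times> \<complex>\<close>, the condition on zeros
  already makes the relation single-valued and injective. Relations are preferred to functions because
  the inverse isomorphism and the union of a chain are then immediate.\<close>

definition iso_graph :: "(complex \<times> complex) set \<Rightarrow> bool" where
  "iso_graph R \<longleftrightarrow> subring2 R \<and> (\<forall>(x, y) \<in> R. x = 0 \<longleftrightarrow> y = 0)"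

lemma
  assumes "subring2 R"
  shows subring2_one: "(1, 1) \<in> R" and subring2_zero: "(0, 0) \<in> R"
    and subring2_diff: "(x, y) \<in> R \<Longrightarrow> (x', y') \<in> R \<Longrightarrow> (x - x', y - y') \<in> R"
    and subring2_mult: "(x, y) \<in> R \<Longrightarrow> (x', y') \<in> R \<Longrightarrow> (x * x', y * y') \<in> R"
    and subring2_add: "(x, y) \<in> R \<Longrightarrow> (x', y') \<in> R \<Longrightarrow> (x + x', y + y') \<in> R"
proof -
  show 1: "(1, 1) \<in> R" and d: "\<And>x y x' y'. (x, y) \<in> R \<Longrightarrow> (x', y') \<in> R \<Longrightarrow> (x - x', y - y') \<in> R"
    and "\<And>x y x' y'. (x, y) \<in> R \<Longrightarrow> (x', y') \<in> R \<Longrightarrow> (x * x', y * y') \<in> R"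
    using assms unfolding subring2_def by blast+
  show 0: "(0, 0) \<in> R" using d[OF 1 1] by simp
  fix x y x' y' assume "(x, y) \<in> R" "(x', y') \<in> R"
  then show "(x + x', y + y') \<in> R" using d[OF _ d[OF 0]] by force
qed

lemma subring2_sum:
  assumes "subring2 R" "\<And>i. i \<in> I \<Longrightarrow> (f i, g i) \<in> R"
  shows "((\<Sum>i\<in>I. f i), (\<Sum>i\<in>I. g i)) \<in> R"
  using assms(2)
proof (induction I rule: infinite_finite_induct)
  case (insert a A)
  then show ?case using subring2_add[OF assms(1)] by simp
qed (simp_all add: subring2_zero[OF assms(1)])

lemma subring2_power: "subring2 R \<Longrightarrow> (x, y) \<in> R \<Longrightarrow> (x ^ n, y ^ n) \<in> R"
  by (induction n) (simp_all add: subring2_one subring2_mult)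

lemma subring2_of_int:
  assumes R: "subring2 R" shows "(of_int k, of_int k) \<in> R"
proof -
  have n: "(of_nat n, of_nat n) \<in> R" for n
    by (induction n) (simp_all add: subring2_zero[OF R] subring2_one[OF R] subring2_add[OF R])
  show ?thesis
  proof (cases "k \<ge> 0")
    case True then show ?thesis using n[of "nat k"] by simp
  next
    case False then show ?thesis
      using subring2_diff[OF R subring2_zero[OF R] n[of "nat (- k)"]] by simp
  qed
qed

lemma subring2_ipoly:
  assumes "subring2 R" "(x, y) \<in> R" shows "(ipoly p x, ipoly p y) \<in> R"
  unfolding poly_altdef degree_cpoly
  by (intro subring2_sum subring2_mult subring2_power subring2_of_int assms)
     (simp add: coeff_map_poly subring2_of_int[OF assms(1)])

definition poly_pair :: "(complex \<times> complex) set \<Rightarrow> complex poly \<Rightarrow> complex poly \<Rightarrow> bool" where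
  "poly_pair R f g \<longleftrightarrow> (\<forall>i. (coeff f i, coeff g i) \<in> R)"

text \<open>The candidate extension that sends \<open>a\<close> to \<open>b\<close>.\<close>

definition adjoin :: "(complex \<times> complex) set \<Rightarrow> complex \<Rightarrow> complex \<Rightarrow> (complex \<times> complex) set" where
  "adjoin R a b = {(poly f a, poly g b) | f g. poly_pair R f g}"

lemma
  assumes R: "subring2 R"
  shows poly_pair_diff: "poly_pair R f g \<Longrightarrow> poly_pair R f' g' \<Longrightarrow> poly_pair R (f - f') (g - g')"
    and poly_pair_mult: "poly_pair R f g \<Longrightarrow> poly_pair R f' g' \<Longrightarrow> poly_pair R (f * f') (g * g')"
    and poly_pair_monom: "(c, c') \<in> R \<Longrightarrow> poly_pair R (monom c n) (monom c' n)"
    and poly_pair_cpoly: "poly_pair R (cpoly p) (cpoly p)"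
  using R unfolding poly_pair_def
  by (auto simp: coeff_mult coeff_map_poly intro!: subring2_diff subring2_sum subring2_mult subring2_of_int subring2_zero)

lemma poly_pair_add:
  assumes R: "subring2 R" and "poly_pair R f g" "poly_pair R f' g'"
  shows "poly_pair R (f + f') (g + g')"
  using assms unfolding poly_pair_def by (auto intro: subring2_add)

lemma poly_pair_const: "subring2 R \<Longrightarrow> (c, c') \<in> R \<Longrightarrow> poly_pair R [:c:] [:c':]"
  using poly_pair_monom[of R c c' 0] by (simp add: monom_0)

lemma subring2_adjoin:
  assumes R: "subring2 R" shows "subring2 (adjoin R a b)"
  unfolding subring2_def
proof (intro conjI allI impI)
  show "(1, 1) \<in> adjoin R a b"
    unfolding adjoin_def using poly_pair_const[OF R subring2_one[OF R]]
    by (auto intro!: exI[of _ "[:1:]"])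
next
  fix x y x' y' assume "(x, y) \<in> adjoin R a b" "(x', y') \<in> adjoin R a b"
  then obtain f g f' g' where fg: "poly_pair R f g" "poly_pair R f' g'"
    "x = poly f a" "y = poly g b" "x' = poly f' a" "y' = poly g' b"
    unfolding adjoin_def by blast
  show "(x - x', y - y') \<in> adjoin R a b" "(x * x', y * y') \<in> adjoin R a b"
    unfolding adjoin_def mem_Collect_eq prod.inject
    using poly_pair_diff[OF R fg(1,2)] poly_pair_mult[OF R fg(1,2)]
    by (metis fg(3-) poly_diff poly_mult)+
qed

lemma adjoin_extends:
  assumes R: "subring2 R" shows "R \<subseteq> adjoin R a b" "(a, b) \<in> adjoin R a b"
proof -
  show "R \<subseteq> adjoin R a b"
    unfolding adjoin_def using poly_pair_const[OF R] by (fastforce intro!: exI[of _ "[:_:]"])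
  show "(a, b) \<in> adjoin R a b"
    unfolding adjoin_def using poly_pair_monom[OF R subring2_one[OF R], of 1]
    by (fastforce simp: poly_monom intro!: exI[of _ "monom 1 1"])
qed

lemma iso_graph_zero: "iso_graph R \<Longrightarrow> (x, y) \<in> R \<Longrightarrow> x = 0 \<longleftrightarrow> y = 0"
  unfolding iso_graph_def by blast

lemma poly_pair_degree:
  assumes R: "iso_graph R" and fg: "poly_pair R f g"
  shows "degree f = degree g" "f = 0 \<longleftrightarrow> g = 0"
proof -
  have c: "coeff f i = 0 \<longleftrightarrow> coeff g i = 0" for i
    using fg iso_graph_zero[OF R] unfolding poly_pair_def by blast
  show "f = 0 \<longleftrightarrow> g = 0" using c by (auto simp: poly_eq_iff)
  show "degree f = degree g"
    by (intro antisym degree_le) (auto simp: c[symmetric] coeff_eq_0 c)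
qed

lemma poly_pair_converse: "poly_pair (R\<inverse>) g f \<longleftrightarrow> poly_pair R f g"
  by (simp add: poly_pair_def)

lemma iso_graph_converse: "iso_graph R \<Longrightarrow> iso_graph (R\<inverse>)"
  by (auto simp: iso_graph_def subring2_def)

definition least_vanishing ::
  "(complex \<times> complex) set \<Rightarrow> complex \<Rightarrow> complex poly \<Rightarrow> complex poly \<Rightarrow> bool" where
  "least_vanishing R a m m' \<longleftrightarrow> poly_pair R m m' \<and> m \<noteq> 0 \<and> poly m a = 0 \<and>
     (\<forall>f g. poly_pair R f g \<longrightarrow> f \<noteq> 0 \<longrightarrow> poly f a = 0 \<longrightarrow> degree m \<le> degree f)"

lemma
  assumes "least_vanishing R a m m'"
  shows least_vanishing_pair: "poly_pair R m m'" and least_vanishing_nonzero: "m \<noteq> 0"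
    and least_vanishing_root: "poly m a = 0"
    and least_vanishing_degree:
      "poly_pair R f g \<Longrightarrow> f \<noteq> 0 \<Longrightarrow> poly f a = 0 \<Longrightarrow> degree m \<le> degree f"
  using assms unfolding least_vanishing_def by blast+

lemma least_vanishing_exists:
  assumes "poly_pair R f g" "f \<noteq> 0" "poly f a = 0"
  obtains m m' where "least_vanishing R a m m'"
proof -
  define P where "P = (\<lambda>(f, g). poly_pair R f g \<and> f \<noteq> 0 \<and> poly f a = 0)"
  have "P (f, g)" using assms by (simp add: P_def)
  from ex_has_least_nat[of P, OF this, of "\<lambda>z. degree (fst z)"]
  obtain mm where mm: "P mm" "\<And>z. P z \<Longrightarrow> degree (fst mm) \<le> degree (fst z)" by blast
  obtain m m' where "mm = (m, m')" by (cases mm)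
  with mm have "P (m, m')" "\<And>z. P z \<Longrightarrow> degree m \<le> degree (fst z)" by simp_all
  then have "least_vanishing R a m m'"
    unfolding least_vanishing_def P_def by fastforce
  then show thesis by (rule that)
qed

text \<open>Pseudo-division, because subrings need not contain inverses; the factor \<open>c\<close> collects the leading
  coefficients by which one has to multiply.\<close>

lemma poly_pair_pseudo_division:
  assumes R: "iso_graph R" and least: "least_vanishing R a m m'"
    and fg: "poly_pair R f g" "poly f a = 0"
  shows "\<exists>c c' q q'. (c, c') \<in> R \<and> c \<noteq> 0 \<and> poly_pair R q q' \<and> smult c f = q * m \<and> smult c' g = q' * m'"
  using fg
proof (induction "if f = 0 then 0 else Suc (degree f)" arbitrary: f g rule: less_induct)
  case less
  have R2: "subring2 R" using R by (simp add: iso_graph_def)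
  note m = least_vanishing_pair[OF least] least_vanishing_nonzero[OF least] least_vanishing_root[OF least]
  note dm = poly_pair_degree[OF R m(1)] note df = poly_pair_degree[OF R less.prems(1)]
  show ?case
  proof (cases "f = 0")
    case True
    then have "g = 0" using df by simp
    then show ?thesis using True subring2_one[OF R2] poly_pair_const[OF R2 subring2_zero[OF R2]]
      by (intro exI[of _ 1] exI[of _ 0]) simp
  next
    case False
    define k where "k = degree f - degree m"
    have le: "degree m \<le> degree f" 
      by (rule least_vanishing_degree[OF least less.prems(1) False less.prems(2)])
    let ?q = "monom (lead_coeff f) k" and ?q' = "monom (lead_coeff g) k"
    let ?l = "lead_coeff m" and ?l' = "lead_coeff m'"
    have ll: "(?l, ?l') \<in> R" "(lead_coeff f, lead_coeff g) \<in> R"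
      using m(1) less.prems(1) dm df unfolding poly_pair_def by metis+
    have pq: "poly_pair R ?q ?q'" using ll by (intro poly_pair_monom[OF R2])
    define f1 where "f1 = smult ?l f - ?q * m"
    define g1 where "g1 = smult ?l' g - ?q' * m'"
    have sm: "poly_pair R (smult c u) (smult c' v)" if "(c, c') \<in> R" "poly_pair R u v" for c c' u v
      using that unfolding poly_pair_def by (auto intro: subring2_mult[OF R2])
    have p1: "poly_pair R f1 g1" unfolding f1_def g1_def
      by (intro poly_pair_diff[OF R2] poly_pair_mult[OF R2] sm ll pq m less.prems)
    have a1: "poly f1 a = 0" using less.prems m by (simp add: f1_def)
    have l0: "?l \<noteq> 0" using m by simp
    have "degree f1 < degree f" if "f1 \<noteq> 0"
    proof -
      have d1: "degree (smult ?l f) = degree f" using l0 by simp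
      have dq: "degree ?q = k" "?q \<noteq> 0" using False by (simp_all add: degree_monom_eq)
      have "degree (?q * m) = degree ?q + degree m" by (rule degree_mult_eq[OF dq(2) m(2)])
      moreover have "k + degree m = degree f" using le by (simp add: k_def)
      ultimately have d2: "degree (?q * m) = degree f" unfolding dq(1) by (rule trans)
      have "lead_coeff (?q * m) = coeff ?q k * ?l" unfolding lead_coeff_mult dq(1) ..
      then have "lead_coeff (smult ?l f) = lead_coeff (?q * m)" using d1 by simp
      then have "coeff f1 (degree f) = 0" unfolding f1_def coeff_diff d1 d2 by simp
      moreover have "degree f1 \<le> degree f" unfolding f1_def using d1 d2 by (intro degree_diff_le) auto
      ultimately show ?thesis using that by (metis le_neq_implies_less leading_coeff_0_iff)
    qed
    then have "(if f1 = 0 then 0 else Suc (degree f1)) < (if f = 0 then 0 else Suc (degree f))"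
      using False by auto
    from less.hyps[OF this p1 a1] obtain c c' u u' where
      IH: "(c, c') \<in> R" "c \<noteq> 0" "poly_pair R u u'" "smult c f1 = u * m" "smult c' g1 = u' * m'"
      by blast
    have "smult (c * ?l) f = (u + smult c ?q) * m"
      using IH(4) by (simp add: f1_def smult_diff_right distrib_left diff_eq_eq mult.commute)
    moreover have "smult (c' * ?l') g = (u' + smult c' ?q') * m'"
      using IH(5) by (simp add: g1_def smult_diff_right distrib_left diff_eq_eq mult.commute)
    moreover have "(c * ?l, c' * ?l') \<in> R" "c * ?l \<noteq> 0"
      using IH ll l0 subring2_mult[OF R2] by auto
    moreover have "poly_pair R (u + smult c ?q) (u' + smult c' ?q')"
      by (intro poly_pair_add[OF R2] sm IH pq)
    ultimately show ?thesis by blast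
  qed
qed

text \<open>One half of the well-definedness of the extension; the other half is the same statement for the
  converse relation.\<close>

lemma adjoin_root_direct:
  assumes R: "iso_graph R" and least: "least_vanishing R a m m'" and b: "poly m' b = 0"
    and fg: "poly_pair R f g" "poly f a = 0"
  shows "poly g b = 0"
proof -
  obtain c c' q q' where q: "(c, c') \<in> R" "c \<noteq> 0" "smult c' g = q' * m'"
    using poly_pair_pseudo_division[OF R least fg] by blast
  then have c': "c' \<noteq> 0" using iso_graph_zero[OF R] by blast
  have "c' * poly g b = poly (smult c' g) b" by simp
  also have "\<dots> = 0" using b by (simp add: q(3))
  finally show ?thesis using c' by simp
qed

text \<open>If \<open>p'\<close> has least degree among the polynomials over the range that vanish at \<open>b\<close>, then \<open>p'\<close>
  pseudo-divides \<open>m'\<close>, hence \<open>p\<close> pseudo-divides \<open>m\<close>. Minimality of \<open>m\<close> forces \<open>p\<close> to vanish at \<open>a\<close>, and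
  the pair \<open>p', p\<close> then controls the converse relation as \<open>m, m'\<close> controls the relation itself.\<close>

lemma iso_graph_adjoin:
  assumes R: "iso_graph R" and least: "least_vanishing R a m m'" and b: "poly m' b = 0"
  shows "iso_graph (adjoin R a b)"
proof -
  have R2: "subring2 R" using R by (simp add: iso_graph_def)
  note Rc = iso_graph_converse[OF R]
  note m = least_vanishing_pair[OF least] least_vanishing_nonzero[OF least] least_vanishing_root[OF least]
  have m'0: "m' \<noteq> 0" using poly_pair_degree(2)[OF R m(1)] m(2) by simp
  have mc: "poly_pair (R\<inverse>) m' m" using m by (simp add: poly_pair_converse)
  obtain p' p where leastc: "least_vanishing (R\<inverse>) b p' p"
    using least_vanishing_exists[OF mc m'0 b] .
  have p: "poly_pair R p p'" "p' \<noteq> 0" "poly p' b = 0"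
    using least_vanishing_pair[OF leastc] least_vanishing_nonzero[OF leastc]
      least_vanishing_root[OF leastc] by (simp_all add: poly_pair_converse)
  note dp = poly_pair_degree[OF R p(1)]
  obtain c' c q' q where q: "(c', c) \<in> R\<inverse>" "c' \<noteq> 0" "poly_pair (R\<inverse>) q' q"
    "smult c' m' = q' * p'" "smult c m = q * p"
    using poly_pair_pseudo_division[OF Rc leastc mc b] by blast
  have c0: "c \<noteq> 0" using q iso_graph_zero[OF R] by blast
  have qp0: "q \<noteq> 0" "p \<noteq> 0" using q(5) c0 m(2) by auto
  have deg: "degree m = degree q + degree p"
    using q(5) c0 qp0 by (metis degree_mult_eq degree_smult_eq)
  have p_pos: "degree p > 0"
  proof (rule ccontr)
    assume "\<not> ?thesis" then obtain e where "p' = [:e:]" using dp by (metis degree_eq_zeroE gr0I)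
    then show False using p by auto
  qed
  have "poly q a * poly p a = poly (smult c m) a" by (simp add: q(5))
  then have "poly q a = 0 \<or> poly p a = 0" using m by simp
  moreover have "poly q a \<noteq> 0"
    using least_vanishing_degree[OF least, of q q'] q(3) qp0 deg p_pos by (auto simp: poly_pair_converse)
  ultimately have pa: "poly p a = 0" by simp
  have "poly f a = 0 \<longleftrightarrow> poly g b = 0" if fg: "poly_pair R f g" for f g
  proof
    show "poly f a = 0 \<Longrightarrow> poly g b = 0" using adjoin_root_direct[OF R least b fg] .
    have gf: "poly_pair (R\<inverse>) g f" using fg by (simp add: poly_pair_converse)
    show "poly g b = 0 \<Longrightarrow> poly f a = 0"
      using adjoin_root_direct[OF Rc leastc pa gf] .
  qed
  then show ?thesis unfolding iso_graph_def using subring2_adjoin[OF R2]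
    by (auto simp: adjoin_def)
qed

lemma iso_graph_extend:
  assumes R: "iso_graph R" and a: "algebraic a"
  obtains R' b where "iso_graph R'" "R \<subseteq> R'" "(a, b) \<in> R'"
proof -
  have R2: "subring2 R" using R by (simp add: iso_graph_def)
  obtain p where "p \<noteq> 0" "ipoly p a = 0" using a by (elim algebraicE')
  then obtain m m' where least: "least_vanishing R a m m'"
    using least_vanishing_exists[OF poly_pair_cpoly[OF R2, of p]] by auto
  note m = least_vanishing_pair[OF least] least_vanishing_nonzero[OF least] least_vanishing_root[OF least]
  have "degree m > 0"
  proof (rule ccontr)
    assume "\<not> ?thesis" then obtain e where "m = [:e:]" by (metis degree_eq_zeroE gr0I)
    then show False using m by auto
  qed
  then have "degree m' > 0" using poly_pair_degree[OF R m(1)] by simp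
  then obtain b where b: "poly m' b = 0"
    using fundamental_theorem_of_algebra[of m'] by (auto simp: constant_degree)
  show thesis
    using that[OF iso_graph_adjoin[OF R least b] adjoin_extends[OF R2]] .
qed

lemma iso_graph_Union_chain:
  assumes C: "subset.chain {R. iso_graph R} C" and ne: "C \<noteq> {}"
  shows "iso_graph (\<Union>C)"
  unfolding iso_graph_def
proof (intro conjI)
  have iso: "iso_graph R" if "R \<in> C" for R using C that by (auto simp: subset.chain_def)
  have dir: "\<exists>T\<in>C. z \<in> T \<and> w \<in> T" if zw: "z \<in> \<Union>C" "w \<in> \<Union>C" for z w
  proof -
    obtain T U where TU: "T \<in> C" "U \<in> C" "z \<in> T" "w \<in> U" using zw by blast
    then have "T \<subseteq> U \<or> U \<subseteq> T" using C unfolding subset.chain_def by blast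
    then show ?thesis using TU by blast
  qed
  show "subring2 (\<Union>C)" unfolding subring2_def
  proof (intro conjI allI impI)
    show "(1, 1) \<in> \<Union>C" using ne iso subring2_one unfolding iso_graph_def by blast
  next
    fix x y x' y' assume "(x, y) \<in> \<Union>C" "(x', y') \<in> \<Union>C"
    then obtain T where T: "T \<in> C" "(x, y) \<in> T" "(x', y') \<in> T" using dir by blast
    have "subring2 T" using iso[OF T(1)] by (simp add: iso_graph_def)
    then show "(x - x', y - y') \<in> \<Union>C" "(x * x', y * y') \<in> \<Union>C"
      using T subring2_diff subring2_mult by blast+
  qed
  show "\<forall>(x, y)\<in>\<Union>C. (x = 0) = (y = 0)" using iso iso_graph_zero by blast
qed

text \<open>A maximal extension contains every algebraic number in its domain, since otherwise one could be
  adjoined.\<close>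

lemma iso_graph_algebraic_extension:
  assumes R0: "iso_graph R0"
  obtains R where "iso_graph R" "R0 \<subseteq> R" "\<And>a. algebraic a \<Longrightarrow> \<exists>b. (a, b) \<in> R"
proof -
  define \<R> where "\<R> = {R. iso_graph R \<and> R0 \<subseteq> R}"
  have "\<exists>M\<in>\<R>. \<forall>X\<in>\<R>. M \<subseteq> X \<longrightarrow> X = M"
  proof (rule subset_Zorn_nonempty)
    show "\<R> \<noteq> {}" using R0 by (auto simp: \<R>_def)
    fix C assume ne: "C \<noteq> {}" and C: "subset.chain \<R> C"
    have "subset.chain {R. iso_graph R} C" using C by (auto simp: subset.chain_def \<R>_def)
    then have "iso_graph (\<Union>C)" using iso_graph_Union_chain ne by blast
    moreover have "R0 \<subseteq> \<Union>C" using ne C unfolding subset.chain_def \<R>_def by blast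
    ultimately show "\<Union>C \<in> \<R>" by (simp add: \<R>_def)
  qed
  then obtain M where M: "iso_graph M" "R0 \<subseteq> M" and max: "\<And>X. iso_graph X \<Longrightarrow> M \<subseteq> X \<Longrightarrow> X = M"
    by (auto simp: \<R>_def)
  show thesis
  proof (rule that[OF M])
    fix a :: complex assume "algebraic a"
    with M(1) obtain R' b where "iso_graph R'" "M \<subseteq> R'" "(a, b) \<in> R'" by (rule iso_graph_extend)
    then show "\<exists>b. (a, b) \<in> M" using max by blast
  qed
qed

text \<open>Surjectivity is automatic: the map permutes the finitely many conjugates of each algebraic number
  injectively.\<close>

lemma galois_group_of_iso_graph:
  assumes R: "iso_graph R" and dom: "\<And>a. algebraic a \<Longrightarrow> \<exists>b. (a, b) \<in> R"
  obtains \<sigma> where "\<sigma> \<in> galois_group" "\<And>a. algebraic a \<Longrightarrow> (a, \<sigma> a) \<in> R"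
proof -
  have R2: "subring2 R" using R by (simp add: iso_graph_def)
  have uniq: "x = x' \<longleftrightarrow> y = y'" if "(x, y) \<in> R" "(x', y') \<in> R" for x y x' y'
    using iso_graph_zero[OF R subring2_diff[OF R2 that]] by simp
  define \<sigma> where "\<sigma> = (\<lambda>a. SOME b. (a, b) \<in> R)"
  have s: "(a, \<sigma> a) \<in> R" if "algebraic a" for a
    unfolding \<sigma>_def using dom[OF that] by (rule someI_ex)
  have eqI: "\<sigma> a = b" if "algebraic a" "(a, b) \<in> R" for a b using uniq[OF s[OF that(1)] that(2)] by simp
  have root: "ipoly p (\<sigma> a) = 0 \<longleftrightarrow> ipoly p a = 0" if "algebraic a" for p a
    using iso_graph_zero[OF R subring2_ipoly[OF R2 s[OF that]]] by simp
  have alg: "algebraic (\<sigma> a)" if "algebraic a" for a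
    using that root[OF that] algebraic_conjugate int_min_poly_root by blast
  have inj: "inj_on \<sigma> algebraic_numbers"
    by (rule inj_onI) (use uniq[OF s s] in \<open>simp add: algebraic_numbers_def\<close>)
  have "\<sigma> ` algebraic_numbers = algebraic_numbers"
  proof
    show "\<sigma> ` algebraic_numbers \<subseteq> algebraic_numbers" using alg by (auto simp: algebraic_numbers_def)
    show "algebraic_numbers \<subseteq> \<sigma> ` algebraic_numbers"
    proof
      fix y assume "y \<in> algebraic_numbers"
      then have y: "algebraic y" by (simp add: algebraic_numbers_def)
      have cs: "conjugates y \<subseteq> algebraic_numbers"
        using algebraic_conjugate[OF y] by (auto simp: conjugates_def algebraic_numbers_def)
      have "\<sigma> ` conjugates y \<subseteq> conjugates y"
        using cs root by (auto simp: conjugates_def algebraic_numbers_def)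
      moreover have "inj_on \<sigma> (conjugates y)" using inj cs by (rule inj_on_subset)
      ultimately have "\<sigma> ` conjugates y = conjugates y"
        using endo_inj_surj[OF finite_conjugates[OF y]] by blast
      then show "y \<in> \<sigma> ` algebraic_numbers" using self_mem_conjugates[OF y] cs by blast
    qed
  qed
  then have bij: "bij_betw \<sigma> algebraic_numbers algebraic_numbers" using inj by (simp add: bij_betw_def)
  have "\<sigma> q = q" if q: "q \<in> \<rat>" for q
  proof -
    obtain a b where ab: "b > 0" "q = of_int a / of_int b" using q by (rule Rats_cases')
    have qa: "algebraic q" using q by (rule rat_imp_algebraic)
    have "(of_int b * q - of_int a, of_int b * \<sigma> q - of_int a) \<in> R"
      by (intro subring2_diff[OF R2] subring2_mult[OF R2] subring2_of_int[OF R2] s qa)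
    moreover have "of_int b * q - of_int a = 0" using ab by simp
    ultimately have "of_int b * \<sigma> q - of_int a = 0" using iso_graph_zero[OF R] by blast
    then have "\<sigma> q = of_int a / of_int b" using ab(1) by (simp add: eq_divide_eq mult.commute)
    then show ?thesis using ab(2) by simp
  qed
  moreover have "\<sigma> (x + y) = \<sigma> x + \<sigma> y" "\<sigma> (x * y) = \<sigma> x * \<sigma> y" if "algebraic x" "algebraic y" for x y
    by (rule eqI, rule algebraic_add algebraic_mult, (rule that)+,
        rule subring2_add[OF R2] subring2_mult[OF R2], (rule s, rule that)+)+
  ultimately have "\<sigma> \<in> galois_group"
    using bij by (auto simp: galois_group_def algebraic_numbers_def)
  then show thesis using s that by blast
qed

text \<open>The isomorphism over the integers that sends \<open>x\<close> to its conjugate \<open>y\<close> extends to the algebraic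
  closure.\<close>

lemma galois_transitive:
  assumes x: "algebraic x" and y: "y \<in> conjugates x"
  obtains \<sigma> where "\<sigma> \<in> galois_group" "\<sigma> x = y"
proof -
  have y': "ipoly (int_min_poly x) y = 0" using y by (simp add: conjugates_def)
  define R0 :: "(complex \<times> complex) set" where "R0 = {(of_int k, of_int k) | k. True}"
  have R0: "iso_graph R0"
    unfolding iso_graph_def subring2_def
  proof (intro conjI allI impI)
    show "(1, 1) \<in> R0" unfolding R0_def by (rule CollectI, rule exI[of _ 1]) simp
    show "\<forall>(x, y)\<in>R0. (x = 0) = (y = 0)" by (auto simp: R0_def)
    fix x y x' y' assume "(x, y) \<in> R0" "(x', y') \<in> R0"
    then obtain k l where "x = of_int k" "y = of_int k" "x' = of_int l" "y' = of_int l"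
      by (auto simp: R0_def)
    then have "(x - x', y - y') = (of_int (k - l), of_int (k - l))"
      "(x * x', y * y') = (of_int (k * l), of_int (k * l))" by simp_all
    then show "(x - x', y - y') \<in> R0" "(x * x', y * y') \<in> R0" unfolding R0_def by blast+
  qed
  have cp: "\<exists>p. f = cpoly p \<and> g = cpoly p" if "poly_pair R0 f g" for f g
  proof -
    have *: "\<forall>i. \<exists>k. coeff f i = of_int k \<and> coeff g i = of_int k"
      using that unfolding poly_pair_def R0_def by blast
    then have "\<And>i. coeff f i \<in> \<int>" by (metis Ints_of_int)
    then obtain p where p: "f = cpoly p" by (metis intpolyE)
    have "f = g" by (rule poly_eqI) (metis *)
    then show ?thesis using p by blast
  qed
  let ?m = "cpoly (int_min_poly x)"
  have R2: "subring2 R0" using R0 by (simp add: iso_graph_def)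
  have "least_vanishing R0 x ?m ?m"
    unfolding least_vanishing_def
  proof (intro conjI allI impI)
    show "?m \<noteq> 0" using int_min_poly_nonzero[OF x] by simp
    show "poly ?m x = 0" by (rule int_min_poly_root[OF x])
    show "poly_pair R0 ?m ?m" by (rule poly_pair_cpoly[OF R2])
    fix f g assume fg: "poly_pair R0 f g" "f \<noteq> 0" "poly f x = 0"
    then obtain p where p: "f = cpoly p" using cp by blast
    then show "degree ?m \<le> degree f" using fg degree_int_min_poly_le[OF x, of p] by simp
  qed
  from iso_graph_adjoin[OF R0 this y'] have "iso_graph (adjoin R0 x y)" .
  then obtain R where R: "iso_graph R" "adjoin R0 x y \<subseteq> R" "\<And>a. algebraic a \<Longrightarrow> \<exists>b. (a, b) \<in> R"
    by (rule iso_graph_algebraic_extension) (rule that)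
  obtain \<sigma> where s: "\<sigma> \<in> galois_group" "\<And>a. algebraic a \<Longrightarrow> (a, \<sigma> a) \<in> R"
    by (rule galois_group_of_iso_graph[OF R(1)]) (erule R(3), rule that)
  have xy: "(x, y) \<in> R" using adjoin_extends(2)[OF R2] R(2) by blast
  have "subring2 R" using R(1) by (simp add: iso_graph_def)
  from subring2_diff[OF this s(2)[OF x] xy] have "(0, \<sigma> x - y) \<in> R" by simp
  from iso_graph_zero[OF R(1) this] have "\<sigma> x = y" by simp
  with s(1) show thesis by (rule that)
qed

section \<open>Galois orbits\<close>

lemma
  assumes s: "\<sigma> \<in> galois_group"
  shows galois_add: "algebraic x \<Longrightarrow> algebraic y \<Longrightarrow> \<sigma> (x + y) = \<sigma> x + \<sigma> y"
    and galois_mult: "algebraic x \<Longrightarrow> algebraic y \<Longrightarrow> \<sigma> (x * y) = \<sigma> x * \<sigma> y"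
    and galois_rat: "q \<in> \<rat> \<Longrightarrow> \<sigma> q = q"
    and galois_algebraic: "algebraic x \<Longrightarrow> algebraic (\<sigma> x)"
    and galois_inj: "algebraic x \<Longrightarrow> algebraic y \<Longrightarrow> \<sigma> x = \<sigma> y \<longleftrightarrow> x = y"
    and galois_surj: "algebraic x \<Longrightarrow> \<exists>y. algebraic y \<and> \<sigma> y = x"
proof -
  have bij: "bij_betw \<sigma> {x. algebraic x} {x. algebraic x}"
    and ops: "\<And>x y. algebraic x \<Longrightarrow> algebraic y \<Longrightarrow> \<sigma> (x + y) = \<sigma> x + \<sigma> y \<and> \<sigma> (x * y) = \<sigma> x * \<sigma> y"
    and rat: "\<And>q. q \<in> \<rat> \<Longrightarrow> \<sigma> q = q"
    using s by (auto simp: galois_group_def algebraic_numbers_def)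
  note im = bij_betw_imp_surj_on[OF bij] and inj = bij_betw_imp_inj_on[OF bij]
  show "algebraic x \<Longrightarrow> algebraic y \<Longrightarrow> \<sigma> (x + y) = \<sigma> x + \<sigma> y"
    and "algebraic x \<Longrightarrow> algebraic y \<Longrightarrow> \<sigma> (x * y) = \<sigma> x * \<sigma> y" using ops by auto
  show "q \<in> \<rat> \<Longrightarrow> \<sigma> q = q" by (rule rat)
  show "algebraic x \<Longrightarrow> algebraic (\<sigma> x)" using im by blast
  show "algebraic x \<Longrightarrow> algebraic y \<Longrightarrow> \<sigma> x = \<sigma> y \<longleftrightarrow> x = y" using inj_on_eq_iff[OF inj] by simp
  show "\<exists>y. algebraic y \<and> \<sigma> y = x" if "algebraic x"
  proof -
    have "x \<in> \<sigma> ` {x. algebraic x}" using that im by simp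
    then show ?thesis by blast
  qed
qed

lemma galois_zero: "\<sigma> \<in> galois_group \<Longrightarrow> \<sigma> 0 = 0" and galois_one: "\<sigma> \<in> galois_group \<Longrightarrow> \<sigma> 1 = 1"
  by (simp_all add: galois_rat)

lemma galois_diff:
  assumes s: "\<sigma> \<in> galois_group" and xy: "algebraic x" "algebraic y"
  shows "\<sigma> (x - y) = \<sigma> x - \<sigma> y"
  using galois_add[OF s algebraic_diff[OF xy] xy(2)] by (simp add: algebra_simps)

lemma galois_prod:
  assumes s: "\<sigma> \<in> galois_group" and alg: "\<And>i. i \<in> I \<Longrightarrow> algebraic (f i)"
  shows "\<sigma> (\<Prod>i\<in>I. f i) = (\<Prod>i\<in>I. \<sigma> (f i))"
  using alg
proof (induction I rule: infinite_finite_induct)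
  case (insert a A)
  have "\<sigma> (f a * prod f A) = \<sigma> (f a) * \<sigma> (prod f A)"
    using insert.prems by (intro galois_mult[OF s] algebraic_prod) auto
  then show ?case using insert by simp
qed (simp_all add: galois_one[OF s])

lemma galois_sum:
  assumes s: "\<sigma> \<in> galois_group" and alg: "\<And>i. i \<in> I \<Longrightarrow> algebraic (f i)"
  shows "\<sigma> (\<Sum>i\<in>I. f i) = (\<Sum>i\<in>I. \<sigma> (f i))"
proof -
  have "algebraic (\<Sum>i\<in>I. f i) \<and> \<sigma> (\<Sum>i\<in>I. f i) = (\<Sum>i\<in>I. \<sigma> (f i))"
    using alg
    by (induction I rule: infinite_finite_induct)
       (simp_all add: galois_zero[OF s] galois_add[OF s] algebraic_add)
  then show ?thesis ..
qed

lemma galois_power: "\<sigma> \<in> galois_group \<Longrightarrow> algebraic x \<Longrightarrow> \<sigma> (x ^ n) = \<sigma> x ^ n"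
  using galois_prod[of \<sigma> "{..<n}" "\<lambda>_. x"] by simp

lemma galois_inverse:
  assumes s: "\<sigma> \<in> galois_group" and x: "algebraic x"
  shows "\<sigma> (inverse x) = inverse (\<sigma> x)"
proof (cases "x = 0")
  case False
  have "\<sigma> x * \<sigma> (inverse x) = \<sigma> (x * inverse x)"
    using x by (intro galois_mult[OF s, symmetric] algebraic_inverse)
  also have "\<dots> = 1" using False by (simp add: galois_one[OF s])
  finally show ?thesis by (rule inverse_unique[symmetric])
qed (simp add: galois_zero[OF s])

lemma galois_ipoly:
  assumes s: "\<sigma> \<in> galois_group" and x: "algebraic x"
  shows "\<sigma> (ipoly p x) = ipoly p (\<sigma> x)"
proof -
  have alg: "algebraic (coeff (cpoly p) i * x ^ i)" for i
    by (intro algebraic_mult algebraic_power x rat_imp_algebraic) (simp add: coeff_map_poly)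
  have "\<sigma> (\<Sum>i\<le>degree p. coeff (cpoly p) i * x ^ i) = (\<Sum>i\<le>degree p. \<sigma> (coeff (cpoly p) i * x ^ i))"
    by (rule galois_sum[OF s alg])
  also have "\<dots> = (\<Sum>i\<le>degree p. coeff (cpoly p) i * \<sigma> x ^ i)"
  proof (rule sum.cong[OF refl])
    fix i
    have "\<sigma> (coeff (cpoly p) i * x ^ i) = \<sigma> (coeff (cpoly p) i) * \<sigma> (x ^ i)"
      by (intro galois_mult[OF s] algebraic_power x rat_imp_algebraic) (simp add: coeff_map_poly)
    then show "\<sigma> (coeff (cpoly p) i * x ^ i) = coeff (cpoly p) i * \<sigma> x ^ i"
      by (simp add: coeff_map_poly galois_rat[OF s] galois_power[OF s x])
  qed
  finally show ?thesis unfolding poly_altdef degree_cpoly .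
qed

lemma galois_conjugates:
  assumes s: "\<sigma> \<in> galois_group" and x: "algebraic x" and y: "y \<in> conjugates x"
  shows "\<sigma> y \<in> conjugates x"
proof -
  have "algebraic y" using algebraic_conjugate[OF x] y by (simp add: conjugates_def)
  from galois_ipoly[OF s this, of "int_min_poly x"] show ?thesis
    using y by (simp add: conjugates_def galois_zero[OF s])
qed

text \<open>By transitivity a fixed algebraic number is its only conjugate, so its degree is 1.\<close>

lemma galois_fixed_imp_rational:
  assumes x: "algebraic x" and fixd: "\<And>\<sigma>. \<sigma> \<in> galois_group \<Longrightarrow> \<sigma> x = x"
  shows "x \<in> \<rat>"
proof -
  have "y = x" if y: "y \<in> conjugates x" for y
  proof -
    obtain \<sigma> where s: "\<sigma> \<in> galois_group" "\<sigma> x = y" using galois_transitive[OF x y] .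
    show ?thesis using fixd[OF s(1)] s(2) by simp
  qed
  then have "conjugates x = {x}" using self_mem_conjugates[OF x] by blast
  then have d: "degree (int_min_poly x) = 1" using card_conjugates[OF x] by (simp add: alg_degree_def)
  then obtain b c where bc: "int_min_poly x = [:b, c:]" "c \<noteq> 0"
  proof -
    obtain b q where q: "int_min_poly x = pCons b q" by (cases "int_min_poly x")
    then have "degree q = 0" "q \<noteq> 0" using d by (auto split: if_splits)
    then obtain c where "q = [:c:]" "c \<noteq> 0" by (metis degree_eq_zeroE pCons_0_0)
    then show thesis using that q by simp
  qed
  then have "of_int b + of_int c * x = 0" using int_min_poly_root[OF x]
    by (simp add: map_poly_pCons mult.commute)
  then have "x = - of_int b / of_int c" using bc(2) by (simp add: field_simps add_eq_0_iff)
  then show ?thesis by simp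
qed

lemma galois_compose:
  assumes "\<sigma> \<in> galois_group" "\<tau> \<in> galois_group"
  shows "\<sigma> \<circ> \<tau> \<in> galois_group"
  unfolding galois_group_def
proof (intro CollectI conjI ballI)
  show "bij_betw (\<sigma> \<circ> \<tau>) algebraic_numbers algebraic_numbers"
    using assms by (auto simp: galois_group_def intro: bij_betw_trans)
qed (use assms in \<open>auto simp: algebraic_numbers_def galois_add galois_mult galois_rat galois_algebraic\<close>)

lemma galois_inverse_exists:
  assumes s: "\<sigma> \<in> galois_group"
  obtains \<tau> where "\<tau> \<in> galois_group" "\<forall>x. algebraic x \<longrightarrow> \<tau> (\<sigma> x) = x"
proof -
  let ?A = "algebraic_numbers"
  define \<tau> where "\<tau> = inv_into ?A \<sigma>"
  have bij: "bij_betw \<sigma> ?A ?A" using s by (simp add: galois_group_def)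
  have bij': "bij_betw \<tau> ?A ?A" unfolding \<tau>_def using bij by (rule bij_betw_inv_into)
  have inv: "\<tau> (\<sigma> x) = x" if "algebraic x" for x
    unfolding \<tau>_def using bij that by (intro inv_into_f_f) (auto simp: bij_betw_def algebraic_numbers_def)
  have surj: "\<exists>u. algebraic u \<and> x = \<sigma> u" if "algebraic x" for x using galois_surj[OF s that] by blast
  have "\<tau> \<in> galois_group" unfolding galois_group_def
  proof (intro CollectI conjI ballI bij')
    fix x y assume "x \<in> ?A" "y \<in> ?A"
    then have "algebraic x" "algebraic y" by (simp_all add: algebraic_numbers_def)
    then obtain u v where u: "algebraic u" "x = \<sigma> u" and v: "algebraic v" "y = \<sigma> v"
      using surj by metis
    show "\<tau> (x + y) = \<tau> x + \<tau> y"
      using inv[OF algebraic_add[OF u(1) v(1)]] inv[OF u(1)] inv[OF v(1)] u v by (simp add: galois_add[OF s])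
    show "\<tau> (x * y) = \<tau> x * \<tau> y"
      using inv[OF algebraic_mult[OF u(1) v(1)]] inv[OF u(1)] inv[OF v(1)] u v by (simp add: galois_mult[OF s])
  next
    fix q :: complex assume "q \<in> \<rat>"
    then show "\<tau> q = q" using inv[OF rat_imp_algebraic[of q]] galois_rat[OF s] by simp
  qed
  then show thesis using inv by (intro that) blast+
qed

definition galois_act :: "(complex \<Rightarrow> complex) \<Rightarrow> complex ^ 'n \<Rightarrow> complex ^ 'n" where
  "galois_act \<sigma> \<alpha> = (\<chi> j. \<sigma> (\<alpha> $ j))"

lemma galois_act_nth [simp]: "galois_act \<sigma> \<alpha> $ j = \<sigma> (\<alpha> $ j)"
  by (simp add: galois_act_def)

lemma galois_orbit_altdef: "galois_orbit \<xi> = (\<lambda>\<sigma>. galois_act \<sigma> \<xi>) ` galois_group"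
  by (simp add: galois_orbit_def galois_act_def)

lemma id_in_galois_group: "id \<in> galois_group"
  by (simp add: galois_group_def)

lemma self_mem_galois_orbit: "\<xi> \<in> galois_orbit \<xi>"
proof -
  have "galois_act id \<xi> = \<xi>" by (simp add: galois_act_def)
  then show ?thesis unfolding galois_orbit_altdef using id_in_galois_group by (metis imageI)
qed

context
  fixes \<xi> :: "complex ^ 'n"
  assumes alg: "\<And>j. algebraic (\<xi> $ j)"
begin

lemma galois_orbit_conjugates: "\<alpha> \<in> galois_orbit \<xi> \<Longrightarrow> \<alpha> $ j \<in> conjugates (\<xi> $ j)"
  unfolding galois_orbit_altdef
  using galois_conjugates[OF _ alg[of j] self_mem_conjugates[OF alg]] by fastforce

lemma galois_orbit_algebraic: "\<alpha> \<in> galois_orbit \<xi> \<Longrightarrow> algebraic (\<alpha> $ j)"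
  unfolding galois_orbit_altdef using galois_algebraic[OF _ alg[of j]] by fastforce

lemma finite_galois_orbit: "finite (galois_orbit \<xi>)"
proof (rule finite_subset)
  show "galois_orbit \<xi> \<subseteq> (\<lambda>f. \<chi> j. f j) ` PiE UNIV (\<lambda>j. conjugates (\<xi> $ j))"
  proof
    fix \<alpha> assume "\<alpha> \<in> galois_orbit \<xi>"
    then have "(\<lambda>j. \<alpha> $ j) \<in> PiE UNIV (\<lambda>j. conjugates (\<xi> $ j))" using galois_orbit_conjugates by auto
    moreover have "\<alpha> = (\<chi> j. \<alpha> $ j)" by (simp add: vec_eq_iff)
    ultimately show "\<alpha> \<in> (\<lambda>f. \<chi> j. f j) ` PiE UNIV (\<lambda>j. conjugates (\<xi> $ j))" by blast
  qed
  show "finite ((\<lambda>f. (\<chi> j. f j) :: complex ^ 'n) ` PiE UNIV (\<lambda>j. conjugates (\<xi> $ j)))"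
    by (intro finite_imageI finite_PiE finite_conjugates alg) simp
qed

lemma galois_act_orbit:
  assumes s: "\<sigma> \<in> galois_group" and a: "\<alpha> \<in> galois_orbit \<xi>"
  shows "galois_act \<sigma> \<alpha> \<in> galois_orbit \<xi>"
proof -
  obtain \<tau> where t: "\<tau> \<in> galois_group" "\<alpha> = galois_act \<tau> \<xi>" using a by (auto simp: galois_orbit_altdef)
  have "galois_act \<sigma> \<alpha> = galois_act (\<sigma> \<circ> \<tau>) \<xi>" by (simp add: vec_eq_iff t(2))
  then show ?thesis unfolding galois_orbit_altdef using galois_compose[OF s t(1)] by blast
qed

lemma galois_act_bij:
  assumes s: "\<sigma> \<in> galois_group"
  shows "bij_betw (galois_act \<sigma>) (galois_orbit \<xi>) (galois_orbit \<xi>)"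
proof -
  have "inj_on (galois_act \<sigma>) (galois_orbit \<xi>)"
    by (rule inj_onI) (auto simp: vec_eq_iff galois_inj[OF s] galois_orbit_algebraic)
  moreover have "galois_act \<sigma> ` galois_orbit \<xi> \<subseteq> galois_orbit \<xi>" using galois_act_orbit[OF s] by blast
  ultimately show ?thesis using endo_inj_surj[OF finite_galois_orbit] by (simp add: bij_betw_def)
qed

lemma card_galois_orbit_pos: "card (galois_orbit \<xi>) > 0"
  using finite_galois_orbit self_mem_galois_orbit[of \<xi>] by (auto simp: card_gt_0_iff)

text \<open>The Galois group permutes the fibres of an equivariant function transitively, so they all have the
  same size.\<close>

lemma galois_orbit_fibres:
  fixes f :: "complex ^ 'n \<Rightarrow> complex"
  assumes f_alg: "algebraic (f \<xi>)"
    and equi: "\<And>\<sigma> \<alpha>. \<sigma> \<in> galois_group \<Longrightarrow> \<alpha> \<in> galois_orbit \<xi> \<Longrightarrow> f (galois_act \<sigma> \<alpha>) = \<sigma> (f \<alpha>)"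
  obtains k where "k > 0" "card (galois_orbit \<xi>) = k * card (conjugates (f \<xi>))"
    "f ` galois_orbit \<xi> = conjugates (f \<xi>)"
    "\<forall>y\<in>conjugates (f \<xi>). card {\<alpha>\<in>galois_orbit \<xi>. f \<alpha> = y} = k"
proof -
  let ?S = "galois_orbit \<xi>" and ?C = "conjugates (f \<xi>)"
  define F where "F = (\<lambda>y. {\<alpha>\<in>?S. f \<alpha> = y})"
  note fin = finite_galois_orbit
  have sub: "f ` ?S \<subseteq> ?C"
  proof
    fix y assume "y \<in> f ` ?S"
    then obtain \<sigma> where s: "\<sigma> \<in> galois_group" "y = f (galois_act \<sigma> \<xi>)" unfolding galois_orbit_altdef by blast
    then show "y \<in> ?C" using equi[OF s(1) self_mem_galois_orbit]
        galois_conjugates[OF s(1) f_alg self_mem_conjugates[OF f_alg]] by simp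
  qed
  have fa: "algebraic (f \<alpha>)" if "\<alpha> \<in> ?S" for \<alpha>
    using sub that algebraic_conjugate[OF f_alg] by (auto simp: conjugates_def)
  have le: "card (F y) \<le> card (F (\<sigma> y))" if s: "\<sigma> \<in> galois_group" for \<sigma> y
  proof (rule card_inj_on_le[of "galois_act \<sigma>"])
    show "inj_on (galois_act \<sigma>) (F y)" using galois_act_bij[OF s]
      by (auto simp: bij_betw_def F_def intro: inj_on_subset)
    show "galois_act \<sigma> ` F y \<subseteq> F (\<sigma> y)" using galois_act_orbit[OF s] equi[OF s] by (auto simp: F_def)
    show "finite (F (\<sigma> y))" using fin by (simp add: F_def)
  qed
  define k where "k = card (F (f \<xi>))"
  have k: "card (F y) = k" if y: "y \<in> ?C" for y
  proof (rule antisym)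
    obtain \<sigma> where s: "\<sigma> \<in> galois_group" "\<sigma> (f \<xi>) = y" using galois_transitive[OF f_alg y] .
    obtain \<tau> where t: "\<tau> \<in> galois_group" "\<forall>x. algebraic x \<longrightarrow> \<tau> (\<sigma> x) = x" using galois_inverse_exists[OF s(1)] .
    show "k \<le> card (F y)" using le[OF s(1), of "f \<xi>"] s(2) by (simp add: k_def)
    show "card (F y) \<le> k" using le[OF t(1), of y] t(2) f_alg s(2) by (auto simp: k_def)
  qed
  have kpos: "k > 0" using self_mem_galois_orbit[of \<xi>] fin by (auto simp: k_def F_def card_gt_0_iff)
  have "?C \<subseteq> f ` ?S"
  proof
    fix y assume "y \<in> ?C"
    then have "F y \<noteq> {}" using k kpos by fastforce
    then show "y \<in> f ` ?S" by (auto simp: F_def)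
  qed
  then have im: "f ` ?S = ?C" using sub by blast
  have "card ?S = (\<Sum>y\<in>?C. card (F y))"
    using sum.group[OF fin finite_conjugates[OF f_alg] sub, of "\<lambda>_. 1::nat"] by (simp add: F_def)
  then have "card ?S = k * card ?C" using k by simp
  then show thesis using that kpos im k by (simp add: F_def)
qed

lemma galois_orbit_average:
  fixes f :: "complex ^ 'n \<Rightarrow> complex" and g :: "complex \<Rightarrow> real"
  assumes f_alg: "algebraic (f \<xi>)"
    and equi: "\<And>\<sigma> \<alpha>. \<sigma> \<in> galois_group \<Longrightarrow> \<alpha> \<in> galois_orbit \<xi> \<Longrightarrow> f (galois_act \<sigma> \<alpha>) = \<sigma> (f \<alpha>)"
  shows "(\<Sum>\<alpha>\<in>galois_orbit \<xi>. g (f \<alpha>)) / card (galois_orbit \<xi>) =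
    (\<Sum>y\<in>conjugates (f \<xi>). g y) / card (conjugates (f \<xi>))"
proof -
  obtain k where k: "k > 0" "card (galois_orbit \<xi>) = k * card (conjugates (f \<xi>))"
    "f ` galois_orbit \<xi> = conjugates (f \<xi>)"
    "\<forall>y\<in>conjugates (f \<xi>). card {\<alpha>\<in>galois_orbit \<xi>. f \<alpha> = y} = k"
    using galois_orbit_fibres[OF f_alg equi] .
  have "(\<Sum>\<alpha>\<in>galois_orbit \<xi>. g (f \<alpha>)) = (\<Sum>y\<in>conjugates (f \<xi>). real k * g y)"
    using sum_fun_comp[OF finite_galois_orbit finite_conjugates[OF f_alg], of f g] k by simp
  also have "\<dots> = k * (\<Sum>y\<in>conjugates (f \<xi>). g y)" by (simp add: sum_distrib_left)
  finally show ?thesis using k(1,2) by simp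
qed

text \<open>By equidistribution over the fibres the product is a power of the minimal polynomial.\<close>

lemma galois_orbit_integer_polynomial:
  fixes f :: "complex ^ 'n \<Rightarrow> complex"
  assumes f_alg: "algebraic (f \<xi>)"
    and equi: "\<And>\<sigma> \<alpha>. \<sigma> \<in> galois_group \<Longrightarrow> \<alpha> \<in> galois_orbit \<xi> \<Longrightarrow> f (galois_act \<sigma> \<alpha>) = \<sigma> (f \<alpha>)"
  obtains k P where "card (galois_orbit \<xi>) = k * card (conjugates (f \<xi>))"
    "cpoly P = smult (of_int (lead_coeff (int_min_poly (f \<xi>)) ^ k)) (\<Prod>\<alpha>\<in>galois_orbit \<xi>. [:- f \<alpha>, 1:])"
proof -
  let ?S = "galois_orbit \<xi>" and ?C = "conjugates (f \<xi>)"
  obtain k where k: "k > 0" "card ?S = k * card ?C" "f ` ?S = ?C"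
    "\<forall>y\<in>?C. card {\<alpha>\<in>?S. f \<alpha> = y} = k"
    using galois_orbit_fibres[OF f_alg equi] .
  have "(\<Prod>\<alpha>\<in>?S. [:- f \<alpha>, 1:]) = (\<Prod>y\<in>?C. \<Prod>\<alpha>\<in>{\<alpha>\<in>?S. f \<alpha> = y}. [:- f \<alpha>, 1:])"
    by (rule prod.group[symmetric, OF finite_galois_orbit finite_conjugates[OF f_alg]]) (simp add: k(3))
  also have "\<dots> = (\<Prod>y\<in>?C. [:- y, 1:] ^ k)"
  proof (rule prod.cong[OF refl])
    fix y assume y: "y \<in> ?C"
    have "(\<Prod>\<alpha>\<in>{\<alpha>\<in>?S. f \<alpha> = y}. [:- f \<alpha>, 1:]) = (\<Prod>\<alpha>\<in>{\<alpha>\<in>?S. f \<alpha> = y}. [:- y, 1:])"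
      by (rule prod.cong) auto
    then show "(\<Prod>\<alpha>\<in>{\<alpha>\<in>?S. f \<alpha> = y}. [:- f \<alpha>, 1:]) = [:- y, 1:] ^ k" using k(4) y by simp
  qed
  also have "\<dots> = (\<Prod>y\<in>?C. [:- y, 1:]) ^ k" by (rule prod_power_distrib[symmetric])
  finally have eq: "(\<Prod>\<alpha>\<in>?S. [:- f \<alpha>, 1:]) = (\<Prod>y\<in>?C. [:- y, 1:]) ^ k" .
  have "cpoly (int_min_poly (f \<xi>) ^ k) =
    smult (of_int (lead_coeff (int_min_poly (f \<xi>)) ^ k)) (\<Prod>\<alpha>\<in>?S. [:- f \<alpha>, 1:])"
    unfolding cpoly_power eq int_min_poly_decompose[OF f_alg] smult_power[symmetric] of_int_power ..
  with k(2) show thesis by (rule that)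
qed

end

section \<open>Heights of inverses\<close>

text \<open>The reflected polynomial is minimal for the inverse, up to sign.\<close>

lemma int_min_poly_inverse:
  assumes x: "algebraic x" "x \<noteq> 0"
  shows "lead_coeff (int_min_poly (inverse x)) = \<bar>coeff (int_min_poly x) 0\<bar>"
    and "coeff (int_min_poly x) 0 \<noteq> 0"
proof -
  let ?P = "int_min_poly x"
  note mP = minimal_int_poly_int_min_poly[OF x(1)]
  show c0: "coeff ?P 0 \<noteq> 0"
  proof
    assume "coeff ?P 0 = 0"
    then obtain Q where Q: "?P = pCons 0 Q" by (cases ?P) simp
    then have "Q \<noteq> 0" using int_min_poly_nonzero[OF x(1)] by auto
    moreover have "ipoly Q x = 0" using int_min_poly_root[OF x(1)] x(2) by (simp add: Q map_poly_pCons)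
    ultimately have "degree ?P \<le> degree Q" using degree_int_min_poly_le[OF x(1)] by blast
    then show False using Q \<open>Q \<noteq> 0\<close> by simp
  qed
  define R where "R = reflect_poly ?P"
  have cR: "cpoly (reflect_poly p) = reflect_poly (cpoly p)" for p
    by (intro poly_eqI) (simp add: coeff_map_poly coeff_reflect_poly)
  have refl_root: "ipoly (reflect_poly p) (inverse z) = 0 \<longleftrightarrow> ipoly p z = 0" if "z \<noteq> 0" for p z
    unfolding cR using that poly_reflect_poly_nz[of "inverse z" "cpoly p"] by simp
  have dR: "degree R = degree ?P" unfolding R_def using c0 by simp
  have rR: "ipoly R (inverse x) = 0" unfolding R_def using refl_root[OF x(2)] int_min_poly_root[OF x(1)] by simp
  have "content R dvd coeff ?P i" for i
  proof (cases "i \<le> degree ?P")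
    case True
    then have "coeff ?P i = coeff R (degree ?P - i)" by (simp add: R_def coeff_reflect_poly)
    then show ?thesis by simp
  qed (simp add: coeff_eq_0)
  then have "content R dvd content ?P"
    by (simp add: const_poly_dvd_iff flip: const_poly_dvd_iff_dvd_content)
  then have "content R dvd 1" using mP by (simp add: minimal_int_poly_def)
  then have ctR: "content R = 1" by (metis content_1 is_unit_normalize normalize_content)
  have minR: "degree R \<le> degree q" if q: "q \<noteq> 0" "ipoly q (inverse x) = 0" for q
  proof -
    have "ipoly (reflect_poly q) x = 0" using refl_root[of "inverse x" q] x(2) q by simp
    then have "degree ?P \<le> degree (reflect_poly q)" using degree_int_min_poly_le[OF x(1)] q by simp
    also have "\<dots> \<le> degree q" by (rule degree_reflect_poly_le)
    finally show ?thesis using dR by simp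
  qed
  have lR: "lead_coeff R = coeff ?P 0" using dR by (simp add: R_def coeff_reflect_poly)
  define T where "T = smult (sgn (coeff ?P 0)) R"
  have "content T = 1" using c0 ctR by (simp add: T_def content_smult sgn_if)
  moreover have lT: "lead_coeff T = \<bar>coeff ?P 0\<bar>" using c0 lR by (simp add: T_def abs_sgn mult.commute)
  moreover have "ipoly T (inverse x) = 0" using rR by (simp add: T_def cpoly_smult)
  moreover have "degree T = degree R" using c0 by (simp add: T_def sgn_if)
  ultimately have "minimal_int_poly (inverse x) T"
    using minR c0 unfolding minimal_int_poly_def by simp
  then show "lead_coeff (int_min_poly (inverse x)) = \<bar>coeff ?P 0\<bar>" using int_min_poly_eqI lT by metis
qed

lemma log_plus_altdef: "x > 0 \<Longrightarrow> log_plus x = max 0 (ln x)"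
  by (simp add: log_plus_def)

lemma log_plus_nonneg: "log_plus x \<ge> 0"
  by (simp add: log_plus_def)

lemma conjugates_nonzero:
  assumes x: "algebraic x" "x \<noteq> 0" and y: "y \<in> conjugates x" shows "y \<noteq> 0"
proof
  assume "y = 0"
  then have "coeff (cpoly (int_min_poly x)) 0 = 0" using y by (simp add: conjugates_def poly_0_coeff_0)
  then show False using int_min_poly_inverse(2)[OF x] by (simp add: coeff_map_poly)
qed

lemma conjugates_inverse:
  assumes x: "algebraic x" "x \<noteq> 0"
  shows "conjugates (inverse x) = inverse ` conjugates x"
proof -
  have *: "inverse ` conjugates z \<subseteq> conjugates (inverse z)" if z: "algebraic z" for z
  proof safe
    fix y assume y: "y \<in> conjugates z"
    obtain \<sigma> where "\<sigma> \<in> galois_group" "\<sigma> z = y" using galois_transitive[OF z y] .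
    then show "inverse y \<in> conjugates (inverse z)"
      using galois_conjugates[of \<sigma> "inverse z" "inverse z"] galois_inverse[of \<sigma> z] z
        self_mem_conjugates[of "inverse z"] algebraic_inverse[OF z] by auto
  qed
  have "inverse ` conjugates (inverse x) \<subseteq> conjugates x" using *[of "inverse x"] x by auto
  then have "inverse ` inverse ` conjugates (inverse x) \<subseteq> inverse ` conjugates x" by (rule image_mono)
  then show ?thesis using *[OF x(1)] by (auto simp: image_image)
qed

text \<open>By Vieta, the constant coefficient is the leading one times the product of the conjugates, and
  \<open>log\<^sup>+ (1 / r) = log\<^sup>+ r - log r\<close>.\<close>

lemma weil_height_inverse:
  assumes x: "algebraic x" "x \<noteq> 0"
  shows "weil_height (inverse x) = weil_height x"
proof -
  let ?P = "int_min_poly x" and ?C = "conjugates x"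
  have nz: "y \<noteq> 0" if "y \<in> ?C" for y using conjugates_nonzero[OF x that] .
  have C: "inj_on inverse ?C" by (auto simp: inj_on_def)
  have fin: "finite ?C" using finite_conjugates[OF x(1)] .
  have a: "lead_coeff ?P > 0" using lead_coeff_int_min_poly[OF x(1)] .
  have "of_int (coeff ?P 0) = poly (cpoly ?P) 0" by (simp add: poly_0_coeff_0 coeff_map_poly)
  also have "\<dots> = of_int (lead_coeff ?P) * (\<Prod>y\<in>?C. - y)"
    unfolding int_min_poly_decompose[OF x(1)] poly_smult poly_prod by simp
  finally have "norm (of_int (coeff ?P 0) :: complex) = norm (of_int (lead_coeff ?P) * (\<Prod>y\<in>?C. - y))" by simp
  then have "real_of_int \<bar>coeff ?P 0\<bar> = real_of_int (lead_coeff ?P) * (\<Prod>y\<in>?C. norm y)"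
    using a by (simp add: norm_mult flip: prod_norm)
  then have "ln (real_of_int \<bar>coeff ?P 0\<bar>) = ln (real_of_int (lead_coeff ?P)) + ln (\<Prod>y\<in>?C. norm y)"
  proof -
    have "real_of_int (lead_coeff ?P) > 0" "(\<Prod>y\<in>?C. norm y) > 0"
      using a nz by (auto intro!: prod_pos simp del: leading_coeff_0_iff)
    with \<open>real_of_int \<bar>coeff ?P 0\<bar> = _\<close> show ?thesis by (simp only: ln_mult_pos)
  qed
  also have "ln (\<Prod>y\<in>?C. norm y) = (\<Sum>y\<in>?C. ln (norm y))"
    using nz fin by (intro ln_prod) auto
  finally have l: "ln (real_of_int (lead_coeff (int_min_poly (inverse x)))) =
      ln (real_of_int (lead_coeff ?P)) + (\<Sum>y\<in>?C. ln (norm y))"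
    by (simp add: int_min_poly_inverse(1)[OF x])
  have "(\<Sum>y\<in>inverse ` ?C. log_plus (norm y)) = (\<Sum>y\<in>?C. log_plus (norm y) - ln (norm y))"
    unfolding sum.reindex[OF C]
  proof (rule sum.cong[OF refl])
    fix y assume "y \<in> ?C"
    then have "norm y > 0" using nz by simp
    then show "((\<lambda>y. log_plus (norm y)) \<circ> inverse) y = log_plus (norm y) - ln (norm y)"
      by (simp add: log_plus_altdef norm_inverse ln_inverse max_def)
  qed
  then show ?thesis
    unfolding weil_height_conjugates[OF x(1)] weil_height_conjugates[OF algebraic_inverse[OF x(1)]] l
      conjugates_inverse[OF x] card_image[OF C] by (simp add: sum_subtractf)
qed

lemma weil_height_nonneg: "algebraic x \<Longrightarrow> weil_height x \<ge> 0"
  using lead_coeff_int_min_poly[of x] unfolding weil_height_conjugates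
  by (intro divide_nonneg_nonneg add_nonneg_nonneg sum_nonneg log_plus_nonneg ln_ge_zero) auto

text \<open>\<open>\<bar>log r\<bar> = log\<^sup>+ r + log\<^sup>+ (1 / r)\<close>, and a number and its inverse have the same height.\<close>

lemma sum_abs_ln_conjugates_le:
  assumes x: "algebraic x" "x \<noteq> 0"
  shows "(\<Sum>y\<in>conjugates x. \<bar>ln (norm y)\<bar>) / card (conjugates x) \<le> 2 * weil_height x"
proof -
  have *: "(\<Sum>y\<in>conjugates z. log_plus (norm y)) / card (conjugates z) \<le> weil_height z" if "algebraic z" for z
    unfolding weil_height_conjugates[OF that] using lead_coeff_int_min_poly[OF that]
    by (intro divide_right_mono) auto
  have C: "inj_on inverse (conjugates x)" by (auto simp: inj_on_def)
  have "\<bar>ln (norm y)\<bar> = log_plus (norm y) + log_plus (norm (inverse y))" if "y \<in> conjugates x" for y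
    using conjugates_nonzero[OF x that] by (simp add: log_plus_altdef norm_inverse ln_inverse)
  then have "(\<Sum>y\<in>conjugates x. \<bar>ln (norm y)\<bar>) / card (conjugates x) =
      (\<Sum>y\<in>conjugates x. log_plus (norm y)) / card (conjugates x) +
      (\<Sum>y\<in>conjugates (inverse x). log_plus (norm y)) / card (conjugates (inverse x))"
    unfolding conjugates_inverse[OF x] card_image[OF C]
    by (simp add: sum.reindex[OF C] sum.distrib add_divide_distrib)
  also have "\<dots> \<le> weil_height x + weil_height (inverse x)"
    by (intro add_mono * algebraic_inverse x)
  finally show ?thesis by (simp add: weil_height_inverse[OF x])
qed

section \<open>Valuation rings of the complex numbers\<close>

definition subring1 :: "complex set \<Rightarrow> bool" where
  "subring1 V \<longleftrightarrow> 1 \<in> V \<and> (\<forall>x\<in>V. \<forall>y\<in>V. x - y \<in> V \<and> x * y \<in> V)"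

lemma
  assumes "subring1 V"
  shows subring1_one: "1 \<in> V" and subring1_zero: "0 \<in> V"
    and subring1_diff: "x \<in> V \<Longrightarrow> y \<in> V \<Longrightarrow> x - y \<in> V"
    and subring1_mult: "x \<in> V \<Longrightarrow> y \<in> V \<Longrightarrow> x * y \<in> V"
    and subring1_minus: "x \<in> V \<Longrightarrow> - x \<in> V"
    and subring1_add: "x \<in> V \<Longrightarrow> y \<in> V \<Longrightarrow> x + y \<in> V"
proof -
  show 1: "1 \<in> V" and d: "\<And>x y. x \<in> V \<Longrightarrow> y \<in> V \<Longrightarrow> x - y \<in> V"
    and "\<And>x y. x \<in> V \<Longrightarrow> y \<in> V \<Longrightarrow> x * y \<in> V"
    using assms unfolding subring1_def by blast+
  show 0: "0 \<in> V" using d[OF 1 1] by simp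
  show m: "- x \<in> V" if "x \<in> V" for x using d[OF 0 that] by simp
  show "x + y \<in> V" if "x \<in> V" "y \<in> V" for x y using d[OF that(1) m[OF that(2)]] by simp
qed

lemma subring1_sum: "subring1 V \<Longrightarrow> (\<And>i. i \<in> I \<Longrightarrow> f i \<in> V) \<Longrightarrow> (\<Sum>i\<in>I. f i) \<in> V"
  by (induction I rule: infinite_finite_induct) (simp_all add: subring1_zero subring1_add)

lemma subring1_prod: "subring1 V \<Longrightarrow> (\<And>i. i \<in> I \<Longrightarrow> f i \<in> V) \<Longrightarrow> (\<Prod>i\<in>I. f i) \<in> V"
  by (induction I rule: infinite_finite_induct) (simp_all add: subring1_one subring1_mult)

lemma subring1_power: "subring1 V \<Longrightarrow> x \<in> V \<Longrightarrow> x ^ n \<in> V"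
  by (induction n) (simp_all add: subring1_one subring1_mult)

lemma subring1_of_int:
  assumes V: "subring1 V" shows "of_int k \<in> V"
proof -
  have n: "of_nat n \<in> V" for n
    by (induction n) (simp_all add: subring1_zero[OF V] subring1_one[OF V] subring1_add[OF V])
  show ?thesis
    by (cases k) (simp_all add: n subring1_minus[OF V] subring1_diff[OF V] subring1_one[OF V] del: of_nat_Suc)
qed

definition poly_over :: "complex set \<Rightarrow> complex poly \<Rightarrow> bool" where
  "poly_over V f \<longleftrightarrow> (\<forall>i. coeff f i \<in> V)"

lemma
  assumes V: "subring1 V"
  shows poly_over_diff: "poly_over V f \<Longrightarrow> poly_over V g \<Longrightarrow> poly_over V (f - g)"
    and poly_over_add: "poly_over V f \<Longrightarrow> poly_over V g \<Longrightarrow> poly_over V (f + g)"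
    and poly_over_mult: "poly_over V f \<Longrightarrow> poly_over V g \<Longrightarrow> poly_over V (f * g)"
    and poly_over_smult: "c \<in> V \<Longrightarrow> poly_over V f \<Longrightarrow> poly_over V (smult c f)"
    and poly_over_monom: "c \<in> V \<Longrightarrow> poly_over V (monom c n)"
  using V unfolding poly_over_def
  by (auto simp: coeff_mult intro!: subring1_diff subring1_add subring1_sum subring1_mult subring1_zero)

lemma poly_over_sum: "subring1 V \<Longrightarrow> (\<And>i. i \<in> I \<Longrightarrow> poly_over V (f i)) \<Longrightarrow> poly_over V (\<Sum>i\<in>I. f i)"
  unfolding poly_over_def by (auto simp: coeff_sum intro!: subring1_sum)

lemma poly_over_linear: "subring1 V \<Longrightarrow> c \<in> V \<Longrightarrow> d \<in> V \<Longrightarrow> poly_over V [:c, d:]"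
  unfolding poly_over_def by (simp add: coeff_pCons subring1_zero split: nat.splits)

lemma subring1_adjoin:
  assumes V: "subring1 V"
  shows "subring1 {poly f x | f. poly_over V f}"
  unfolding subring1_def
proof (intro conjI ballI)
  show "1 \<in> {poly f x |f. poly_over V f}"
    using poly_over_monom[OF V subring1_one[OF V], of 0] by (force simp: poly_monom)
next
  fix a b assume "a \<in> {poly f x |f. poly_over V f}" "b \<in> {poly f x |f. poly_over V f}"
  then obtain f g where "poly_over V f" "poly_over V g" "a = poly f x" "b = poly g x" by blast
  then show "a - b \<in> {poly f x |f. poly_over V f}" "a * b \<in> {poly f x |f. poly_over V f}"
    using poly_over_diff[OF V] poly_over_mult[OF V] by (metis (mono_tags, lifting) mem_Collect_eq poly_diff poly_mult)+
qed

definition valuation_ring :: "complex set \<Rightarrow> bool" where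
  "valuation_ring V \<longleftrightarrow> subring1 V \<and> (\<forall>x. x \<in> V \<or> inverse x \<in> V)"

text \<open>This is the step that makes a maximal subring without \<open>u = 1 / p\<close> a valuation ring. If adjoining
  \<open>x\<close> and adjoining \<open>y = 1 / x\<close> both produce \<open>u\<close>, the relation for \<open>y\<close> expresses the top power of \<open>x\<close>
  through lower ones, and the relation for \<open>x\<close> can be shortened.\<close>

lemma adjoin_degree_descent:
  assumes V: "subring1 V" and xy: "x * y = 1" and pu: "p * u = 1" and p: "p \<in> V" and u: "u \<notin> V"
    and max: "\<And>z. z \<notin> V \<Longrightarrow> \<exists>f. poly_over V f \<and> poly f z = u"
    and f: "poly_over V f" "poly f x = u" and g: "poly_over V g" "poly g y = u"
    and le: "degree g \<le> degree f"
  shows "\<exists>f'. poly_over V f' \<and> poly f' x = u \<and> degree f' < degree f"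
proof -
  define t where "t = 1 - p * coeff g 0"
  have fV: "coeff f i \<in> V" and gV: "coeff g i \<in> V" for i using f g by (auto simp: poly_over_def)
  have tV: "t \<in> V" unfolding t_def by (intro subring1_diff subring1_one subring1_mult V p gV)
  have p0: "p \<noteq> 0" and u_eq: "u = inverse p" using pu by (auto simp: inverse_unique)
  have no: "p * w \<noteq> 1" if "w \<in> V" for w
  proof
    assume "p * w = 1" then have "w = u" using u_eq by (simp add: inverse_unique)
    then show False using that u by simp
  qed
  have t0: "t \<noteq> 0" using no[OF gV[of 0]] by (auto simp: t_def)
  \<comment> \<open>Powers of \<open>t\<close> are congruent to 1 modulo \<open>p\<close>, so inverting \<open>t\<close> cannot make \<open>p\<close> invertible.\<close>
  have tk: "\<exists>w\<in>V. t ^ k = 1 - p * w" for k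
  proof (induction k)
    case 0 show ?case using subring1_zero[OF V] by (intro bexI[of _ 0]) auto
  next
    case (Suc k)
    then obtain w where w: "w \<in> V" "t ^ k = 1 - p * w" by blast
    have "t ^ Suc k = 1 - p * (coeff g 0 + t * w)"
      unfolding power_Suc w(2) by (simp add: t_def algebra_simps)
    moreover have "coeff g 0 + t * w \<in> V" by (intro subring1_add subring1_mult V gV tV w)
    ultimately show ?case by blast
  qed
  have tinv: "inverse t \<in> V"
  proof (rule ccontr)
    assume "inverse t \<notin> V"
    then obtain r where r: "poly_over V r" "poly r (inverse t) = u" using max by blast
    define k where "k = degree r"
    have e: "t ^ k * u = (\<Sum>i\<le>k. coeff r i * t ^ (k - i))"
      unfolding r(2)[symmetric] poly_altdef k_def[symmetric] sum_distrib_left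
      by (intro sum.cong refl) (use t0 in \<open>simp add: power_diff field_simps\<close>)
    have eV: "t ^ k * u \<in> V" unfolding e
      using r by (intro subring1_sum subring1_mult subring1_power V tV) (auto simp: poly_over_def)
    obtain w where w: "w \<in> V" "t ^ k = 1 - p * w" using tk by blast
    have "p * (t ^ k * u + w) = (p * u) * t ^ k + p * w" by (simp add: algebra_simps)
    then have "p * (t ^ k * u + w) = 1" using pu w(2) by simp
    then show False using no[OF subring1_add[OF V eV w(1)]] by blast
  qed
  define n where "n = degree f"
  have n0: "n > 0"
  proof (rule ccontr)
    assume "\<not> n > 0" then obtain c where "f = [:c:]" by (metis n_def degree_eq_zeroE gr0I)
    then show False using f u fV[of 0] by simp
  qed
  define m where "m = degree g"
  have y: "y ^ j * x ^ n = x ^ (n - j)" if "j \<le> n" for j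
  proof -
    have "y ^ j * x ^ n = (x * y) ^ j * x ^ (n - j)"
      using that by (simp add: power_mult_distrib flip: power_add)
    then show ?thesis by (simp add: xy)
  qed
  have "t = p * (\<Sum>j\<in>{1..m}. coeff g j * y ^ j)"
  proof -
    have "1 = p * poly g y" using pu g by simp
    also have "poly g y = coeff g 0 + (\<Sum>j\<in>{1..m}. coeff g j * y ^ j)"
      unfolding poly_altdef m_def by (simp add: sum.atMost_shift sum.atLeast1_atMost_eq)
    finally show ?thesis by (simp add: t_def algebra_simps)
  qed
  then have "t * x ^ n = p * (\<Sum>j\<in>{1..m}. coeff g j * (y ^ j * x ^ n))"
    by (simp add: sum_distrib_right mult.assoc)
  also have "\<dots> = p * (\<Sum>j\<in>{1..m}. coeff g j * x ^ (n - j))"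
    using le y by (intro arg_cong[of _ _ "\<lambda>z. p * z"] sum.cong refl) (simp add: m_def n_def)
  finally have xn: "x ^ n = inverse t * p * (\<Sum>j\<in>{1..m}. coeff g j * x ^ (n - j))"
    using t0 by (simp add: field_simps)
  define h where "h = smult (inverse t * p) (\<Sum>j\<in>{1..m}. monom (coeff g j) (n - j))"
  have hV: "poly_over V h" unfolding h_def
    by (intro poly_over_smult poly_over_sum poly_over_monom V subring1_mult tinv p gV)
  have hx: "poly h x = x ^ n" unfolding xn h_def by (simp add: poly_sum poly_monom)
  have hc: "coeff h i = 0" if "i \<ge> n" for i
    unfolding h_def using that n0 by (auto simp: coeff_sum intro!: sum.neutral)
  define f' where "f' = f - monom (coeff f n) n + smult (coeff f n) h"
  have "poly_over V f'" unfolding f'_def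
    by (intro poly_over_add poly_over_diff poly_over_smult poly_over_monom V f fV hV)
  moreover have "poly f' x = u" by (simp add: f'_def f poly_monom hx)
  moreover have "degree f' < degree f"
  proof -
    have "coeff f' i = 0" if "i \<ge> n" for i
      using that hc[OF that] by (auto simp: f'_def n_def coeff_eq_0)
    then have "degree f' \<le> n - 1" by (intro degree_le) auto
    then show ?thesis using n0 by (simp add: n_def)
  qed
  ultimately show ?thesis by blast
qed

text \<open>Zorn's lemma gives a maximal subring in which \<open>p\<close> is not invertible. If neither \<open>x\<close> nor \<open>1 / x\<close>
  belonged to it, \<open>1 / p\<close> would be a polynomial in each of them, and the relation of larger degree among
  two of least degree could be shortened.\<close>

lemma valuation_ring_above_prime:
  fixes p :: nat
  assumes p: "p \<ge> 2"
  obtains V where "valuation_ring V" "inverse (of_nat p) \<notin> V"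
proof -
  define u where "u = inverse (of_nat p :: complex)"
  define \<R> where "\<R> = {V. subring1 V \<and> u \<notin> V}"
  have "\<exists>M\<in>\<R>. \<forall>X\<in>\<R>. M \<subseteq> X \<longrightarrow> X = M"
  proof (rule subset_Zorn_nonempty)
    have "u \<notin> \<int>"
    proof
      assume "u \<in> \<int>"
      then obtain k where k: "u = of_int k" by (elim Ints_cases)
      then have "of_int (k * int p) = (1 :: complex)" using p by (simp add: u_def field_simps flip: k)
      then have "k * int p = 1" using of_int_eq_1_iff by blast
      then show False using p by (simp add: zmult_eq_1_iff)
    qed
    then have "\<int> \<in> \<R>" by (simp add: \<R>_def subring1_def)
    then show "\<R> \<noteq> {}" by blast
    fix C assume ne: "C \<noteq> {}" and C: "subset.chain \<R> C"
    have sub: "subring1 T" "u \<notin> T" if "T \<in> C" for T using C that by (auto simp: subset.chain_def \<R>_def)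
    have "subring1 (\<Union>C)" unfolding subring1_def
    proof (intro conjI ballI)
      show "1 \<in> \<Union>C" using ne sub subring1_one by blast
      fix x y assume "x \<in> \<Union>C" "y \<in> \<Union>C"
      then obtain T U where TU: "T \<in> C" "U \<in> C" "x \<in> T" "y \<in> U" by blast
      then have "T \<subseteq> U \<or> U \<subseteq> T" using C unfolding subset.chain_def by blast
      then obtain Y where Y: "Y \<in> C" "x \<in> Y" "y \<in> Y" using TU by blast
      then show "x - y \<in> \<Union>C" "x * y \<in> \<Union>C"
        using subring1_diff[OF sub(1)[OF Y(1)]] subring1_mult[OF sub(1)[OF Y(1)]] by blast+
    qed
    then show "\<Union>C \<in> \<R>" using sub by (auto simp: \<R>_def)
  qed
  then obtain V where V: "subring1 V" and u: "u \<notin> V"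
    and max: "\<And>X. subring1 X \<Longrightarrow> u \<notin> X \<Longrightarrow> V \<subseteq> X \<Longrightarrow> X = V"
    by (auto simp: \<R>_def)
  have adj: "\<exists>f. poly_over V f \<and> poly f z = u" if z: "z \<notin> V" for z
  proof (rule ccontr)
    assume "\<not> ?thesis"
    then have "u \<notin> {poly f z | f. poly_over V f}" by blast
    moreover have "c \<in> {poly f z | f. poly_over V f}" if "c \<in> V" for c
      using poly_over_monom[OF V that, of 0] by (force simp: poly_monom)
    ultimately have "{poly f z | f. poly_over V f} = V"
      using max[OF subring1_adjoin[OF V]] by blast
    moreover have "z \<in> {poly f z | f. poly_over V f}"
      using poly_over_monom[OF V subring1_one[OF V], of 1] by (force simp: poly_monom)
    ultimately show False using z by blast
  qed
  have least: "\<exists>f. (poly_over V f \<and> poly f z = u) \<and>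
      (\<forall>g. poly_over V g \<and> poly g z = u \<longrightarrow> degree f \<le> degree g)" if z: "z \<notin> V" for z
    using adj[OF z] ex_has_least_nat[of "\<lambda>f. poly_over V f \<and> poly f z = u" _ degree] by blast
  have pu: "of_nat p * u = 1" using p by (simp add: u_def)
  have pV: "of_nat p \<in> V" using subring1_of_int[OF V, of "int p"] by simp
  have "x \<in> V \<or> inverse x \<in> V" for x
  proof (rule ccontr)
    assume "\<not> ?thesis"
    then have x: "x \<notin> V" and y: "inverse x \<notin> V" by auto
    have x0: "x \<noteq> 0" using x subring1_zero[OF V] by auto
    obtain f where f: "poly_over V f" "poly f x = u" "\<And>g. poly_over V g \<Longrightarrow> poly g x = u \<Longrightarrow> degree f \<le> degree g"
      using least[OF x] by blast
    obtain g where g: "poly_over V g" "poly g (inverse x) = u" "\<And>f. poly_over V f \<Longrightarrow> poly f (inverse x) = u \<Longrightarrow> degree g \<le> degree f"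
      using least[OF y] by blast
    have xy: "x * inverse x = 1" "inverse x * x = 1" using x0 by simp_all
    show False
    proof (cases "degree g \<le> degree f")
      case True
      from adjoin_degree_descent[OF V xy(1) pu pV u adj f(1,2) g(1,2) True] f(3)
      show False by (metis not_le)
    next
      case False
      then have "degree f \<le> degree g" by simp
      from adjoin_degree_descent[OF V xy(2) pu pV u adj g(1,2) f(1,2) this] g(3)
      show False by (metis not_le)
    qed
  qed
  then show thesis using that V u by (auto simp: valuation_ring_def u_def)
qed

definition nonunits :: "complex set \<Rightarrow> complex set" where
  "nonunits V = {x \<in> V. x = 0 \<or> inverse x \<notin> V}"

lemma
  assumes V: "valuation_ring V"
  shows nonunits_mult: "x \<in> V \<Longrightarrow> y \<in> nonunits V \<Longrightarrow> x * y \<in> nonunits V"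
    and nonunits_diff: "x \<in> nonunits V \<Longrightarrow> y \<in> nonunits V \<Longrightarrow> x - y \<in> nonunits V"
    and nonunits_add: "x \<in> nonunits V \<Longrightarrow> y \<in> nonunits V \<Longrightarrow> x + y \<in> nonunits V"
    and inverse_nonunit: "x \<notin> V \<Longrightarrow> inverse x \<in> nonunits V"
    and inverse_unit: "x - 1 \<in> nonunits V \<Longrightarrow> x \<noteq> 0 \<and> inverse x \<in> V"
    and zero_nonunit: "0 \<in> nonunits V"
proof -
  have R: "subring1 V" and val: "\<And>x. x \<in> V \<or> inverse x \<in> V" using V by (auto simp: valuation_ring_def)
  have nV: "x \<in> V" if "x \<in> nonunits V" for x using that by (simp add: nonunits_def)
  show z: "0 \<in> nonunits V" using subring1_zero[OF R] by (simp add: nonunits_def)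
  show mult: "x * y \<in> nonunits V" if x: "x \<in> V" and y: "y \<in> nonunits V" for x y
  proof (rule ccontr)
    assume *: "x * y \<notin> nonunits V"
    have "x * y \<in> V" using subring1_mult[OF R x nV[OF y]] .
    then have "x * y \<noteq> 0" and i: "inverse (x * y) \<in> V" using * by (auto simp: nonunits_def)
    then have "x * inverse (x * y) = inverse y" by (simp flip: mult.assoc)
    then have "inverse y \<in> V" using subring1_mult[OF R x i] by metis
    then show False using y \<open>x * y \<noteq> 0\<close> by (auto simp: nonunits_def)
  qed
  show diff: "x - y \<in> nonunits V" if x: "x \<in> nonunits V" and y: "y \<in> nonunits V" for x y
  proof (cases "x = 0 \<or> y = 0")
    case True
    then show ?thesis
      using x mult[OF subring1_minus[OF R subring1_one[OF R]] y] by auto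
  next
    case False
    then have "x - y = (x * inverse y - 1) * y" "x - y = (1 - inverse (x * inverse y)) * x"
      by (simp_all add: field_simps)
    then show ?thesis
      using val[of "x * inverse y"] mult[OF subring1_diff[OF R _ subring1_one[OF R]] y]
        mult[OF subring1_diff[OF R subring1_one[OF R]] x] by metis
  qed
  show "x + y \<in> nonunits V" if x: "x \<in> nonunits V" and y: "y \<in> nonunits V" for x y
    using diff[OF x diff[OF z y]] by simp
  show "inverse x \<in> nonunits V" if "x \<notin> V" for x
    using that val[of x] by (auto simp: nonunits_def)
  have one: "1 \<notin> nonunits V" using subring1_one[OF R] by (simp add: nonunits_def)
  show "x \<noteq> 0 \<and> inverse x \<in> V" if x: "x - 1 \<in> nonunits V" for x
  proof -
    have "x \<in> V" using subring1_add[OF R nV[OF x] subring1_one[OF R]] by simp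
    moreover have "x \<notin> nonunits V" using diff[OF _ x, of x] one by auto
    ultimately show ?thesis by (auto simp: nonunits_def)
  qed
qed

text \<open>Gauss's lemma for linear factors. The index \<open>k\<close> is the number of roots in \<open>V\<close>: modulo nonunits a
  root in \<open>V\<close> contributes a monic factor of degree 1, and any other root contributes the factor 1.\<close>

lemma prod_linear_factors_primitive:
  assumes V: "valuation_ring V" and S: "finite S"
  shows "\<exists>g k. poly_over V g \<and> coeff g k - 1 \<in> nonunits V \<and> (\<forall>l>k. coeff g l \<in> nonunits V) \<and>
    (\<Prod>i\<in>S. [:- \<beta> i, 1:]) = smult (\<Prod>i\<in>{i\<in>S. \<beta> i \<notin> V}. - \<beta> i) g"
  using S
proof induction
  case empty
  have "subring1 V" using V by (simp add: valuation_ring_def)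
  then have "poly_over V 1" using poly_over_monom[OF _ subring1_one, of V 0] by (simp add: monom_0 one_pCons)
  then show ?case using zero_nonunit[OF V] by (intro exI[of _ 1] exI[of _ 0]) simp
next
  case (insert i S)
  have R: "subring1 V" using V by (simp add: valuation_ring_def)
  obtain g k where g: "poly_over V g" "coeff g k - 1 \<in> nonunits V" "\<And>l. l > k \<Longrightarrow> coeff g l \<in> nonunits V"
    and eq: "(\<Prod>i\<in>S. [:- \<beta> i, 1:]) = smult (\<Prod>i\<in>{i\<in>S. \<beta> i \<notin> V}. - \<beta> i) g"
    using insert.IH by blast
  have gV: "coeff g l \<in> V" for l using g(1) by (simp add: poly_over_def)
  have c: "coeff ([:c, d:] * g) l = c * coeff g l + (if l = 0 then 0 else d * coeff g (l - 1))" for c d l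
    by (cases l) simp_all
  have prodeq: "(\<Prod>i\<in>insert i S. [:- \<beta> i, 1:]) = [:- \<beta> i, 1:] * (\<Prod>i\<in>S. [:- \<beta> i, 1:])"
    by (rule prod.insert[OF insert.hyps])
  show ?case
  proof (cases "\<beta> i \<in> V")
    case True
    define g' where "g' = [:- \<beta> i, 1:] * g"
    have bV: "- \<beta> i \<in> V" using subring1_minus[OF R True] .
    have "poly_over V g'" unfolding g'_def
      by (intro poly_over_mult[OF R _ g(1)] poly_over_linear R bV subring1_one)
    moreover have "coeff g' (Suc k) - 1 \<in> nonunits V"
    proof -
      have "coeff g' (Suc k) - 1 = - \<beta> i * coeff g (Suc k) + (coeff g k - 1)" unfolding g'_def c by simp
      also have "\<dots> \<in> nonunits V" by (intro nonunits_add[OF V] nonunits_mult[OF V] bV g) simp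
      finally show ?thesis .
    qed
    moreover have "\<forall>l>Suc k. coeff g' l \<in> nonunits V"
    proof (intro allI impI)
      fix l assume l: "l > Suc k"
      have "coeff g' l = - \<beta> i * coeff g l + coeff g (l - 1)" unfolding g'_def c using l by simp
      also have "\<dots> \<in> nonunits V" using l by (intro nonunits_add[OF V] nonunits_mult[OF V] bV g) simp_all
      finally show "coeff g' l \<in> nonunits V" .
    qed
    moreover have "{j\<in>insert i S. \<beta> j \<notin> V} = {j\<in>S. \<beta> j \<notin> V}" using True by auto
    then have "(\<Prod>i\<in>insert i S. [:- \<beta> i, 1:]) = smult (\<Prod>j\<in>{j\<in>insert i S. \<beta> j \<notin> V}. - \<beta> j) g'"
      unfolding prodeq eq g'_def by (simp only: mult_smult_right)
    ultimately show ?thesis by blast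
  next
    case False
    define d where "d = - inverse (\<beta> i)"
    define g' where "g' = [:1, d:] * g"
    have dn: "d \<in> nonunits V" unfolding d_def
      using nonunits_diff[OF V zero_nonunit[OF V] inverse_nonunit[OF V False]] by simp
    have dV: "d \<in> V" using dn by (simp add: nonunits_def)
    have tail: "(if l = 0 then 0 else d * coeff g (l - 1)) \<in> nonunits V" for l
      using nonunits_mult[OF V gV[of "l - 1"] dn] zero_nonunit[OF V] by (simp add: mult.commute)
    have "poly_over V g'" unfolding g'_def
      by (intro poly_over_mult[OF R _ g(1)] poly_over_linear R dV subring1_one)
    moreover have "coeff g' k - 1 \<in> nonunits V"
      using nonunits_add[OF V g(2) tail[of k]] unfolding g'_def c by (simp add: algebra_simps split: if_splits)
    moreover have "\<forall>l>k. coeff g' l \<in> nonunits V"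
    proof (intro allI impI)
      fix l assume l: "l > k"
      show "coeff g' l \<in> nonunits V"
        using nonunits_add[OF V g(3)[OF l] tail[of l]] unfolding g'_def c by simp
    qed
    moreover have "(\<Prod>i\<in>insert i S. [:- \<beta> i, 1:]) = smult (\<Prod>j\<in>{j\<in>insert i S. \<beta> j \<notin> V}. - \<beta> j) g'"
    proof -
      have b0: "\<beta> i \<noteq> 0" using False subring1_zero[OF R] by auto
      have "{j\<in>insert i S. \<beta> j \<notin> V} = insert i {j\<in>S. \<beta> j \<notin> V}" using False by auto
      then have "(\<Prod>j\<in>{j\<in>insert i S. \<beta> j \<notin> V}. - \<beta> j) = - \<beta> i * (\<Prod>j\<in>{j\<in>S. \<beta> j \<notin> V}. - \<beta> j)"
        using insert.hyps by simp
      moreover have "[:- \<beta> i, 1:] = smult (- \<beta> i) [:1, d:]" using b0 by (simp add: d_def)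
      ultimately show ?thesis unfolding prodeq eq g'_def
        by (simp only: mult_smult_right mult_smult_left smult_smult mult.commute)
    qed
    ultimately show ?thesis by blast
  qed
qed

text \<open>Compare the coefficients at which the primitive factor has a unit.\<close>

lemma lead_coeff_times_large_roots_in_valuation_ring:
  assumes V: "valuation_ring V" and S: "finite S"
    and f: "cpoly P = smult a (\<Prod>i\<in>S. [:- \<beta> i, 1:])"
  shows "a * (\<Prod>i\<in>{i\<in>S. \<beta> i \<notin> V}. \<beta> i) \<in> V"
proof -
  have R: "subring1 V" using V by (simp add: valuation_ring_def)
  let ?L = "{i\<in>S. \<beta> i \<notin> V}"
  obtain g k where g: "coeff g k - 1 \<in> nonunits V"
    and eq: "(\<Prod>i\<in>S. [:- \<beta> i, 1:]) = smult (\<Prod>i\<in>?L. - \<beta> i) g"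
    using prod_linear_factors_primitive[OF V S] by blast
  have u: "coeff g k \<noteq> 0" "inverse (coeff g k) \<in> V" using inverse_unit[OF V g] by auto
  define s where "s = ((-1) ^ card ?L :: complex)"
  have "s * s = 1" by (simp add: s_def flip: power_mult_distrib)
  moreover have "(\<Prod>i\<in>?L. - \<beta> i) = s * (\<Prod>i\<in>?L. \<beta> i)" unfolding s_def by (rule prod_uminus)
  moreover have "s * (a * (s * (\<Prod>i\<in>?L. \<beta> i))) = (s * s) * (a * (\<Prod>i\<in>?L. \<beta> i))" by (simp only: ac_simps)
  ultimately have s: "a * (\<Prod>i\<in>?L. \<beta> i) = s * (a * (\<Prod>i\<in>?L. - \<beta> i))" by simp
  have "a * (\<Prod>i\<in>?L. - \<beta> i) * coeff g k = of_int (coeff P k)"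
    using arg_cong[OF f, of "\<lambda>q. coeff q k"] unfolding eq by (simp add: coeff_map_poly)
  then have "a * (\<Prod>i\<in>?L. - \<beta> i) = of_int (coeff P k) * inverse (coeff g k)"
    using u(1) by (simp add: field_simps)
  moreover have "of_int (coeff P k) * inverse (coeff g k) \<in> V"
    by (intro subring1_mult subring1_of_int R u(2))
  moreover have "s \<in> V" unfolding s_def by (intro subring1_power subring1_minus subring1_one R)
  ultimately show ?thesis unfolding s using subring1_mult[OF R] by simp
qed

text \<open>A prime \<open>p\<close> in the denominator would make \<open>1 / p\<close> an integral combination of \<open>q\<close> and 1, against the
  choice of a valuation ring above \<open>p\<close>.\<close>

lemma rational_in_all_valuation_rings:
  assumes q: "q \<in> \<rat>" and all: "\<And>V. valuation_ring V \<Longrightarrow> q \<in> V"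
  shows "q \<in> \<int>"
proof -
  obtain a b where ab: "b > 0" "coprime a b" "q = of_int a / of_int b" using q by (rule Rats_cases')
  show ?thesis
  proof (cases "b = 1")
    case True then show ?thesis using ab by simp
  next
    case False
    then obtain p where p: "prime p" "p dvd b" using ab(1) by (metis abs_of_pos prime_factor_int zabs_less_one_iff abs_1 zdvd1_eq)
    obtain n where n: "p = int n" using p(1) by (metis int_eq_iff prime_ge_0_int)
    have n2: "n \<ge> 2" using p(1) n by (metis of_nat_numeral of_nat_le_iff prime_ge_2_int)
    obtain V where V: "valuation_ring V" "inverse (of_nat n) \<notin> V" using valuation_ring_above_prime[OF n2] .
    have R: "subring1 V" using V by (simp add: valuation_ring_def)
    obtain c where c: "b = p * c" using p(2) by blast
    have cp: "coprime a p" using ab(2) c by simp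
    then obtain x y where xy: "a * x + p * y = 1"
      by (metis bezout_int coprime_iff_gcd_eq_1 mult.commute)
    have p0: "p \<noteq> 0" and c0: "c \<noteq> 0" using p ab(1) c by auto
    have "q * of_int (c * x) + of_int y \<in> V"
      by (intro subring1_add subring1_mult subring1_of_int R all V)
    moreover have "q * of_int (c * x) + of_int y = inverse (of_nat n)"
    proof -
      have "q * of_int (c * x) + of_int y = (of_int (a * x + p * y) :: complex) / of_int p"
        using p0 c0 by (simp add: ab(3) c field_simps)
      then show ?thesis unfolding xy by (simp add: n inverse_eq_divide)
    qed
    ultimately show ?thesis using V by simp
  qed
qed

section \<open>The discriminant of a monomial\<close>

context
  fixes \<xi> :: "complex ^ 'n" and n :: "int ^ 'n"
  assumes alg: "\<And>j. algebraic (\<xi> $ j)" and nz: "\<And>j. \<xi> $ j \<noteq> 0"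
begin

text \<open>Replacing the coordinates with negative exponent by their inverses makes all exponents natural
  numbers.\<close>

definition base :: "complex ^ 'n \<Rightarrow> 'n \<Rightarrow> complex" where
  "base \<alpha> j = (if n $ j \<ge> 0 then \<alpha> $ j else inverse (\<alpha> $ j))"

definition expo :: "'n \<Rightarrow> nat" where
  "expo j = nat \<bar>n $ j\<bar>"

lemma monomial_base: "monomial n \<alpha> = (\<Prod>j\<in>UNIV. base \<alpha> j ^ expo j)"
  unfolding monomial_def base_def expo_def by (intro prod.cong refl) (simp add: power_int_def)

lemma orbit_nonzero: "\<alpha> \<in> galois_orbit \<xi> \<Longrightarrow> \<alpha> $ j \<noteq> 0"
  using galois_orbit_conjugates[OF alg, of \<alpha> j] conjugates_nonzero[OF alg nz] by blast

lemma base_algebraic: "\<alpha> \<in> galois_orbit \<xi> \<Longrightarrow> algebraic (base \<alpha> j)"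
  unfolding base_def using galois_orbit_algebraic[OF alg, of \<alpha> j] by (simp add: algebraic_inverse)

lemma base_equivariant:
  "\<sigma> \<in> galois_group \<Longrightarrow> \<alpha> \<in> galois_orbit \<xi> \<Longrightarrow> base (galois_act \<sigma> \<alpha>) j = \<sigma> (base \<alpha> j)"
  unfolding base_def using galois_orbit_algebraic[OF alg, of \<alpha> j] by (simp add: galois_inverse)

lemma base_nonzero: "\<alpha> \<in> galois_orbit \<xi> \<Longrightarrow> base \<alpha> j \<noteq> 0"
  by (simp add: base_def orbit_nonzero)

lemma monomial_algebraic: "\<alpha> \<in> galois_orbit \<xi> \<Longrightarrow> algebraic (monomial n \<alpha>)"
  unfolding monomial_base by (intro algebraic_prod algebraic_power base_algebraic)

lemma monomial_equivariant:
  assumes s: "\<sigma> \<in> galois_group" and a: "\<alpha> \<in> galois_orbit \<xi>"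
  shows "monomial n (galois_act \<sigma> \<alpha>) = \<sigma> (monomial n \<alpha>)"
proof -
  have "\<sigma> (monomial n \<alpha>) = (\<Prod>j\<in>UNIV. \<sigma> (base \<alpha> j ^ expo j))"
    unfolding monomial_base by (rule galois_prod[OF s]) (intro algebraic_power base_algebraic a)
  then show ?thesis
    unfolding monomial_base by (simp add: base_equivariant[OF s a] galois_power[OF s base_algebraic[OF a]])
qed

lemma monomial_nonzero: "\<alpha> \<in> galois_orbit \<xi> \<Longrightarrow> monomial n \<alpha> \<noteq> 0"
  unfolding monomial_base by (simp add: prod_zero_iff base_nonzero)

lemma weil_height_base: "weil_height (base \<xi> j) = weil_height (\<xi> $ j)"
  by (simp add: base_def weil_height_inverse[OF alg nz])

text \<open>The leading coefficient of the product of the linear factors \<open>x - base \<alpha> j\<close> over the orbit, made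
  integral, to the power with which the \<open>j\<close>-th coordinate enters.\<close>

definition denominator :: int where
  "denominator = (\<Prod>j\<in>UNIV. (lead_coeff (int_min_poly (base \<xi> j)) ^
     (card (galois_orbit \<xi>) div card (conjugates (base \<xi> j)))) ^ expo j)"

abbreviation "orb \<equiv> galois_orbit \<xi>"

abbreviation "chi \<equiv> monomial n"

definition distinct_pairs :: "((complex ^ 'n) \<times> (complex ^ 'n)) set" where
  "distinct_pairs = {(\<alpha>, \<beta>) \<in> orb \<times> orb. chi \<alpha> \<noteq> chi \<beta>}"

text \<open>Pairs with equal values are left out, which makes the product nonzero. Each value takes part in at
  most \<open>2 * card orb\<close> factors, hence the exponent.\<close>

definition disc :: complex where
  "disc = of_int denominator ^ (2 * card orb) * (\<Prod>(\<alpha>, \<beta>)\<in>distinct_pairs. chi \<alpha> - chi \<beta>)"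

lemma base_self_algebraic: "algebraic (base \<xi> j)"
  by (rule base_algebraic[OF self_mem_galois_orbit])

lemma denominator_pos: "denominator > 0"
  unfolding denominator_def
  by (intro prod_pos ballI zero_less_power lead_coeff_int_min_poly base_self_algebraic)

lemma finite_orb: "finite orb"
  by (rule finite_galois_orbit[OF alg])

lemma finite_distinct_pairs: "finite distinct_pairs"
  unfolding distinct_pairs_def by (rule finite_subset[of _ "orb \<times> orb"]) (auto simp: finite_orb)

text \<open>Gauss's lemma, one coordinate at a time.\<close>

lemma denominator_large_bases:
  assumes V: "valuation_ring V"
  shows "of_int denominator * (\<Prod>\<alpha>\<in>orb. \<Prod>j\<in>UNIV. (if base \<alpha> j \<in> V then 1 else base \<alpha> j) ^ expo j) \<in> V"
proof -
  have R: "subring1 V" using V by (simp add: valuation_ring_def)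
  have *: "of_int (lead_coeff (int_min_poly (base \<xi> j)) ^ (card orb div card (conjugates (base \<xi> j)))) *
      (\<Prod>\<alpha>\<in>orb. if base \<alpha> j \<in> V then 1 else base \<alpha> j) \<in> V" for j
  proof -
    obtain k P where k: "card orb = k * card (conjugates (base \<xi> j))"
      and P: "cpoly P = smult (of_int (lead_coeff (int_min_poly (base \<xi> j)) ^ k)) (\<Prod>\<alpha>\<in>orb. [:- base \<alpha> j, 1:])"
      using galois_orbit_integer_polynomial[OF alg, of "\<lambda>\<alpha>. base \<alpha> j", OF base_self_algebraic base_equivariant] .
    have "card (conjugates (base \<xi> j)) > 0"
      using finite_conjugates self_mem_conjugates base_self_algebraic by (auto simp: card_gt_0_iff)
    then have "card orb div card (conjugates (base \<xi> j)) = k" by (simp add: k)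
    moreover have "(\<Prod>\<alpha>\<in>orb. if base \<alpha> j \<in> V then 1 else base \<alpha> j) = (\<Prod>\<alpha>\<in>{\<alpha>\<in>orb. base \<alpha> j \<notin> V}. base \<alpha> j)"
      by (rule prod.mono_neutral_cong_right) (auto simp: finite_orb)
    ultimately show ?thesis
      using lead_coeff_times_large_roots_in_valuation_ring[OF V finite_orb P] by simp
  qed
  have "of_int denominator * (\<Prod>\<alpha>\<in>orb. \<Prod>j\<in>UNIV. (if base \<alpha> j \<in> V then 1 else base \<alpha> j) ^ expo j) =
    (\<Prod>j\<in>UNIV. (of_int (lead_coeff (int_min_poly (base \<xi> j)) ^ (card orb div card (conjugates (base \<xi> j)))) *
      (\<Prod>\<alpha>\<in>orb. if base \<alpha> j \<in> V then 1 else base \<alpha> j)) ^ expo j)"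
    unfolding denominator_def prod.swap[of _ UNIV] of_int_prod of_int_power prod_power_distrib[symmetric]
      prod.distrib[symmetric] power_mult_distrib ..
  also have "\<dots> \<in> V" by (intro subring1_prod[OF R] subring1_power[OF R] *)
  finally show ?thesis .
qed

text \<open>Write each value as \<open>m \<alpha>\<close>, the part outside \<open>V\<close>, times an element of \<open>V\<close>. The differences are then
  \<open>m \<alpha> * m \<beta>\<close> times elements of \<open>V\<close>, and since the inverses of the \<open>m\<close> lie in \<open>V\<close>, the product over the
  distinct pairs may be completed to all pairs; that product is cleared by the denominator.\<close>

lemma disc_in_valuation_ring:
  assumes V: "valuation_ring V"
  shows "disc \<in> V"
proof -
  have R: "subring1 V" and val: "\<And>x. x \<in> V \<or> inverse x \<in> V" using V by (auto simp: valuation_ring_def)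
  define m where "m = (\<lambda>\<alpha>. \<Prod>j\<in>UNIV. (if base \<alpha> j \<in> V then 1 else base \<alpha> j) ^ expo j)"
  define v where "v = (\<lambda>\<alpha>. \<Prod>j\<in>UNIV. (if base \<alpha> j \<in> V then base \<alpha> j else 1) ^ expo j)"
  have chi: "chi \<alpha> = m \<alpha> * v \<alpha>" for \<alpha>
    unfolding monomial_base m_def v_def prod.distrib[symmetric] power_mult_distrib[symmetric]
    by (intro prod.cong refl) simp
  have vV: "v \<alpha> \<in> V" for \<alpha>
    unfolding v_def by (intro subring1_prod[OF R] subring1_power[OF R]) (simp add: subring1_one[OF R])
  have mV: "inverse (m \<alpha>) \<in> V" for \<alpha>
  proof -
    have "inverse (m \<alpha>) = (\<Prod>j\<in>UNIV. inverse (if base \<alpha> j \<in> V then 1 else base \<alpha> j) ^ expo j)"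
      unfolding m_def prod_inversef[symmetric] by (simp add: power_inverse)
    also have "\<dots> \<in> V"
      using val by (intro subring1_prod[OF R] subring1_power[OF R]) (auto simp: subring1_one[OF R])
    finally show ?thesis .
  qed
  have m0: "m \<alpha> \<noteq> 0" if "\<alpha> \<in> orb" for \<alpha>
    unfolding m_def using base_nonzero[OF that] by (simp add: prod_zero_iff)
  let ?D = distinct_pairs and ?E = "orb \<times> orb - distinct_pairs"
  have DE: "orb \<times> orb = ?D \<union> ?E" "?D \<inter> ?E = {}" by (auto simp: distinct_pairs_def)
  define M where "M = (\<lambda>(\<alpha>, \<beta>). m \<alpha> * m \<beta>)"
  have M0: "M z \<noteq> 0" if "z \<in> orb \<times> orb" for z using that m0 by (auto simp: M_def)
  have "(\<Prod>(\<alpha>, \<beta>)\<in>?D. chi \<alpha> - chi \<beta>) = (\<Prod>z\<in>?D. M z * (case z of (\<alpha>, \<beta>) \<Rightarrow> v \<alpha> * inverse (m \<beta>) - v \<beta> * inverse (m \<alpha>)))"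
    by (rule prod.cong[OF refl]) (auto simp: M_def distinct_pairs_def chi m0 field_simps)
  also have "\<dots> = prod M ?D * (\<Prod>(\<alpha>, \<beta>)\<in>?D. v \<alpha> * inverse (m \<beta>) - v \<beta> * inverse (m \<alpha>))"
    by (rule prod.distrib)
  also have "prod M ?D = prod M (orb \<times> orb) * (\<Prod>z\<in>?E. inverse (M z))"
  proof -
    have "prod M (orb \<times> orb) = prod M ?D * prod M ?E"
      by (subst DE(1), rule prod.union_disjoint) (use DE(2) finite_distinct_pairs finite_orb in auto)
    moreover have "prod M ?E * (\<Prod>z\<in>?E. inverse (M z)) = 1"
      unfolding prod.distrib[symmetric] using M0 by (intro prod.neutral) auto
    ultimately show ?thesis by (simp add: mult.assoc)
  qed
  also have "prod M (orb \<times> orb) = (\<Prod>\<alpha>\<in>orb. m \<alpha>) ^ (2 * card orb)"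
  proof -
    have "prod M (orb \<times> orb) = (\<Prod>\<alpha>\<in>orb. \<Prod>\<beta>\<in>orb. m \<alpha> * m \<beta>)"
      unfolding M_def by (rule prod.cartesian_product[symmetric])
    also have "\<dots> = (\<Prod>\<alpha>\<in>orb. m \<alpha>) ^ card orb * (\<Prod>\<alpha>\<in>orb. m \<alpha>) ^ card orb"
      by (simp add: prod.distrib prod_power_distrib)
    finally show ?thesis by (simp add: mult_2 power_add)
  qed
  finally have "disc = (of_int denominator * (\<Prod>\<alpha>\<in>orb. m \<alpha>)) ^ (2 * card orb) * (\<Prod>z\<in>?E. inverse (M z)) *
      (\<Prod>(\<alpha>, \<beta>)\<in>?D. v \<alpha> * inverse (m \<beta>) - v \<beta> * inverse (m \<alpha>))"
    unfolding disc_def by (simp add: power_mult_distrib mult.assoc)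
  also have "\<dots> \<in> V"
  proof (intro subring1_mult[OF R, of "_ * _"] subring1_mult[OF R, of "_ ^ _"])
    have "of_int denominator * prod m orb \<in> V" unfolding m_def by (rule denominator_large_bases[OF V])
    then show "(of_int denominator * prod m orb) ^ (2 * card orb) \<in> V" by (rule subring1_power[OF R])
    have "inverse (M z) \<in> V" for z
      unfolding M_def by (cases z) (simp add: subring1_mult[OF R] mV)
    then show "(\<Prod>z\<in>?E. inverse (M z)) \<in> V" by (intro subring1_prod[OF R])
    have "(case z of (\<alpha>, \<beta>) \<Rightarrow> v \<alpha> * inverse (m \<beta>) - v \<beta> * inverse (m \<alpha>)) \<in> V" for z
      by (cases z) (simp add: subring1_mult[OF R] subring1_diff[OF R] mV vV)
    then show "(\<Prod>(\<alpha>, \<beta>)\<in>?D. v \<alpha> * inverse (m \<beta>) - v \<beta> * inverse (m \<alpha>)) \<in> V"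
      by (intro subring1_prod[OF R])
  qed
  finally show ?thesis .
qed

text \<open>A Galois automorphism permutes the distinct pairs, so it fixes the product.\<close>

lemma disc_integer: "disc \<in> \<int>"
proof (rule rational_in_all_valuation_rings)
  show "disc \<in> V" if "valuation_ring V" for V using disc_in_valuation_ring[OF that] .
  have alg_factor: "algebraic (case z of (\<alpha>, \<beta>) \<Rightarrow> chi \<alpha> - chi \<beta>)" if "z \<in> distinct_pairs" for z
    using that by (auto simp: distinct_pairs_def intro!: algebraic_diff monomial_algebraic)
  have alg_prod: "algebraic (\<Prod>(\<alpha>, \<beta>)\<in>distinct_pairs. chi \<alpha> - chi \<beta>)"
    by (rule algebraic_prod[OF alg_factor])
  have alg_den: "algebraic (of_int denominator ^ (2 * card orb) :: complex)"
    by (rule rat_imp_algebraic) simp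
  show "disc \<in> \<rat>"
  proof (rule galois_fixed_imp_rational)
    show "algebraic disc" unfolding disc_def by (rule algebraic_mult[OF alg_den alg_prod])
    fix \<sigma> assume s: "\<sigma> \<in> galois_group"
    let ?h = "map_prod (galois_act \<sigma>) (galois_act \<sigma>) :: (complex ^ 'n) \<times> (complex ^ 'n) \<Rightarrow> _"
    have b: "bij_betw (galois_act \<sigma>) orb orb" by (rule galois_act_bij[OF alg s])
    have eq: "chi (galois_act \<sigma> \<alpha>) = chi (galois_act \<sigma> \<beta>) \<longleftrightarrow> chi \<alpha> = chi \<beta>" if "\<alpha> \<in> orb" "\<beta> \<in> orb" for \<alpha> \<beta>
      unfolding monomial_equivariant[OF s that(1)] monomial_equivariant[OF s that(2)]
      by (rule galois_inj[OF s monomial_algebraic monomial_algebraic]) (use that in auto)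
    have inj: "inj_on ?h distinct_pairs"
      using b by (auto simp: inj_on_def bij_betw_def distinct_pairs_def)
    have "?h ` distinct_pairs \<subseteq> distinct_pairs"
      using b eq by (auto simp: distinct_pairs_def bij_betw_def)
    then have "?h ` distinct_pairs = distinct_pairs" using endo_inj_surj[OF finite_distinct_pairs _ inj] by blast
    then have bij: "bij_betw ?h distinct_pairs distinct_pairs" using inj by (simp add: bij_betw_def)
    have "\<sigma> disc = \<sigma> (of_int denominator ^ (2 * card orb)) * \<sigma> (\<Prod>(\<alpha>, \<beta>)\<in>distinct_pairs. chi \<alpha> - chi \<beta>)"
      unfolding disc_def by (rule galois_mult[OF s alg_den alg_prod])
    also have "\<sigma> (of_int denominator ^ (2 * card orb)) = of_int denominator ^ (2 * card orb)"
      by (rule galois_rat[OF s]) simp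
    also have "\<sigma> (\<Prod>(\<alpha>, \<beta>)\<in>distinct_pairs. chi \<alpha> - chi \<beta>) = (\<Prod>z\<in>distinct_pairs. \<sigma> (case z of (\<alpha>, \<beta>) \<Rightarrow> chi \<alpha> - chi \<beta>))"
      by (rule galois_prod[OF s alg_factor])
    also have "\<dots> = (\<Prod>z\<in>distinct_pairs. case ?h z of (\<alpha>, \<beta>) \<Rightarrow> chi \<alpha> - chi \<beta>)"
      by (rule prod.cong[OF refl])
         (auto simp: distinct_pairs_def galois_diff[OF s monomial_algebraic monomial_algebraic] monomial_equivariant[OF s])
    also have "\<dots> = (\<Prod>(\<alpha>, \<beta>)\<in>distinct_pairs. chi \<alpha> - chi \<beta>)"
      by (rule prod.reindex_bij_betw[OF bij])
    finally show "\<sigma> disc = disc" by (simp add: disc_def)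
  qed
qed

lemma disc_nonzero: "disc \<noteq> 0"
  unfolding disc_def using denominator_pos finite_distinct_pairs
  by (auto simp: prod_zero_iff distinct_pairs_def)

lemma norm_disc_ge_1: "norm disc \<ge> 1"
proof -
  obtain k where k: "disc = of_int k" using disc_integer by (elim Ints_cases)
  then have "k \<noteq> 0" using disc_nonzero by auto
  then have "\<bar>k\<bar> \<ge> 1" by linarith
  then show ?thesis unfolding k by (metis norm_of_int of_int_1_le_iff of_int_abs)
qed

lemma log_disc_nonneg:
  "0 \<le> 2 * card orb * ln (real_of_int denominator) + (\<Sum>(\<alpha>, \<beta>)\<in>distinct_pairs. ln (norm (chi \<alpha> - chi \<beta>)))"
proof -
  have d: "real_of_int denominator > 0" using denominator_pos by simp
  have pos: "norm (case z of (\<alpha>, \<beta>) \<Rightarrow> chi \<alpha> - chi \<beta>) > 0" if "z \<in> distinct_pairs" for z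
    using that by (auto simp: distinct_pairs_def)
  have "0 \<le> ln (norm disc)" using norm_disc_ge_1 by simp
  also have "norm disc = real_of_int denominator ^ (2 * card orb) * (\<Prod>z\<in>distinct_pairs. norm (case z of (\<alpha>, \<beta>) \<Rightarrow> chi \<alpha> - chi \<beta>))"
    unfolding disc_def norm_mult prod_norm[symmetric] norm_power using d by simp
  also have "ln \<dots> = ln (real_of_int denominator ^ (2 * card orb)) + ln (\<Prod>z\<in>distinct_pairs. norm (case z of (\<alpha>, \<beta>) \<Rightarrow> chi \<alpha> - chi \<beta>))"
    by (rule ln_mult_pos) (use d pos in \<open>auto intro!: prod_pos\<close>)
  also have "ln (\<Prod>z\<in>distinct_pairs. norm (case z of (\<alpha>, \<beta>) \<Rightarrow> chi \<alpha> - chi \<beta>)) =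
     (\<Sum>z\<in>distinct_pairs. ln (norm (case z of (\<alpha>, \<beta>) \<Rightarrow> chi \<alpha> - chi \<beta>)))"
    by (rule ln_prod[OF finite_distinct_pairs]) (use pos in fastforce)
  finally show ?thesis using d by (simp add: ln_realpow case_prod_unfold)
qed

lemma ln_denominator:
  "ln (real_of_int denominator) = card orb *
    (\<Sum>j\<in>UNIV. expo j * (ln (lead_coeff (int_min_poly (base \<xi> j))) / card (conjugates (base \<xi> j))))"
proof -
  have l: "real_of_int (lead_coeff (int_min_poly (base \<xi> j))) > 0" for j
    using lead_coeff_int_min_poly[OF base_self_algebraic] by simp
  have k: "real (card orb div card (conjugates (base \<xi> j))) = card orb / card (conjugates (base \<xi> j))" for j
  proof -
    obtain k where "card orb = k * card (conjugates (base \<xi> j))"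
      using galois_orbit_fibres[OF alg, of "\<lambda>\<alpha>. base \<alpha> j", OF base_self_algebraic base_equivariant] by metis
    then have "card (conjugates (base \<xi> j)) dvd card orb" by simp
    then show ?thesis by (rule real_of_nat_div)
  qed
  have "ln (real_of_int denominator) = ln (\<Prod>j\<in>UNIV. (real_of_int (lead_coeff (int_min_poly (base \<xi> j))) ^
     (card orb div card (conjugates (base \<xi> j)))) ^ expo j)"
    by (simp add: denominator_def)
  also have "\<dots> = (\<Sum>j\<in>UNIV. ln ((real_of_int (lead_coeff (int_min_poly (base \<xi> j))) ^
     (card orb div card (conjugates (base \<xi> j)))) ^ expo j))"
    by (rule ln_prod) (simp_all add: int_min_poly_nonzero[OF base_self_algebraic])
  also have "\<dots> = (\<Sum>j\<in>UNIV. card orb * (expo j * (ln (lead_coeff (int_min_poly (base \<xi> j))) / card (conjugates (base \<xi> j)))))"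
    by (rule sum.cong[OF refl]) (use l in \<open>simp add: ln_realpow k\<close>)
  finally show ?thesis by (simp add: sum_distrib_left)
qed

lemma log_plus_monomial:
  assumes a: "\<alpha> \<in> orb"
  shows "log_plus (norm (chi \<alpha>)) \<le> (\<Sum>j\<in>UNIV. expo j * log_plus (norm (base \<alpha> j)))"
    and "\<bar>ln (norm (chi \<alpha>))\<bar> \<le> (\<Sum>j\<in>UNIV. expo j * \<bar>ln (norm (base \<alpha> j))\<bar>)"
proof -
  have p: "norm (base \<alpha> j) > 0" for j using base_nonzero[OF a] by simp
  have "ln (norm (chi \<alpha>)) = ln (\<Prod>j\<in>UNIV. norm (base \<alpha> j) ^ expo j)"
    unfolding monomial_base by (simp add: norm_power flip: prod_norm)
  also have "\<dots> = (\<Sum>j\<in>UNIV. ln (norm (base \<alpha> j) ^ expo j))"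
    by (rule ln_prod) (use p in auto)
  also have "\<dots> = (\<Sum>j\<in>UNIV. expo j * ln (norm (base \<alpha> j)))"
    by (rule sum.cong[OF refl]) (use p in \<open>simp add: ln_realpow\<close>)
  finally have l: "ln (norm (chi \<alpha>)) = (\<Sum>j\<in>UNIV. expo j * ln (norm (base \<alpha> j)))" .
  show "\<bar>ln (norm (chi \<alpha>))\<bar> \<le> (\<Sum>j\<in>UNIV. expo j * \<bar>ln (norm (base \<alpha> j))\<bar>)"
    unfolding l by (rule order_trans[OF sum_abs]) (simp add: abs_mult)
  have "(\<Sum>j\<in>UNIV. expo j * ln (norm (base \<alpha> j))) \<le> (\<Sum>j\<in>UNIV. expo j * log_plus (norm (base \<alpha> j)))"
    using p by (intro sum_mono mult_left_mono) (simp_all add: log_plus_altdef)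
  moreover have "0 \<le> (\<Sum>j\<in>UNIV. expo j * log_plus (norm (base \<alpha> j)))"
    by (intro sum_nonneg mult_nonneg_nonneg log_plus_nonneg) simp
  moreover have "norm (chi \<alpha>) > 0" using monomial_nonzero[OF a] by simp
  ultimately show "log_plus (norm (chi \<alpha>)) \<le> (\<Sum>j\<in>UNIV. expo j * log_plus (norm (base \<alpha> j)))"
    by (simp add: log_plus_altdef l)
qed

definition monomial_height :: real where
  "monomial_height = (\<Sum>j\<in>UNIV. expo j * weil_height (\<xi> $ j))"

text \<open>The arithmetic and the archimedean parts of the heights of the coordinates appear separately on the
  left.\<close>

lemma monomial_height_bound:
  "ln (real_of_int denominator) + (\<Sum>\<alpha>\<in>orb. log_plus (norm (chi \<alpha>))) \<le> card orb * monomial_height"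
proof -
  have c: "real (card orb) > 0" using card_galois_orbit_pos[OF alg] by simp
  have "(\<Sum>\<alpha>\<in>orb. log_plus (norm (chi \<alpha>))) \<le> (\<Sum>\<alpha>\<in>orb. \<Sum>j\<in>UNIV. expo j * log_plus (norm (base \<alpha> j)))"
    by (intro sum_mono log_plus_monomial)
  also have "\<dots> = (\<Sum>j\<in>UNIV. expo j * (\<Sum>\<alpha>\<in>orb. log_plus (norm (base \<alpha> j))))"
    by (subst sum.swap) (simp add: sum_distrib_left)
  also have "\<dots> = card orb * (\<Sum>j\<in>UNIV. expo j * ((\<Sum>y\<in>conjugates (base \<xi> j). log_plus (norm y)) / card (conjugates (base \<xi> j))))"
    unfolding sum_distrib_left[of "real (card orb)"]
  proof (rule sum.cong[OF refl])
    fix j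
    have "(\<Sum>\<alpha>\<in>orb. log_plus (norm (base \<alpha> j))) / card orb =
        (\<Sum>y\<in>conjugates (base \<xi> j). log_plus (norm y)) / card (conjugates (base \<xi> j))"
      by (rule galois_orbit_average[OF alg, of "\<lambda>\<alpha>. base \<alpha> j", OF base_self_algebraic base_equivariant])
    then show "expo j * (\<Sum>\<alpha>\<in>orb. log_plus (norm (base \<alpha> j))) = card orb *
       (expo j * ((\<Sum>y\<in>conjugates (base \<xi> j). log_plus (norm y)) / card (conjugates (base \<xi> j))))"
      using c by (simp add: field_simps)
  qed
  finally have "ln (real_of_int denominator) + (\<Sum>\<alpha>\<in>orb. log_plus (norm (chi \<alpha>))) \<le>
    card orb * (\<Sum>j\<in>UNIV. expo j * weil_height (base \<xi> j))"
    unfolding ln_denominator weil_height_conjugates[OF base_self_algebraic]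
    by (simp add: add_divide_distrib distrib_left sum.distrib)
  then show ?thesis by (simp add: weil_height_base monomial_height_def)
qed

lemma average_abs_ln_monomial:
  "(\<Sum>\<alpha>\<in>orb. \<bar>ln (norm (chi \<alpha>))\<bar>) / card orb \<le> 2 * monomial_height"
proof -
  have "(\<Sum>\<alpha>\<in>orb. \<bar>ln (norm (chi \<alpha>))\<bar>) / card orb \<le> (\<Sum>\<alpha>\<in>orb. \<Sum>j\<in>UNIV. expo j * \<bar>ln (norm (base \<alpha> j))\<bar>) / card orb"
    by (intro divide_right_mono sum_mono log_plus_monomial) simp_all
  also have "\<dots> = (\<Sum>j\<in>UNIV. expo j * ((\<Sum>\<alpha>\<in>orb. \<bar>ln (norm (base \<alpha> j))\<bar>) / card orb))"
    by (subst sum.swap) (simp add: sum_distrib_left sum_divide_distrib)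
  also have "\<dots> \<le> (\<Sum>j\<in>UNIV. expo j * (2 * weil_height (base \<xi> j)))"
  proof (intro sum_mono mult_left_mono)
    fix j
    have "(\<Sum>\<alpha>\<in>orb. \<bar>ln (norm (base \<alpha> j))\<bar>) / card orb =
      (\<Sum>y\<in>conjugates (base \<xi> j). \<bar>ln (norm y)\<bar>) / card (conjugates (base \<xi> j))"
      by (rule galois_orbit_average[OF alg, of "\<lambda>\<alpha>. base \<alpha> j", OF base_self_algebraic base_equivariant])
    also have "\<dots> \<le> 2 * weil_height (base \<xi> j)"
      by (rule sum_abs_ln_conjugates_le[OF base_self_algebraic base_nonzero[OF self_mem_galois_orbit]])
    finally show "(\<Sum>\<alpha>\<in>orb. \<bar>ln (norm (base \<alpha> j))\<bar>) / card orb \<le> 2 * weil_height (base \<xi> j)" .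
  qed simp
  finally show ?thesis by (simp add: weil_height_base monomial_height_def sum_distrib_left mult_ac)
qed

end

section \<open>Equidistribution of the arguments of a monomial\<close>

text \<open>Reflection in the unit circle moves points into the closed disc without changing their argument.\<close>

definition fold_disc :: "complex \<Rightarrow> complex" where
  "fold_disc z = (if norm z \<le> 1 then z else inverse (cnj z))"

lemma norm_fold_disc_le_1: "norm (fold_disc z) \<le> 1"
  by (auto simp: fold_disc_def norm_inverse intro: inverse_le_1_iff[THEN iffD2])

lemma norm_one_minus_mult_cnj:
  fixes z w :: complex
  shows "(norm (1 - z * cnj w))\<^sup>2 = (norm (z - w))\<^sup>2 + (1 - (norm z)\<^sup>2) * (1 - (norm w)\<^sup>2)"
  by (simp add: cmod_power2 algebra_simps) (simp add: power2_eq_square algebra_simps)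

lemma norm_one_minus_cnj: "norm (1 - cnj z * w) = norm (1 - z * cnj w)"
proof -
  have "cnj (1 - z * cnj w) = 1 - cnj z * w" by simp
  then show ?thesis by (metis complex_mod_cnj)
qed

text \<open>In the disc \<open>\<bar>z - w\<bar> \<le> \<bar>1 - z cnj w\<bar>\<close>; reflecting a point costs a factor equal to its modulus.\<close>

lemma norm_diff_le_fold_disc:
  assumes z: "z \<noteq> 0" and w: "w \<noteq> 0"
  shows "norm (z - w) \<le> max 1 (norm z) * max 1 (norm w) * norm (1 - fold_disc z * cnj (fold_disc w))"
proof -
  have same: "norm (z - w) \<le> norm (1 - z * cnj w)" if "0 \<le> (1 - (norm z)\<^sup>2) * (1 - (norm w)\<^sup>2)"
  proof (rule power2_le_imp_le[OF _ norm_ge_zero])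
    show "(norm (z - w))\<^sup>2 \<le> (norm (1 - z * cnj w))\<^sup>2"
      using norm_one_minus_mult_cnj[of z w] that by linarith
  qed
  have cz: "cnj z * inverse (cnj z) = 1" and cw: "w * inverse w = 1" using z w by simp_all
  show ?thesis
  proof (cases "norm z \<le> 1"; cases "norm w \<le> 1")
    assume 1: "norm z \<le> 1" "norm w \<le> 1"
    then have "(norm z)\<^sup>2 \<le> 1" "(norm w)\<^sup>2 \<le> 1" by (simp_all add: power_le_one)
    then have "0 \<le> (1 - (norm z)\<^sup>2) * (1 - (norm w)\<^sup>2)" by (intro mult_nonneg_nonneg) auto
    from same[OF this] show ?thesis using 1 by (simp add: fold_disc_def)
  next
    assume 2: "norm z \<le> 1" "\<not> norm w \<le> 1"
    have "w * (1 - z * inverse w) = w - z * (w * inverse w)" by (simp only: right_diff_distrib mult_1_right mult.left_commute)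
    then have "norm w * norm (1 - z * inverse w) = norm (w - z)" by (simp only: cw mult_1_right norm_mult[symmetric])
    then show ?thesis using 2 by (simp add: fold_disc_def norm_minus_commute)
  next
    assume 3: "\<not> norm z \<le> 1" "norm w \<le> 1"
    have "cnj z * (1 - inverse (cnj z) * cnj w) = cnj z - (cnj z * inverse (cnj z)) * cnj w"
      by (simp only: right_diff_distrib mult_1_right mult.assoc)
    then have "norm (cnj z) * norm (1 - inverse (cnj z) * cnj w) = norm (cnj (z - w))"
      by (simp only: cz mult_1_left norm_mult[symmetric]) simp
    then have "norm z * norm (1 - inverse (cnj z) * cnj w) = norm (z - w)"
      by (simp only: complex_mod_cnj)
    then show ?thesis using 3 by (simp add: fold_disc_def)
  next
    assume 4: "\<not> norm z \<le> 1" "\<not> norm w \<le> 1"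
    have "cnj z * w * (1 - inverse (cnj z) * inverse w) = cnj z * w - (cnj z * inverse (cnj z)) * (w * inverse w)"
      by (simp only: right_diff_distrib mult_1_right mult.assoc mult.left_commute)
    then have "norm (cnj z * w) * norm (1 - inverse (cnj z) * inverse w) = norm (- (1 - cnj z * w))"
      by (simp only: cz cw mult_1_left norm_mult[symmetric] minus_diff_eq)
    then have eq: "norm z * norm w * norm (1 - inverse (cnj z) * inverse w) = norm (1 - z * cnj w)"
      by (simp only: norm_minus_cancel norm_one_minus_cnj norm_mult complex_mod_cnj)
    have "1 \<le> (norm z)\<^sup>2" "1 \<le> (norm w)\<^sup>2" using 4 by (simp_all add: one_le_power)
    then have "0 \<le> (1 - (norm z)\<^sup>2) * (1 - (norm w)\<^sup>2)" by (intro mult_nonpos_nonpos) auto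
    from same[OF this] show ?thesis using eq 4 by (simp add: fold_disc_def)
  qed
qed

text \<open>Shrinking \<open>\<zeta>\<close> keeps the kernel finite on the diagonal; the constant is attained at \<open>\<zeta> = - 1\<close>.\<close>

lemma norm_one_minus_regularize:
  fixes \<zeta> :: complex
  assumes z: "norm \<zeta> \<le> 1" and r: "0 < \<rho>" "\<rho> < 1"
  shows "norm (1 - \<zeta>) \<le> 2 / (1 + \<rho>) * norm (1 - of_real \<rho> * \<zeta>)"
proof -
  have sq: "(norm \<zeta>)\<^sup>2 \<le> 1" using z by (simp add: power_le_one)
  have re: "Re \<zeta> \<ge> - 1" using z abs_Re_le_cmod[of \<zeta>] by linarith
  have "((1 + \<rho>) * norm (1 - \<zeta>))\<^sup>2 \<le> (2 * norm (1 - of_real \<rho> * \<zeta>))\<^sup>2"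
  proof -
    have e: "(norm (1 - of_real t * \<zeta>))\<^sup>2 = 1 - 2 * t * Re \<zeta> + t\<^sup>2 * (norm \<zeta>)\<^sup>2" for t :: real
      unfolding cmod_power2 by (simp add: power2_eq_square algebra_simps)
    have "(2 * norm (1 - of_real \<rho> * \<zeta>))\<^sup>2 - ((1 + \<rho>) * norm (1 - \<zeta>))\<^sup>2 =
      (1 - \<rho>) * ((3 + \<rho>) + 2 * Re \<zeta> * (1 - \<rho>) - (norm \<zeta>)\<^sup>2 * (1 + 3 * \<rho>))"
      using e[of \<rho>] e[of 1] by (simp add: power_mult_distrib) (simp add: power2_eq_square algebra_simps)
    moreover have "(3 + \<rho>) + 2 * Re \<zeta> * (1 - \<rho>) - (norm \<zeta>)\<^sup>2 * (1 + 3 * \<rho>) \<ge> (3 + \<rho>) + 2 * (-1) * (1 - \<rho>) - 1 * (1 + 3 * \<rho>)"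
      using r re sq by (intro diff_mono add_mono mult_right_mono) auto
    then have "(1 - \<rho>) * ((3 + \<rho>) + 2 * Re \<zeta> * (1 - \<rho>) - (norm \<zeta>)\<^sup>2 * (1 + 3 * \<rho>)) \<ge> 0"
      using r by (intro mult_nonneg_nonneg) auto
    ultimately show ?thesis by linarith
  qed
  then have "(1 + \<rho>) * norm (1 - \<zeta>) \<le> 2 * norm (1 - of_real \<rho> * \<zeta>)"
    by (rule power2_le_imp_le) simp
  then show ?thesis using r by (simp add: field_simps)
qed

text \<open>The logarithmic series turns the sum into \<open>- (\<Sum>m. \<rho> ^ m / m * \<bar>\<Sum>a. z a ^ m\<bar>\<^sup>2)\<close>, all of whose terms
  have the same sign; the bound keeps the term for \<open>m = 1\<close>.\<close>

lemma sum_ln_kernel_le: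
  fixes z :: "'a \<Rightarrow> complex"
  assumes z: "\<And>a. a \<in> S \<Longrightarrow> norm (z a) \<le> 1" and r: "0 < \<rho>" "\<rho> < 1"
  shows "(\<Sum>(a, b)\<in>S \<times> S. ln (norm (1 - of_real \<rho> * (z a * cnj (z b))))) \<le> - \<rho> * (norm (\<Sum>a\<in>S. z a))\<^sup>2"
proof -
  define q where "q = (\<lambda>(a, b). of_real \<rho> * (z a * cnj (z b)))"
  define T where "T = (\<lambda>m::nat. \<rho> ^ m / m * (norm (\<Sum>a\<in>S. z a ^ m))\<^sup>2)"
  have qn: "norm (q p) < 1" if p: "p \<in> S \<times> S" for p
  proof -
    obtain a b where ab: "p = (a, b)" "a \<in> S" "b \<in> S" using p by auto
    have "norm (z a) * norm (z b) \<le> 1" using z ab by (intro mult_le_one) auto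
    then have "\<rho> * (norm (z a) * norm (z b)) \<le> \<rho>" using r by (intro mult_left_le) auto
    moreover have "norm (q p) = \<rho> * (norm (z a) * norm (z b))" using r by (simp add: q_def ab norm_mult)
    ultimately show ?thesis using r by linarith
  qed
  have s1: "(\<lambda>m. Re (- (q p ^ m) / of_nat m)) sums ln (norm (1 - q p))" if "p \<in> S \<times> S" for p
  proof -
    have "1 - q p \<noteq> 0" using qn[OF that] by (metis eq_iff_diff_eq_0 less_irrefl norm_one)
    then show ?thesis using sums_Re[OF Ln_series'[of "- q p"]] qn[OF that] by simp
  qed
  have "(\<lambda>m. \<Sum>p\<in>S \<times> S. Re (- (q p ^ m) / of_nat m)) sums (\<Sum>p\<in>S \<times> S. ln (norm (1 - q p)))"
    by (rule sums_sum) (rule s1)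
  also have "(\<lambda>m. \<Sum>p\<in>S \<times> S. Re (- (q p ^ m) / of_nat m)) = (\<lambda>m. - T m)"
  proof
    fix m :: nat
    have "(\<Sum>p\<in>S \<times> S. q p ^ m) = (\<Sum>a\<in>S. \<Sum>b\<in>S. of_real (\<rho> ^ m) * (z a ^ m * cnj (z b ^ m)))"
      unfolding sum.cartesian_product by (intro sum.cong refl) (auto simp: q_def power_mult_distrib)
    also have "\<dots> = of_real (\<rho> ^ m) * ((\<Sum>a\<in>S. z a ^ m) * cnj (\<Sum>b\<in>S. z b ^ m))"
    proof -
      have "(\<Sum>a\<in>S. z a ^ m) * cnj (\<Sum>b\<in>S. z b ^ m) = (\<Sum>a\<in>S. \<Sum>b\<in>S. z a ^ m * cnj (z b ^ m))"
        by (simp only: cnj_sum sum_product)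
      then show ?thesis by (simp only: sum_distrib_left)
    qed
    also have "\<dots> = of_real (\<rho> ^ m * (norm (\<Sum>a\<in>S. z a ^ m))\<^sup>2)"
      by (simp only: complex_norm_square of_real_mult)
    finally have *: "(\<Sum>p\<in>S \<times> S. q p ^ m) = of_real (\<rho> ^ m * (norm (\<Sum>a\<in>S. z a ^ m))\<^sup>2)" .
    have "(\<Sum>p\<in>S \<times> S. Re (- (q p ^ m) / of_nat m)) = Re (- (\<Sum>p\<in>S \<times> S. q p ^ m) / of_nat m)"
      by (simp add: sum_divide_distrib sum_negf)
    also have "\<dots> = - T m" unfolding * T_def by simp
    finally show "(\<Sum>p\<in>S \<times> S. Re (- (q p ^ m) / of_nat m)) = - T m" .
  qed
  finally have "(\<lambda>m. - T m) sums (\<Sum>p\<in>S \<times> S. ln (norm (1 - q p)))" .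
  from sums_minus[OF this] have sT: "T sums - (\<Sum>p\<in>S \<times> S. ln (norm (1 - q p)))"
    by (simp only: minus_minus)
  have "T 1 = (\<Sum>m\<in>{1}. T m)" by simp
  also have "\<dots> \<le> suminf T"
    by (rule sum_le_suminf[OF sums_summable[OF sT]]) (use r in \<open>simp_all add: T_def\<close>)
  also have "\<dots> = - (\<Sum>p\<in>S \<times> S. ln (norm (1 - q p)))" using sums_unique[OF sT] by simp
  finally show ?thesis by (simp add: T_def q_def case_prod_unfold)
qed

text \<open>Both points lie on the same ray, at distances 1 and \<open>exp (- \<bar>ln (norm z)\<bar>)\<close> from the origin.\<close>

lemma norm_sgn_minus_fold_disc_le:
  assumes "z \<noteq> 0" shows "norm (sgn z - fold_disc z) \<le> \<bar>ln (norm z)\<bar>"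
proof -
  have p: "norm z > 0" using assms by simp
  define t where "t = exp (- \<bar>ln (norm z)\<bar>)"
  have t: "t \<le> 1" "1 - t \<le> \<bar>ln (norm z)\<bar>"
    using exp_ge_add_one_self[of "- \<bar>ln (norm z)\<bar>"] by (auto simp: t_def)
  have "fold_disc z = of_real t * sgn z"
  proof (cases "norm z \<le> 1")
    case True
    then have "ln (norm z) \<le> 0" using p by simp
    then have "t = norm z" using p by (simp add: t_def)
    then show ?thesis using True assms by (simp add: fold_disc_def sgn_eq)
  next
    case False
    then have "t = inverse (norm z)" using p by (simp add: t_def exp_minus)
    moreover have "inverse (cnj z) = z / (of_real (norm z))\<^sup>2"
      using assms complex_norm_square[of z] by (simp add: field_simps)
    moreover have "of_real (inverse (norm z)) * sgn z = z / (of_real (norm z))\<^sup>2"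
      by (simp add: sgn_eq power2_eq_square inverse_eq_divide)
    ultimately show ?thesis using False by (simp add: fold_disc_def)
  qed
  then have "sgn z - fold_disc z = of_real (1 - t) * sgn z" by (simp add: algebra_simps)
  then have "norm (sgn z - fold_disc z) = 1 - t" using assms t by (simp only: norm_mult norm_of_real) (simp add: norm_sgn)
  then show ?thesis using t by simp
qed

context
  fixes \<xi> :: "complex ^ 'n" and n :: "int ^ 'n"
  assumes alg: "\<And>j. algebraic (\<xi> $ j)" and nz: "\<And>j. \<xi> $ j \<noteq> 0"
begin

text \<open>The discriminant bounds \<open>\<Sum> ln \<bar>\<chi> \<alpha> - \<chi> \<beta>\<bar>\<close> over the distinct pairs from below, the kernel bounds it
  from above. Completing the kernel sum to all pairs costs \<open>ln (1 / (1 - \<rho>))\<close> for each pair with equal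
  values, a proportion of one in \<open>d\<close>.\<close>

lemma monomial_energy_bound:
  assumes r: "0 < \<rho>" "\<rho> < 1"
  shows "\<rho> * (norm (\<Sum>\<alpha>\<in>galois_orbit \<xi>. fold_disc (monomial n \<alpha>)) / card (galois_orbit \<xi>))\<^sup>2 \<le>
    2 * monomial_height \<xi> n + ln (2 / (1 + \<rho>)) + ln (1 / (1 - \<rho>)) / alg_degree (monomial n \<xi>)"
proof -
  let ?S = "galois_orbit \<xi>" and ?D = "distinct_pairs \<xi> n"
  define E where "E = {(\<alpha>, \<beta>) \<in> ?S \<times> ?S. monomial n \<alpha> = monomial n \<beta>}"
  define s where "s = real (card ?S)"
  define z where "z = (\<lambda>\<alpha>. fold_disc (monomial n \<alpha>))"
  define M where "M = (\<lambda>\<alpha>. log_plus (norm (monomial n \<alpha>)))"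
  define K where "K = (\<lambda>(\<alpha>, \<beta>). ln (norm (1 - of_real \<rho> * (z \<alpha> * cnj (z \<beta>)))))"
  define c where "c = ln (2 / (1 + \<rho>))"
  have s0: "s > 0" using card_galois_orbit_pos[OF alg] by (simp add: s_def)
  have fin: "finite ?S" by (rule finite_galois_orbit[OF alg])
  have fD: "finite ?D" by (rule finite_distinct_pairs[OF alg nz])
  have fE: "finite E" unfolding E_def by (rule finite_subset[of _ "?S \<times> ?S"]) (auto simp: fin)
  have DE: "?S \<times> ?S = ?D \<union> E" "?D \<inter> E = {}" by (auto simp: distinct_pairs_def[OF alg nz] E_def)
  have c0: "c \<ge> 0" using r by (simp add: c_def)
  have zn: "norm (z \<alpha>) \<le> 1" for \<alpha> by (simp add: z_def norm_fold_disc_le_1)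
  have mnz: "monomial n \<alpha> \<noteq> 0" if "\<alpha> \<in> ?S" for \<alpha> using monomial_nonzero[OF alg nz that] .
  have zz: "norm (z \<alpha> * cnj (z \<beta>)) \<le> 1" for \<alpha> \<beta> by (simp add: norm_mult mult_le_one zn)
  have Kpos: "norm (1 - of_real \<rho> * (z \<alpha> * cnj (z \<beta>))) \<ge> 1 - \<rho>" for \<alpha> \<beta>
  proof -
    have "norm (of_real \<rho> * (z \<alpha> * cnj (z \<beta>))) \<le> \<rho>"
      using mult_left_mono[OF zz[of \<alpha> \<beta>], of \<rho>] r by (simp add: norm_mult)
    then show ?thesis using norm_triangle_ineq2[of 1 "of_real \<rho> * (z \<alpha> * cnj (z \<beta>))"] by simp
  qed
  have pair: "ln (norm (monomial n \<alpha> - monomial n \<beta>)) \<le> M \<alpha> + M \<beta> + c + K (\<alpha>, \<beta>)"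
    if "(\<alpha>, \<beta>) \<in> ?D" for \<alpha> \<beta>
  proof -
    have ab: "\<alpha> \<in> ?S" "\<beta> \<in> ?S" "monomial n \<alpha> \<noteq> monomial n \<beta>" using that by (auto simp: distinct_pairs_def[OF alg nz])
    let ?k = "norm (1 - of_real \<rho> * (z \<alpha> * cnj (z \<beta>)))"
    have k0: "?k > 0" using Kpos[of \<alpha> \<beta>] r by linarith
    have lm: "ln (max 1 (norm (monomial n \<gamma>))) = M \<gamma>" if "\<gamma> \<in> ?S" for \<gamma>
      using mnz[OF that] by (simp add: M_def log_plus_altdef max_def)
    have "norm (monomial n \<alpha> - monomial n \<beta>) \<le>
      max 1 (norm (monomial n \<alpha>)) * max 1 (norm (monomial n \<beta>)) * norm (1 - z \<alpha> * cnj (z \<beta>))"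
      unfolding z_def by (rule norm_diff_le_fold_disc) (use mnz ab in auto)
    also have "\<dots> \<le> max 1 (norm (monomial n \<alpha>)) * max 1 (norm (monomial n \<beta>)) * (2 / (1 + \<rho>) * ?k)"
      by (intro mult_left_mono norm_one_minus_regularize zz r) simp
    finally have "ln (norm (monomial n \<alpha> - monomial n \<beta>)) \<le>
      ln (max 1 (norm (monomial n \<alpha>)) * max 1 (norm (monomial n \<beta>)) * (2 / (1 + \<rho>) * ?k))"
      using ab by (subst ln_le_cancel_iff) (use k0 r in auto)
    also have "\<dots> = M \<alpha> + M \<beta> + (c + K (\<alpha>, \<beta>))"
    proof -
      have m1: "max 1 (norm (monomial n \<gamma>)) > 0" for \<gamma> by simp
      have t: "2 / (1 + \<rho>) > 0" using r by simp
      show ?thesis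
        unfolding ln_mult_pos[OF mult_pos_pos[OF m1 m1] mult_pos_pos[OF t k0]] ln_mult_pos[OF m1 m1]
          ln_mult_pos[OF t k0] lm[OF ab(1)] lm[OF ab(2)] by (simp add: c_def K_def)
    qed
    finally show ?thesis by simp
  qed
  have "(\<Sum>(\<alpha>, \<beta>)\<in>?D. ln (norm (monomial n \<alpha> - monomial n \<beta>))) \<le> (\<Sum>p\<in>?D. (M (fst p) + M (snd p) + c) + K p)"
  proof (rule sum_mono)
    fix p assume p: "p \<in> ?D"
    obtain \<alpha> \<beta> where ab: "p = (\<alpha>, \<beta>)" by (cases p)
    show "(case p of (\<alpha>, \<beta>) \<Rightarrow> ln (norm (monomial n \<alpha> - monomial n \<beta>))) \<le> (M (fst p) + M (snd p) + c) + K p"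
      using pair[of \<alpha> \<beta>] p unfolding ab by simp
  qed
  also have "\<dots> = (\<Sum>p\<in>?D. M (fst p) + M (snd p) + c) + sum K ?D" by (rule sum.distrib)
  also have "(\<Sum>p\<in>?D. M (fst p) + M (snd p) + c) \<le> (\<Sum>p\<in>?S \<times> ?S. M (fst p) + M (snd p) + c)"
  proof (rule sum_mono2)
    show "finite (?S \<times> ?S)" using fin by simp
    show "?D \<subseteq> ?S \<times> ?S" using DE(1) by blast
    show "0 \<le> M (fst p) + M (snd p) + c" for p
      unfolding M_def by (intro add_nonneg_nonneg log_plus_nonneg c0)
  qed
  also have "\<dots> = 2 * s * (\<Sum>\<alpha>\<in>?S. M \<alpha>) + s\<^sup>2 * c"
  proof -
    have "(\<Sum>p\<in>?S \<times> ?S. M (fst p) + M (snd p) + c) = (\<Sum>(\<alpha>, \<beta>)\<in>?S \<times> ?S. M \<alpha> + M \<beta> + c)"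
      by (simp only: case_prod_unfold)
    also have "\<dots> = (\<Sum>\<alpha>\<in>?S. \<Sum>\<beta>\<in>?S. M \<alpha> + M \<beta> + c)" by (rule sum.cartesian_product[symmetric])
    also have "\<dots> = (\<Sum>\<alpha>\<in>?S. s * M \<alpha> + sum M ?S + s * c)" by (simp only: sum.distrib sum_constant s_def)
    also have "\<dots> = s * sum M ?S + s * sum M ?S + s * (s * c)"
      by (simp only: sum.distrib sum_constant sum_distrib_left[symmetric] s_def)
    finally show ?thesis by (simp only: mult_2 power2_eq_square distrib_right mult.assoc)
  qed
  also have "sum K ?D = sum K (?S \<times> ?S) - sum K E"
    by (subst DE(1), subst sum.union_disjoint) (use fD fE DE(2) in auto)
  also have "sum K (?S \<times> ?S) \<le> - \<rho> * (norm (\<Sum>\<alpha>\<in>?S. z \<alpha>))\<^sup>2"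
    using sum_ln_kernel_le[of ?S z \<rho>, OF zn r] by (simp add: K_def)
  finally have B: "(\<Sum>(\<alpha>, \<beta>)\<in>?D. ln (norm (monomial n \<alpha> - monomial n \<beta>))) \<le>
     2 * s * (\<Sum>\<alpha>\<in>?S. M \<alpha>) + s\<^sup>2 * c + (- \<rho> * (norm (\<Sum>\<alpha>\<in>?S. z \<alpha>))\<^sup>2 - sum K E)" by simp
  define d where "d = alg_degree (monomial n \<xi>)"
  have ax: "algebraic (monomial n \<xi>)" by (rule monomial_algebraic[OF alg nz self_mem_galois_orbit])
  have d0: "d > 0" using degree_int_min_poly_pos[OF ax] by (simp add: d_def alg_degree_def)
  obtain k where k: "k > 0" "card ?S = k * card (conjugates (monomial n \<xi>))" "monomial n ` ?S = conjugates (monomial n \<xi>)"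
    "\<forall>y\<in>conjugates (monomial n \<xi>). card {\<alpha>\<in>?S. monomial n \<alpha> = y} = k"
    using galois_orbit_fibres[OF alg, of "monomial n", OF ax monomial_equivariant[OF alg nz]] .
  have "card E = (\<Sum>\<alpha>\<in>?S. card {\<beta>\<in>?S. monomial n \<beta> = monomial n \<alpha>})"
  proof -
    have "E = Sigma ?S (\<lambda>\<alpha>. {\<beta>\<in>?S. monomial n \<beta> = monomial n \<alpha>})" unfolding E_def by auto
    then show ?thesis using fin by (simp add: card_SigmaI)
  qed
  also have "\<dots> = (\<Sum>\<alpha>\<in>?S. k)" by (rule sum.cong[OF refl]) (use k(3,4) in blast)
  finally have "real (card E) = s * k" by (simp add: s_def)
  moreover have "s = k * d" unfolding s_def d_def using k(2) card_conjugates[OF ax] by simp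
  ultimately have cE: "real (card E) = s\<^sup>2 / d" using d0 by (simp add: power2_eq_square)
  have "- sum K E = (\<Sum>p\<in>E. - K p)" by (simp add: sum_negf)
  also have "\<dots> \<le> (\<Sum>p\<in>E. ln (1 / (1 - \<rho>)))"
  proof (rule sum_mono)
    fix p assume "p \<in> E"
    have "ln (1 - \<rho>) \<le> K p"
      unfolding K_def using r Kpos by (cases p) (auto intro!: ln_mono)
    then show "- K p \<le> ln (1 / (1 - \<rho>))" using r by (simp add: ln_div)
  qed
  finally have sE: "- sum K E \<le> s\<^sup>2 / d * ln (1 / (1 - \<rho>))" by (simp only: sum_constant cE)
  have H: "ln (real_of_int (denominator \<xi> n)) + (\<Sum>\<alpha>\<in>?S. M \<alpha>) \<le> s * monomial_height \<xi> n"
    using monomial_height_bound[OF alg nz, of n] by (simp add: M_def s_def)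
  have "0 \<le> 2 * s * ln (real_of_int (denominator \<xi> n)) + (\<Sum>(\<alpha>, \<beta>)\<in>?D. ln (norm (monomial n \<alpha> - monomial n \<beta>)))"
    using log_disc_nonneg[OF alg nz, of n] by (simp add: s_def)
  also note B
  finally have "\<rho> * (norm (\<Sum>\<alpha>\<in>?S. z \<alpha>))\<^sup>2 \<le>
     2 * s * (ln (real_of_int (denominator \<xi> n)) + (\<Sum>\<alpha>\<in>?S. M \<alpha>)) + s\<^sup>2 * c + s\<^sup>2 / d * ln (1 / (1 - \<rho>))"
    using sE by (simp add: algebra_simps)
  also have "2 * s * (ln (real_of_int (denominator \<xi> n)) + (\<Sum>\<alpha>\<in>?S. M \<alpha>)) \<le> 2 * s * (s * monomial_height \<xi> n)"
    using H s0 by (intro mult_left_mono) auto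
  finally have "\<rho> * (norm (\<Sum>\<alpha>\<in>?S. z \<alpha>))\<^sup>2 \<le> s\<^sup>2 * (2 * monomial_height \<xi> n + c + ln (1 / (1 - \<rho>)) / d)"
    by (simp add: algebra_simps power2_eq_square)
  then have "\<rho> * (norm (\<Sum>\<alpha>\<in>?S. z \<alpha>))\<^sup>2 / s\<^sup>2 \<le> 2 * monomial_height \<xi> n + c + ln (1 / (1 - \<rho>)) / d"
    using s0 by (simp add: divide_le_eq mult.commute)
  then show ?thesis unfolding z_def c_def d_def s_def by (simp add: power_divide)
qed

lemma monomial_height_nonneg: "monomial_height \<xi> n \<ge> 0"
  unfolding monomial_height_def[OF alg nz] by (intro sum_nonneg mult_nonneg_nonneg weil_height_nonneg alg) simp

text \<open>The choice \<open>\<rho> = 1 - 1 / d\<close> balances the two error terms of the energy bound. For \<open>d = 1\<close> the estimate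
  is trivial.\<close>

lemma average_sgn_monomial_le:
  defines "d \<equiv> real (alg_degree (monomial n \<xi>))"
  shows "norm (\<Sum>\<alpha>\<in>galois_orbit \<xi>. sgn (monomial n \<alpha>)) / card (galois_orbit \<xi>) \<le>
    2 * monomial_height \<xi> n + sqrt 6 * sqrt (monomial_height \<xi> n + ln (2 * d) / (3 * d))"
proof -
  let ?S = "galois_orbit \<xi>" and ?H = "monomial_height \<xi> n"
  define s where "s = real (card ?S)"
  have s0: "s > 0" using card_galois_orbit_pos[OF alg] by (simp add: s_def)
  have ax: "algebraic (monomial n \<xi>)" by (rule monomial_algebraic[OF alg nz self_mem_galois_orbit])
  have d1: "d \<ge> 1" using degree_int_min_poly_pos[OF ax] by (simp add: d_def alg_degree_def)
  have H0: "?H \<ge> 0" by (rule monomial_height_nonneg)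
  have l2: "ln 2 \<ge> (2/3 :: real)" by (rule ln2_ge_two_thirds)
  have fb: "norm (fold_disc z) \<le> 1" for z by (rule norm_fold_disc_le_1)
  define A where "A = norm (\<Sum>\<alpha>\<in>?S. fold_disc (monomial n \<alpha>)) / s"
  have A0: "A \<ge> 0" using s0 by (simp add: A_def)
  have A: "A \<le> sqrt 6 * sqrt (?H + ln (2 * d) / (3 * d))"
  proof -
    have "A\<^sup>2 \<le> 6 * (?H + ln (2 * d) / (3 * d))"
    proof (cases "d = 1")
      case True
      have "norm (\<Sum>\<alpha>\<in>?S. fold_disc (monomial n \<alpha>)) \<le> (\<Sum>\<alpha>\<in>?S. 1)"
        by (rule order_trans[OF norm_sum sum_mono]) (rule fb)
      then have "A \<le> 1" using s0 by (simp add: A_def s_def)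
      then have "A\<^sup>2 \<le> 1" using A0 by (simp add: power_le_one)
      also have "1 \<le> 6 * (?H + ln (2 * d) / (3 * d))" using True H0 l2 by simp
      finally show ?thesis .
    next
      case False
      then have "alg_degree (monomial n \<xi>) \<noteq> 1" by (simp add: d_def)
      then have d2: "d \<ge> 2" using d1 unfolding d_def by linarith
      define \<rho> where "\<rho> = 1 - 1 / d"
      have r: "0 < \<rho>" "\<rho> < 1" "\<rho> \<ge> 1/2" using d2 by (auto simp: \<rho>_def field_simps)
      have en: "\<rho> * A\<^sup>2 \<le> 2 * ?H + ln (2 / (1 + \<rho>)) + ln (1 / (1 - \<rho>)) / d"
        using monomial_energy_bound[OF r(1,2)] unfolding A_def s_def d_def .
      have "ln (2 / (1 + \<rho>)) \<le> 2 / (1 + \<rho>) - 1" using r by (intro ln_le_minus_one) auto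
      also have "\<dots> = 1 / (2 * d - 1)" using d2 by (simp add: \<rho>_def field_simps)
      also have "\<dots> \<le> (2/3) / d" using d2 by (simp add: field_simps)
      also have "\<dots> \<le> ln 2 / d" using l2 d2 by (intro divide_right_mono) auto
      finally have "\<rho> * A\<^sup>2 \<le> 2 * ?H + ln 2 / d + ln d / d"
        using en d2 by (simp add: \<rho>_def)
      also have "\<dots> = 2 * ?H + ln (2 * d) / d" using d2 by (simp add: ln_mult add_divide_distrib)
      finally have 1: "\<rho> * A\<^sup>2 \<le> 2 * ?H + ln (2 * d) / d" .
      have "1/2 * A\<^sup>2 \<le> \<rho> * A\<^sup>2" using r by (intro mult_right_mono) auto
      then have "A\<^sup>2 \<le> 4 * ?H + 2 * (ln (2 * d) / d)" using 1 by simp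
      also have "\<dots> \<le> 6 * ?H + 6 * (ln (2 * d) / (3 * d))" using H0 by simp
      finally show ?thesis by (simp add: algebra_simps)
    qed
    then have "A \<le> sqrt (6 * (?H + ln (2 * d) / (3 * d)))" by (rule real_le_rsqrt)
    then show ?thesis by (simp only: real_sqrt_mult)
  qed
  have "norm (\<Sum>\<alpha>\<in>?S. sgn (monomial n \<alpha>)) = norm ((\<Sum>\<alpha>\<in>?S. sgn (monomial n \<alpha>) - fold_disc (monomial n \<alpha>)) + (\<Sum>\<alpha>\<in>?S. fold_disc (monomial n \<alpha>)))"
    by (simp add: sum_subtractf)
  also have "\<dots> \<le> (\<Sum>\<alpha>\<in>?S. \<bar>ln (norm (monomial n \<alpha>))\<bar>) + norm (\<Sum>\<alpha>\<in>?S. fold_disc (monomial n \<alpha>))"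
    by (intro order_trans[OF norm_triangle_ineq] add_right_mono order_trans[OF norm_sum] sum_mono
        norm_sgn_minus_fold_disc_le monomial_nonzero[OF alg nz])
  finally have "norm (\<Sum>\<alpha>\<in>?S. sgn (monomial n \<alpha>)) / s \<le> (\<Sum>\<alpha>\<in>?S. \<bar>ln (norm (monomial n \<alpha>))\<bar>) / s + A"
    using s0 by (simp add: A_def divide_right_mono flip: add_divide_distrib)
  also have "(\<Sum>\<alpha>\<in>?S. \<bar>ln (norm (monomial n \<alpha>))\<bar>) / s \<le> 2 * ?H"
    unfolding s_def by (rule average_abs_ln_monomial[OF alg nz])
  finally show ?thesis using A by (simp add: s_def)
qed

end

section \<open>Product integrals\<close>

lemma
  fixes h :: "'n::finite \<Rightarrow> real \<Rightarrow> 'a::{real_normed_field, banach, second_countable_topology}"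
  assumes h: "\<And>j. integrable lborel (h j)"
  shows integrable_lborel_vec_prod: "integrable lborel (\<lambda>x::real^'n. \<Prod>j\<in>UNIV. h j (x $ j))"
    and integral_lborel_vec_prod:
      "integral\<^sup>L (lborel :: (real^'n) measure) (\<lambda>x. \<Prod>j\<in>UNIV. h j (x $ j)) = (\<Prod>j\<in>UNIV. LINT x|lborel. h j x)"
proof -
  let ?B = "Basis :: (real^'n) set"
  define e where "e = (\<lambda>j::'n. axis j (1::real))"
  define g where "g = (\<lambda>b. h (inv e b))"
  define T where "T = (\<lambda>f. \<Sum>b\<in>?B. f b *\<^sub>R b)"
  have inj: "inj e" by (auto simp: e_def inj_def axis_eq_axis)
  have B: "?B = e ` UNIV" by (auto simp: Basis_vec_def e_def)
  have ge: "g (e j) = h j" for j by (simp add: g_def inv_f_f[OF inj])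
  interpret product_sigma_finite "\<lambda>_::real^'n. lborel :: real measure" ..
  have T: "T f $ j = f (e j)" for f j
  proof -
    have "T f $ j = (\<Sum>i\<in>UNIV. f (e i) * (e i $ j))"
      unfolding T_def B by (subst sum.reindex[OF inj]) simp
    also have "\<dots> = (\<Sum>i\<in>UNIV. if i = j then f (e i) else 0)" by (rule sum.cong) (auto simp: e_def axis_def)
    finally show ?thesis by simp
  qed
  have prod: "(\<Prod>j\<in>UNIV. h j (T f $ j)) = (\<Prod>b\<in>?B. g b (f b))" for f
    unfolding T B by (subst prod.reindex[OF inj]) (simp add: ge)
  have ig: "integrable lborel (g b)" for b unfolding g_def by (rule h)
  have Tm: "T \<in> measurable (\<Pi>\<^sub>M b\<in>?B. lborel) borel" unfolding T_def by measurable
  have hm [measurable]: "h j \<in> borel_measurable borel" for j using borel_measurable_integrable[OF h[of j]] by simp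
  have m: "(\<lambda>x::real^'n. \<Prod>j\<in>UNIV. h j (x $ j)) \<in> borel_measurable borel" by measurable
  have L: "lborel = distr (\<Pi>\<^sub>M b\<in>?B. lborel) borel T" unfolding T_def by (rule lborel_eq)
  show "integrable lborel (\<lambda>x::real^'n. \<Prod>j\<in>UNIV. h j (x $ j))"
    unfolding L integrable_distr_eq[OF Tm m] prod by (rule product_integrable_prod) (simp_all add: ig)
  have "integral\<^sup>L (lborel :: (real^'n) measure) (\<lambda>x. \<Prod>j\<in>UNIV. h j (x $ j)) = (\<Prod>b\<in>?B. LINT x|lborel. g b x)"
    unfolding L integral_distr[OF Tm m] prod by (rule product_integral_prod) (simp_all add: ig)
  also have "\<dots> = (\<Prod>j\<in>UNIV. LINT x|lborel. h j x)"
    unfolding B by (subst prod.reindex[OF inj]) (simp add: ge)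
  finally show "integral\<^sup>L (lborel :: (real^'n) measure) (\<lambda>x. \<Prod>j\<in>UNIV. h j (x $ j)) = (\<Prod>j\<in>UNIV. LINT x|lborel. h j x)" .
qed

lemma cell_borel: "{\<theta>::real^'n. \<forall>j. 0 \<le> \<theta> $ j \<and> \<theta> $ j < 1} \<in> sets borel"
proof -
  have "{\<theta>::real^'n. \<forall>j. 0 \<le> \<theta> $ j \<and> \<theta> $ j < 1} = (\<Inter>j. {\<theta>. 0 \<le> \<theta> $ j \<and> \<theta> $ j < 1})" by auto
  also have "\<dots> \<in> sets borel" by measurable
  finally show ?thesis .
qed

lemma indicator_cell:
  "(indicator {\<theta>::real^'n. \<forall>j. 0 \<le> \<theta> $ j \<and> \<theta> $ j < 1} \<theta> :: real) = (\<Prod>j\<in>UNIV. indicator {0..<1} (\<theta> $ j))"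
proof (cases "\<forall>j. 0 \<le> \<theta> $ j \<and> \<theta> $ j < 1")
  case False
  then obtain j where "(indicator {0..<1} (\<theta> $ j) :: real) = 0" by (auto simp: indicator_def)
  then have "(\<Prod>j\<in>UNIV. indicator {0..<1} (\<theta> $ j)) = (0::real)" by (intro prod_zero) auto
  then show ?thesis using False by simp
qed simp

lemma
  fixes h :: "'n::finite \<Rightarrow> real \<Rightarrow> 'a::{real_normed_field, banach, second_countable_topology}"
  assumes h: "\<And>j. integrable lborel (\<lambda>x. indicator {0..<1} x *\<^sub>R h j x)"
  shows integrable_torus_prod: "integrable torus (\<lambda>x::real^'n. \<Prod>j\<in>UNIV. h j (x $ j))"
    and integral_torus_prod:
      "integral\<^sup>L (torus :: (real^'n) measure) (\<lambda>x. \<Prod>j\<in>UNIV. h j (x $ j)) = (\<Prod>j\<in>UNIV. LINT x|lborel. indicator {0..<1} x *\<^sub>R h j x)"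
proof -
  have s: "{\<theta>::real^'n. \<forall>j. 0 \<le> \<theta> $ j \<and> \<theta> $ j < 1} \<inter> space lborel \<in> sets lborel" using cell_borel by simp
  have eq: "indicator {\<theta>::real^'n. \<forall>j. 0 \<le> \<theta> $ j \<and> \<theta> $ j < 1} x *\<^sub>R (\<Prod>j\<in>UNIV. h j (x $ j)) =
     (\<Prod>j\<in>UNIV. indicator {0..<1} (x $ j) *\<^sub>R h j (x $ j))" for x :: "real^'n"
    unfolding indicator_cell by (simp add: scaleR_conv_of_real prod.distrib)
  show "integrable torus (\<lambda>x::real^'n. \<Prod>j\<in>UNIV. h j (x $ j))"
    unfolding torus_def integrable_restrict_space[OF s] eq by (rule integrable_lborel_vec_prod[OF h])
  show "integral\<^sup>L (torus :: (real^'n) measure) (\<lambda>x. \<Prod>j\<in>UNIV. h j (x $ j)) = (\<Prod>j\<in>UNIV. LINT x|lborel. indicator {0..<1} x *\<^sub>R h j x)"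
    unfolding torus_def integral_restrict_space[OF s] eq by (rule integral_lborel_vec_prod[OF h])
qed

lemma space_torus: "space torus = {\<theta>::real^'n. \<forall>j. 0 \<le> \<theta> $ j \<and> \<theta> $ j < 1}"
  by (simp add: torus_def space_restrict_space)

lemma finite_measure_torus: "finite_measure (torus :: (real^'n) measure)"
proof
  let ?Q = "{\<theta>::real^'n. \<forall>j. 0 \<le> \<theta> $ j \<and> \<theta> $ j < 1}"
  have "bounded ?Q"
  proof (rule bounded_subset[OF bounded_cbox])
    show "?Q \<subseteq> cbox 0 (\<chi> j. 1)" by (auto simp: mem_box_cart less_imp_le)
  qed
  from emeasure_bounded_finite[OF this] show "emeasure (torus :: (real^'n) measure) (space torus) \<noteq> \<infinity>"
    unfolding space_torus unfolding torus_def
    by (subst emeasure_restrict_space) (use cell_borel in \<open>auto simp: less_top\<close>)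
qed

lemma
  fixes f :: "'a \<Rightarrow> 'c::{real_normed_field, banach, second_countable_topology}" and g :: "'b \<Rightarrow> 'c"
  assumes sf: "sigma_finite_measure M" "sigma_finite_measure N"
    and f: "integrable M f" and g: "integrable N g"
  shows integrable_pair_mult: "integrable (M \<Otimes>\<^sub>M N) (\<lambda>(x, y). f x * g y)"
    and integral_pair_mult: "(LINT z|(M \<Otimes>\<^sub>M N). (case z of (x, y) \<Rightarrow> f x * g y)) = integral\<^sup>L M f * integral\<^sup>L N g"
proof -
  interpret M: sigma_finite_measure M by fact
  interpret N: sigma_finite_measure N by fact
  interpret pair_sigma_finite M N ..
  note [measurable] = borel_measurable_integrable[OF f] borel_measurable_integrable[OF g]
  show i: "integrable (M \<Otimes>\<^sub>M N) (\<lambda>(x, y). f x * g y)"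
  proof (rule Fubini_integrable)
    show "(\<lambda>(x, y). f x * g y) \<in> borel_measurable (M \<Otimes>\<^sub>M N)" by measurable
    show "integrable M (\<lambda>x. \<integral>y. norm (case (x, y) of (x, y) \<Rightarrow> f x * g y) \<partial>N)"
      using f by (simp add: norm_mult)
    show "AE x in M. integrable N (\<lambda>y. case (x, y) of (x, y) \<Rightarrow> f x * g y)" using g by simp
  qed
  from integral_fst'[OF i] show "(LINT z|(M \<Otimes>\<^sub>M N). (case z of (x, y) \<Rightarrow> f x * g y)) = integral\<^sup>L M f * integral\<^sup>L N g"
    by simp
qed

section \<open>One-dimensional kernels\<close>

definition gauss_freq :: "real \<Rightarrow> real \<Rightarrow> real" where
  "gauss_freq m t = exp (- (pi * t\<^sup>2 / m))"

definition gauss_kernel :: "real \<Rightarrow> real \<Rightarrow> real" where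
  "gauss_kernel m s = sqrt m * exp (- (pi * m * s\<^sup>2))"

lemma
  assumes m: "m > 0"
  shows integrable_gauss_kernel: "integrable lborel (\<lambda>s. gauss_kernel m (s - s0))"
    and integral_gauss_kernel: "(LINT s|lborel. gauss_kernel m (s - s0)) = 1"
proof -
  define \<sigma> where "\<sigma> = 1 / sqrt (2 * pi * m)"
  have s: "\<sigma> > 0" using m by (simp add: \<sigma>_def)
  have s2: "\<sigma>\<^sup>2 = 1 / (2 * pi * m)" using m by (simp add: \<sigma>_def power_divide)
  have "gauss_kernel m (s - s0) = normal_density s0 \<sigma> s" for s
    unfolding gauss_kernel_def normal_density_def s2 using m by (simp add: real_sqrt_divide field_simps)
  then show "integrable lborel (\<lambda>s. gauss_kernel m (s - s0))" "(LINT s|lborel. gauss_kernel m (s - s0)) = 1"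
    using integrable_normal_density[OF s, of s0] integral_normal_density[OF s, of s0] by simp_all
qed

lemma gauss_kernel_pos: "m > 0 \<Longrightarrow> gauss_kernel m s > 0"
  by (simp add: gauss_kernel_def)

lemma
  assumes m: "m > 0"
  shows integrable_gauss_freq: "integrable lborel (gauss_freq m)"
    and integrable_gauss_freq_cis: "integrable lborel (\<lambda>t. of_real (gauss_freq m t) * cis (2 * pi * (t * s)))"
    and integral_gauss_freq_cis:
      "(LINT t|lborel. of_real (gauss_freq m t) * cis (2 * pi * (t * s))) = of_real (gauss_kernel m s)"
proof -
  define c where "c = sqrt (m / (2 * pi))"
  have c: "c > 0" "c\<^sup>2 = m / (2 * pi)" using m by (simp_all add: c_def)
  have g: "gauss_freq m (0 + c * x) = sqrt (2 * pi) * std_normal_density x" for x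
  proof -
    have "pi * (c * x)\<^sup>2 / m = x\<^sup>2 / 2" unfolding power_mult_distrib c(2) using m by simp
    then show ?thesis by (simp add: gauss_freq_def std_normal_density_def)
  qed
  have "integrable lborel (\<lambda>x. gauss_freq m (0 + c * x))"
    unfolding g by (intro integrable_mult_right integrable_normal_density) simp
  then show i: "integrable lborel (gauss_freq m)"
    using lborel_integrable_real_affine_iff[of c "gauss_freq m" 0] c by simp
  show i2: "integrable lborel (\<lambda>t. of_real (gauss_freq m t) * cis (2 * pi * (t * s)))"
    by (rule Bochner_Integration.integrable_bound[OF i])
       (auto simp: norm_mult gauss_freq_def cis_conv_exp intro!: borel_measurable_times)
  have "(LINT t|lborel. of_real (gauss_freq m t) * cis (2 * pi * (t * s))) =
    c *\<^sub>R (LINT x|lborel. of_real (gauss_freq m (0 + c * x)) * cis (2 * pi * ((0 + c * x) * s)))"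
    using lborel_integral_real_affine[of c "\<lambda>t. of_real (gauss_freq m t) * cis (2 * pi * (t * s))" 0] c by simp
  also have "(LINT x|lborel. of_real (gauss_freq m (0 + c * x)) * cis (2 * pi * ((0 + c * x) * s))) =
    sqrt (2 * pi) *\<^sub>R (LINT x|lborel. std_normal_density x *\<^sub>R iexp (2 * pi * c * s * x))"
    unfolding g
    by (subst integral_scaleR_right[symmetric]) (auto intro!: Bochner_Integration.integral_cong simp: scaleR_conv_of_real cis_conv_exp mult_ac)
  also have "(LINT x|lborel. std_normal_density x *\<^sub>R iexp (2 * pi * c * s * x)) = char std_normal_distribution (2 * pi * c * s)"
    unfolding char_def by (subst integral_density) (auto simp: normal_density_nonneg)
  also have "\<dots> = of_real (exp (- ((2 * pi * c * s)\<^sup>2) / 2))" by (simp add: char_std_normal_distribution)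
  also have "(2 * pi * c * s)\<^sup>2 = 2 * (pi * m * s\<^sup>2)"
    unfolding power_mult_distrib c(2) by (simp add: power2_eq_square)
  also have "c *\<^sub>R sqrt (2 * pi) *\<^sub>R complex_of_real (exp (- (2 * (pi * m * s\<^sup>2)) / 2)) = of_real (gauss_kernel m s)"
  proof -
    have "c * sqrt (2 * pi) = sqrt m" unfolding c_def by (simp flip: real_sqrt_mult)
    then show ?thesis by (simp add: gauss_kernel_def scaleR_conv_of_real flip: mult.assoc of_real_mult)
  qed
  finally show "(LINT t|lborel. of_real (gauss_freq m t) * cis (2 * pi * (t * s))) = of_real (gauss_kernel m s)" .
qed

text \<open>The Fourier coefficients of the kernel of de la Vallee-Poussin, a normalized power of a cosine: a
  nonnegative trigonometric polynomial with mean 1 that concentrates at the integers exponentially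
  fast.\<close>

definition vallee_poussin_coeff :: "nat \<Rightarrow> int \<Rightarrow> real" where
  "vallee_poussin_coeff l k = (if \<bar>k\<bar> \<le> int l then real ((2 * l) choose nat (int l + k)) / real ((2 * l) choose l) else 0)"

definition vallee_poussin_kernel :: "nat \<Rightarrow> real \<Rightarrow> real" where
  "vallee_poussin_kernel l x = 4 ^ l / real ((2 * l) choose l) * cos (pi * x) ^ (2 * l)"

lemma vallee_poussin_coeff_bounds: "0 \<le> vallee_poussin_coeff l k" "vallee_poussin_coeff l k \<le> 1"
proof -
  show "0 \<le> vallee_poussin_coeff l k" by (simp add: vallee_poussin_coeff_def)
  have "real ((2 * l) choose nat (int l + k)) \<le> real ((2 * l) choose l)"
    using binomial_maximum[of "2 * l" "nat (int l + k)"] by simp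
  then show "vallee_poussin_coeff l k \<le> 1" by (simp add: vallee_poussin_coeff_def divide_le_eq)
qed

lemma vallee_poussin_coeff_0 [simp]: "vallee_poussin_coeff l 0 = 1"
  by (simp add: vallee_poussin_coeff_def)

lemma vallee_poussin_coeff_minus: "vallee_poussin_coeff l (- k) = vallee_poussin_coeff l k"
proof (cases "\<bar>k\<bar> \<le> int l")
  case True
  have "nat (int l + k) \<le> 2 * l" "2 * l - nat (int l + k) = nat (int l + - k)" using True by linarith+
  then have "(2 * l) choose nat (int l + k) = (2 * l) choose nat (int l + - k)"
    using binomial_symmetric[of "nat (int l + k)" "2 * l"] by simp
  then show ?thesis by (simp add: vallee_poussin_coeff_def)
qed (simp add: vallee_poussin_coeff_def)

text \<open>Consecutive coefficients have the ratio \<open>(l - j) / (l + j + 1)\<close>.\<close>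

lemma vallee_poussin_coeff_tendsto_nat: "(\<lambda>l. vallee_poussin_coeff l (int j)) \<longlonglongrightarrow> 1"
proof (induction j)
  case 0 show ?case by simp
next
  case (Suc j)
  have eq: "vallee_poussin_coeff l (int (Suc j)) = vallee_poussin_coeff l (int j) * ((real l - real j) / (real l + real j + 1))"
    if "l > j" for l
  proof -
    have n: "nat (int l + int (Suc j)) = Suc (l + j)" "nat (int l + int j) = l + j" by linarith+
    have "Suc (l + j) * ((2 * l) choose Suc (l + j)) = (2 * l - (l + j)) * ((2 * l) choose (l + j))"
      unfolding binomial_absorption binomial_absorb_comp ..
    also have "2 * l - (l + j) = l - j" by simp
    finally have "real (Suc (l + j)) * real ((2 * l) choose Suc (l + j)) = real (l - j) * real ((2 * l) choose (l + j))"
      by (simp only: of_nat_mult[symmetric])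
    then have "real ((2 * l) choose Suc (l + j)) = real ((2 * l) choose (l + j)) * ((real l - real j) / (real l + real j + 1))"
      using that by (simp add: field_simps of_nat_diff)
    then show ?thesis using that unfolding vallee_poussin_coeff_def n by simp
  qed
  have "(\<lambda>l. (real l - real j) / (real l + real j + 1)) \<longlonglongrightarrow> 1" by real_asymp
  from tendsto_mult[OF Suc this]
  have "(\<lambda>l. vallee_poussin_coeff l (int j) * ((real l - real j) / (real l + real j + 1))) \<longlonglongrightarrow> 1" by simp
  moreover have "\<forall>\<^sub>F l in sequentially. vallee_poussin_coeff l (int j) * ((real l - real j) / (real l + real j + 1)) = vallee_poussin_coeff l (int (Suc j))"
    using eventually_gt_at_top[of j] by eventually_elim (simp only: eq)
  ultimately show ?case by (rule Lim_transform_eventually)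
qed

lemma vallee_poussin_coeff_tendsto: "(\<lambda>l. vallee_poussin_coeff l k) \<longlonglongrightarrow> 1"
proof (cases "k \<ge> 0")
  case True then show ?thesis using vallee_poussin_coeff_tendsto_nat[of "nat k"] by simp
next
  case False then show ?thesis using vallee_poussin_coeff_tendsto_nat[of "nat (- k)"] by (simp add: vallee_poussin_coeff_minus)
qed

text \<open>The binomial theorem for \<open>(cis (pi * x) + cis (- (pi * x))) ^ (2 * l)\<close>.\<close>

lemma vallee_poussin_kernel_expansion:
  "(\<Sum>k\<in>{- int l..int l}. of_real (vallee_poussin_coeff l k) * cis (2 * pi * (of_int k * x))) = of_real (vallee_poussin_kernel l x)"
proof -
  let ?C = "complex_of_real (real ((2 * l) choose l))"
  have C0: "?C \<noteq> 0" by simp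
  have "(\<Sum>k\<in>{- int l..int l}. of_real (vallee_poussin_coeff l k) * cis (2 * pi * (of_int k * x))) =
    (\<Sum>i\<le>2 * l. of_real (vallee_poussin_coeff l (int i - int l)) * cis (2 * pi * (of_int (int i - int l) * x)))"
    by (rule sum.reindex_bij_witness[of _ "\<lambda>i. int i - int l" "\<lambda>k. nat (k + int l)"]) auto
  also have "\<dots> = (\<Sum>i\<le>2 * l. of_nat ((2 * l) choose i) * cis (pi * x) ^ i * cis (- (pi * x)) ^ (2 * l - i)) / ?C"
    unfolding sum_divide_distrib
  proof (rule sum.cong[OF refl])
    fix i assume i: "i \<in> {..2 * l}"
    have "nat (int l + (int i - int l)) = i" "\<bar>int i - int l\<bar> \<le> int l" using i by auto
    then have f: "vallee_poussin_coeff l (int i - int l) = real ((2 * l) choose i) / real ((2 * l) choose l)"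
      by (simp add: vallee_poussin_coeff_def)
    have "cis (pi * x) ^ i * cis (- (pi * x)) ^ (2 * l - i) = cis (real i * (pi * x) + real (2 * l - i) * (- (pi * x)))"
      by (simp only: Complex.DeMoivre cis_mult)
    also have "real i * (pi * x) + real (2 * l - i) * (- (pi * x)) = 2 * pi * (of_int (int i - int l) * x)"
      using i by (simp add: of_nat_diff algebra_simps)
    finally show "of_real (vallee_poussin_coeff l (int i - int l)) * cis (2 * pi * (of_int (int i - int l) * x)) =
      of_nat ((2 * l) choose i) * cis (pi * x) ^ i * cis (- (pi * x)) ^ (2 * l - i) / ?C"
      unfolding f by (simp add: mult.assoc)
  qed
  also have "(\<Sum>i\<le>2 * l. of_nat ((2 * l) choose i) * cis (pi * x) ^ i * cis (- (pi * x)) ^ (2 * l - i)) =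
      (cis (pi * x) + cis (- (pi * x))) ^ (2 * l)"
    by (rule binomial_ring[symmetric])
  also have "cis (pi * x) + cis (- (pi * x)) = of_real (2 * cos (pi * x))"
    by (simp add: complex_eq_iff)
  also have "of_real (2 * cos (pi * x)) ^ (2 * l) / ?C = of_real (vallee_poussin_kernel l x)"
    by (simp add: vallee_poussin_kernel_def power_mult_distrib power_mult)
  finally show ?thesis .
qed

lemma vallee_poussin_kernel_nonneg: "vallee_poussin_kernel l x \<ge> 0"
  by (simp add: vallee_poussin_kernel_def power_mult)

lemma vallee_poussin_kernel_minus: "vallee_poussin_kernel l (- x) = vallee_poussin_kernel l x"
  by (simp add: vallee_poussin_kernel_def)

lemma
  shows integrable_unit_cis: "integrable lborel (\<lambda>x. indicator {0..<1::real} x *\<^sub>R cis (2 * pi * (of_int k * x)))"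
    and integral_unit_cis: "(LINT x|lborel. indicator {0..<1::real} x *\<^sub>R cis (2 * pi * (of_int k * x))) = (if k = 0 then 1 else 0)"
proof -
  have c: "continuous_on {0..1} (\<lambda>x. cis (2 * pi * (of_int k * x)))"
    unfolding cis_conv_exp by (intro continuous_intros)
  have ae: "AE x in lborel. indicator {0..1::real} x *\<^sub>R cis (2 * pi * (of_int k * x)) = indicator {0..<1::real} x *\<^sub>R cis (2 * pi * (of_int k * x))"
    using AE_lborel_singleton[of 1] by eventually_elim (auto simp: indicator_def)
  have i: "integrable lborel (\<lambda>x. indicator {0..1::real} x *\<^sub>R cis (2 * pi * (of_int k * x)))"
    by (rule borel_integrable_compact[OF compact_Icc c])
  have m: "(\<lambda>x. indicator {0..<1::real} x *\<^sub>R cis (2 * pi * (of_int k * x))) \<in> borel_measurable lborel"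
    unfolding cis_conv_exp by measurable
  show "integrable lborel (\<lambda>x. indicator {0..<1::real} x *\<^sub>R cis (2 * pi * (of_int k * x)))"
    using integrable_cong_AE[OF borel_measurable_integrable[OF i] m ae] i by simp
  have "(LINT x|lborel. indicator {0..<1::real} x *\<^sub>R cis (2 * pi * (of_int k * x))) =
     (LINT x|lborel. indicator {0..1::real} x *\<^sub>R cis (2 * pi * (of_int k * x)))"
    using integral_cong_AE[OF borel_measurable_integrable[OF i] m ae] by simp
  also have "\<dots> = (if k = 0 then 1 else 0)"
  proof (cases "k = 0")
    case True
    then show ?thesis by simp
  next
    case False
    define w where "w = 2 * pi * of_int k * \<i>"
    have w0: "w \<noteq> 0" using False by (simp add: w_def)
    have e: "cis (2 * pi * (of_int k * x)) = exp (of_real x * w)" for x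
      by (simp add: cis_conv_exp w_def mult_ac)
    have "((\<lambda>x. exp (of_real x * w) / w) has_vector_derivative exp (of_real x * w)) (at x within {0..1})" for x :: real
    proof -
      have "((\<lambda>z. exp (z * w) / w) has_field_derivative exp (of_real x * w)) (at (of_real x))"
        using w0 by (auto intro!: derivative_eq_intros)
      then show ?thesis by (rule has_vector_derivative_real_field)
    qed
    from integral_FTC_Icc[of 0 1, OF _ this c[unfolded e]]
    have "(LINT x|lborel. indicator {0..1::real} x *\<^sub>R exp (of_real x * w)) = exp w / w - 1 / w" by simp
    moreover have "exp w = 1" unfolding exp_eq_1 by (simp add: w_def)
    ultimately show ?thesis using False by (simp add: e)
  qed
  finally show "(LINT x|lborel. indicator {0..<1::real} x *\<^sub>R cis (2 * pi * (of_int k * x))) = (if k = 0 then 1 else 0)" .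
qed

lemma
  shows integrable_vallee_poussin_kernel: "integrable lborel (\<lambda>x. indicator {0..<1::real} x *\<^sub>R vallee_poussin_kernel l (x - x0))"
    and integral_vallee_poussin_kernel: "(LINT x|lborel. indicator {0..<1::real} x *\<^sub>R vallee_poussin_kernel l (x - x0)) = 1"
proof -
  let ?g = "\<lambda>k x. (of_real (vallee_poussin_coeff l k) * cis (- (2 * pi * (of_int k * x0)))) * (indicator {0..<1::real} x *\<^sub>R cis (2 * pi * (of_int k * x)))"
  have eq: "complex_of_real (indicator {0..<1::real} x *\<^sub>R vallee_poussin_kernel l (x - x0)) = (\<Sum>k\<in>{- int l..int l}. ?g k x)" for x
  proof -
    have "cis (2 * pi * (of_int k * (x - x0))) = cis (- (2 * pi * (of_int k * x0))) * cis (2 * pi * (of_int k * x))" for k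
      unfolding cis_mult by (simp add: algebra_simps)
    then have "complex_of_real (vallee_poussin_kernel l (x - x0)) =
       (\<Sum>k\<in>{- int l..int l}. of_real (vallee_poussin_coeff l k) * cis (- (2 * pi * (of_int k * x0))) * cis (2 * pi * (of_int k * x)))"
      unfolding vallee_poussin_kernel_expansion[symmetric] by (simp add: mult.assoc)
    then show ?thesis by (simp add: scaleR_conv_of_real sum_distrib_left mult_ac)
  qed
  have "integrable lborel (\<lambda>x. complex_of_real (indicator {0..<1::real} x *\<^sub>R vallee_poussin_kernel l (x - x0)))"
    unfolding eq by (intro Bochner_Integration.integrable_sum integrable_mult_right integrable_unit_cis)
  then show "integrable lborel (\<lambda>x. indicator {0..<1::real} x *\<^sub>R vallee_poussin_kernel l (x - x0))"
    using complex_of_real_integrable_eq by blast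
  have "complex_of_real (LINT x|lborel. indicator {0..<1::real} x *\<^sub>R vallee_poussin_kernel l (x - x0)) =
     (LINT x|lborel. complex_of_real (indicator {0..<1::real} x *\<^sub>R vallee_poussin_kernel l (x - x0)))"
    by (rule integral_complex_of_real[symmetric])
  also have "\<dots> = (\<Sum>k\<in>{- int l..int l}. LINT x|lborel. ?g k x)"
    unfolding eq by (intro Bochner_Integration.integral_sum integrable_mult_right integrable_unit_cis)
  also have "\<dots> = (\<Sum>k\<in>{- int l..int l}. if k = 0 then 1 else 0)"
    unfolding integral_mult_right_zero integral_unit_cis by (rule sum.cong) auto
  also have "\<dots> = 1" by simp
  finally show "(LINT x|lborel. indicator {0..<1::real} x *\<^sub>R vallee_poussin_kernel l (x - x0)) = 1"
    by (metis of_real_eq_1_iff)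
qed

section \<open>Fourier inversion\<close>

definition phase :: "(int ^ 'n) \<times> (real ^ 'n) \<Rightarrow> (real ^ 'n) \<times> (real ^ 'n) \<Rightarrow> complex" where
  "phase w z = cis (2 * pi * (\<Sum>j\<in>UNIV. of_int (fst w $ j) * fst z $ j)) * cis (2 * pi * (snd w \<bullet> snd z))"

lemma norm_phase [simp]: "norm (phase w z) = 1"
  by (simp add: phase_def norm_mult)

lemma cnj_phase: "cnj (phase (n, t) (\<theta>, s)) =
  cis (- 2 * pi * (\<Sum>j\<in>UNIV. of_int (n $ j) * \<theta> $ j)) * cis (- 2 * pi * (t \<bullet> s))"
  by (simp add: phase_def cis_cnj)

lemma cis_sum: "finite A \<Longrightarrow> cis (\<Sum>a\<in>A. f a) = (\<Prod>a\<in>A. cis (f a))"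
  by (simp add: cis_conv_exp exp_sum[symmetric] sum_distrib_left)

lemma phase_mult_cnj_phase:
  "phase (n, t) (\<theta>0, s0) * cnj (phase (n, t) (\<theta>, s)) =
    (\<Prod>j\<in>UNIV. cis (2 * pi * (of_int (n $ j) * (\<theta>0 $ j - \<theta> $ j)))) * (\<Prod>j\<in>UNIV. cis (2 * pi * (t $ j * (s0 $ j - s $ j))))"
proof -
  have "phase (n, t) (\<theta>0, s0) * cnj (phase (n, t) (\<theta>, s)) =
    cis (\<Sum>j\<in>UNIV. 2 * pi * (of_int (n $ j) * (\<theta>0 $ j - \<theta> $ j))) * cis (\<Sum>j\<in>UNIV. 2 * pi * (t $ j * (s0 $ j - s $ j)))"
    unfolding cnj_phase unfolding phase_def
    by (simp add: cis_mult inner_vec_def sum_distrib_left algebra_simps sum_subtractf sum_negf)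
  then show ?thesis by (simp add: cis_sum)
qed

lemma borel_measurable_int_component [measurable]:
  "(\<lambda>w. real_of_int (fst w $ j)) \<in> borel_measurable ((frequency_measure :: ((int ^ 'n) \<times> (real ^ 'n)) measure))"
  by (rule measurable_compose[OF measurable_fst]) simp

lemma measurable_torus_component: "(\<lambda>\<theta>. \<theta>) \<in> measurable (torus :: (real ^ 'n) measure) borel"
  unfolding torus_def by (rule measurable_restrict_space1) simp

lemma measurable_fst_physical [measurable]: "fst \<in> measurable (physical_measure :: ((real ^ 'n) \<times> (real ^ 'n)) measure) borel"
  by (rule measurable_compose[OF measurable_fst measurable_torus_component])

lemma measurable_snd_physical [measurable]: "snd \<in> measurable (physical_measure :: ((real ^ 'n) \<times> (real ^ 'n)) measure) borel"
  using measurable_snd[of "torus :: (real ^ 'n) measure" lborel] by simp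

lemma measurable_snd_frequency [measurable]: "snd \<in> measurable (frequency_measure :: ((int ^ 'n) \<times> (real ^ 'n)) measure) borel"
  using measurable_snd[of "count_space UNIV :: (int ^ 'n) measure" "lborel :: (real ^ 'n) measure"] by simp

lemma borel_measurable_cis: "g \<in> borel_measurable M \<Longrightarrow> (\<lambda>x. cis (g x)) \<in> borel_measurable M"
  by (rule measurable_compose[OF _ borel_measurable_continuous_onI])
     (auto simp: cis_conv_exp intro!: continuous_intros)

lemma borel_measurable_cnj: "g \<in> borel_measurable M \<Longrightarrow> (\<lambda>x. cnj (g x)) \<in> borel_measurable M"
  by (rule measurable_compose[OF _ borel_measurable_continuous_onI]) (auto intro!: continuous_intros)

lemma borel_measurable_vec_component: "b \<in> measurable M borel \<Longrightarrow> (\<lambda>x. b x $ j) \<in> borel_measurable M" for b :: "_ \<Rightarrow> real ^ 'n"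
  by (rule measurable_compose[OF _ borel_measurable_continuous_onI]) (auto intro!: continuous_intros)

lemma phase_measurable:
  assumes a: "a \<in> measurable M (frequency_measure :: ((int ^ 'n) \<times> (real ^ 'n)) measure)"
    and b: "b \<in> measurable M borel" and c: "c \<in> measurable M borel"
  shows "(\<lambda>x. phase (a x) (b x, c x)) \<in> borel_measurable M"
  unfolding phase_def fst_conv snd_conv
  by (intro borel_measurable_times borel_measurable_cis borel_measurable_sum borel_measurable_const
      borel_measurable_inner borel_measurable_vec_component b c
      measurable_compose[OF a borel_measurable_int_component] measurable_compose[OF a measurable_snd_frequency])

lemma phase_measurable_physical: "phase w \<in> borel_measurable physical_measure"
  using phase_measurable[of "\<lambda>_. w" physical_measure fst snd] by (simp add: space_pair_measure)

lemma sigma_finite_torus: "sigma_finite_measure (torus :: (real ^ 'n) measure)"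
  using finite_measure_torus finite_measure_def by blast

lemma sigma_finite_physical: "sigma_finite_measure (physical_measure :: ((real ^ 'n) \<times> (real ^ 'n)) measure)"
  by (rule sigma_finite_pair_measure[OF sigma_finite_torus sigma_finite_lborel])

lemma sigma_finite_count: "sigma_finite_measure (count_space UNIV :: (int ^ 'n) measure)"
  by (rule sigma_finite_measure_count_space)

lemma sigma_finite_frequency: "sigma_finite_measure (frequency_measure :: ((int ^ 'n) \<times> (real ^ 'n)) measure)"
  by (rule sigma_finite_pair_measure[OF sigma_finite_count sigma_finite_lborel])

lemma fourier_L1_phase:
  fixes f :: "(real ^ 'n) \<times> (real ^ 'n) \<Rightarrow> complex"
  assumes f: "integrable physical_measure f"
  shows "fourier_L1 f w = (LINT z|physical_measure. f z * cnj (phase w z))"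
proof -
  interpret T: sigma_finite_measure "torus :: (real ^ 'n) measure" by (rule sigma_finite_torus)
  interpret L: sigma_finite_measure "lborel :: (real ^ 'n) measure" by (rule sigma_finite_lborel)
  interpret pair_sigma_finite "torus :: (real ^ 'n) measure" "lborel :: (real ^ 'n) measure" ..
  obtain n t where w: "w = (n, t)" by (cases w)
  have m: "(\<lambda>z. f z * cnj (phase w z)) \<in> borel_measurable physical_measure"
    by (intro borel_measurable_times borel_measurable_cnj phase_measurable_physical borel_measurable_integrable[OF f])
  have i: "integrable physical_measure (\<lambda>z. f z * cnj (phase w z))"
    by (rule Bochner_Integration.integrable_bound[OF f m]) (auto simp: norm_mult)
  show ?thesis
    unfolding fourier_L1_def integral_fst'[OF i, symmetric] unfolding w prod.case cnj_phase mult.assoc ..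
qed

text \<open>The multiplication formula: by Fubini, the transform may be moved to the other factor.\<close>

lemma
  fixes f :: "(real ^ 'n) \<times> (real ^ 'n) \<Rightarrow> complex"
  assumes f: "integrable physical_measure f" and \<psi>: "integrable frequency_measure \<psi>"
  shows fourier_L1_mult_integrable: "integrable frequency_measure (\<lambda>w. fourier_L1 f w * \<psi> w)"
    and fourier_L1_mult: "(LINT w|frequency_measure. fourier_L1 f w * \<psi> w) =
      (LINT z|physical_measure. f z * (LINT w|frequency_measure. \<psi> w * cnj (phase w z)))"
    and fourier_L1_measurable: "fourier_L1 f \<in> borel_measurable frequency_measure"
proof -
  interpret X: sigma_finite_measure "physical_measure :: ((real ^ 'n) \<times> (real ^ 'n)) measure" by (rule sigma_finite_physical)
  interpret Y: sigma_finite_measure "frequency_measure :: ((int ^ 'n) \<times> (real ^ 'n)) measure" by (rule sigma_finite_frequency)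
  interpret pair_sigma_finite "physical_measure :: ((real ^ 'n) \<times> (real ^ 'n)) measure" "frequency_measure :: ((int ^ 'n) \<times> (real ^ 'n)) measure" ..
  have ph: "(\<lambda>p. phase (snd p) (fst (fst p), snd (fst p))) \<in> borel_measurable (physical_measure \<Otimes>\<^sub>M (frequency_measure :: ((int ^ 'n) \<times> (real ^ 'n)) measure))"
    by (intro phase_measurable measurable_snd measurable_compose[OF measurable_fst measurable_fst_physical] measurable_compose[OF measurable_fst measurable_snd_physical])
  have ph': "(\<lambda>p. phase (fst p) (fst (snd p), snd (snd p))) \<in> borel_measurable ((frequency_measure :: ((int ^ 'n) \<times> (real ^ 'n)) measure) \<Otimes>\<^sub>M physical_measure)"
    by (intro phase_measurable measurable_fst measurable_compose[OF measurable_snd measurable_fst_physical] measurable_compose[OF measurable_snd measurable_snd_physical])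
  have "(\<lambda>w. LINT z|physical_measure. f z * cnj (phase w z)) \<in> borel_measurable frequency_measure"
  proof (rule X.borel_measurable_lebesgue_integral[of "\<lambda>w z. f z * cnj (phase w z)"])
    have "(\<lambda>p. f (snd p) * cnj (phase (fst p) (fst (snd p), snd (snd p)))) \<in> borel_measurable ((frequency_measure :: ((int ^ 'n) \<times> (real ^ 'n)) measure) \<Otimes>\<^sub>M physical_measure)"
      by (intro borel_measurable_times borel_measurable_cnj ph' measurable_compose[OF measurable_snd borel_measurable_integrable[OF f]])
    then show "(\<lambda>(w, z). f z * cnj (phase w z)) \<in> borel_measurable ((frequency_measure :: ((int ^ 'n) \<times> (real ^ 'n)) measure) \<Otimes>\<^sub>M physical_measure)"
      by (simp add: case_prod_unfold)
  qed
  then show "fourier_L1 f \<in> borel_measurable frequency_measure"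
    by (simp add: fourier_L1_phase[OF f, abs_def])
  have i: "integrable (physical_measure \<Otimes>\<^sub>M frequency_measure) (\<lambda>(z, w). f z * (\<psi> w * cnj (phase w z)))"
  proof (rule Bochner_Integration.integrable_bound[OF integrable_pair_mult[OF sigma_finite_physical sigma_finite_frequency f \<psi>]])
    have "(\<lambda>p. f (fst p) * (\<psi> (snd p) * cnj (phase (snd p) (fst (fst p), snd (fst p))))) \<in> borel_measurable (physical_measure \<Otimes>\<^sub>M (frequency_measure :: ((int ^ 'n) \<times> (real ^ 'n)) measure))"
      by (intro borel_measurable_times borel_measurable_cnj ph measurable_compose[OF measurable_fst borel_measurable_integrable[OF f]]
          measurable_compose[OF measurable_snd borel_measurable_integrable[OF \<psi>]])
    then show "(\<lambda>(z, w). f z * (\<psi> w * cnj (phase w z))) \<in> borel_measurable (physical_measure \<Otimes>\<^sub>M (frequency_measure :: ((int ^ 'n) \<times> (real ^ 'n)) measure))"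
      by (simp add: case_prod_unfold)
  qed (auto simp: norm_mult)
  have eq: "fourier_L1 f w * \<psi> w = (LINT z|physical_measure. f z * (\<psi> w * cnj (phase w z)))" for w
    unfolding fourier_L1_phase[OF f] by (subst integral_mult_left_zero[symmetric]) (simp add: mult_ac)
  show "integrable frequency_measure (\<lambda>w. fourier_L1 f w * \<psi> w)"
    unfolding eq by (rule integrable_snd[OF i])
  show "(LINT w|frequency_measure. fourier_L1 f w * \<psi> w) =
      (LINT z|physical_measure. f z * (LINT w|frequency_measure. \<psi> w * cnj (phase w z)))"
    unfolding eq Fubini_integral[OF i] by simp
qed

text \<open>The Cauchy-Schwarz inequality.\<close>

lemma tendsto_L2_imp_tendsto_integral:
  fixes f :: "nat \<Rightarrow> 'a \<Rightarrow> complex"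
  assumes lim: "tendsto_L2 M f g"
    and fm: "\<And>k. f k \<in> borel_measurable M" and gm: "g \<in> borel_measurable M"
    and \<phi>: "\<phi> \<in> borel_measurable M" "integrable M (\<lambda>x. (norm (\<phi> x))\<^sup>2)"
    and fi: "\<And>k. integrable M (\<lambda>x. f k x * \<phi> x)" and gi: "integrable M (\<lambda>x. g x * \<phi> x)"
  shows "(\<lambda>k. LINT x|M. f k x * \<phi> x) \<longlonglongrightarrow> (LINT x|M. g x * \<phi> x)"
proof -
  note [measurable] = fm gm \<phi>(1)
  define A where "A = (\<lambda>k. \<integral>\<^sup>+ x. ennreal ((norm (f k x - g x))\<^sup>2) \<partial>M)"
  define C where "C = (\<integral>\<^sup>+ x. ennreal ((norm (\<phi> x))\<^sup>2) \<partial>M)"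
  define d where "d = (\<lambda>k. norm ((LINT x|M. f k x * \<phi> x) - (LINT x|M. g x * \<phi> x)))"
  have C: "C < \<infinity>" using \<phi>(2) unfolding C_def integrable_iff_bounded by simp
  have le: "ennreal ((d k)\<^sup>2) \<le> A k * C" for k
  proof -
    have "ennreal (d k) = ennreal (norm (LINT x|M. f k x * \<phi> x - g x * \<phi> x))"
      unfolding d_def by (simp add: fi gi)
    also have "\<dots> \<le> (\<integral>\<^sup>+ x. norm (f k x * \<phi> x - g x * \<phi> x) \<partial>M)"
      by (rule integral_norm_bound_ennreal) (simp add: fi gi)
    also have "\<dots> = (\<integral>\<^sup>+ x. ennreal (norm (f k x - g x)) * ennreal (norm (\<phi> x)) \<partial>M)"
      by (simp add: ennreal_mult[symmetric] norm_mult[symmetric] left_diff_distrib)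
    finally have "(ennreal (d k))\<^sup>2 \<le> (\<integral>\<^sup>+ x. ennreal (norm (f k x - g x)) * ennreal (norm (\<phi> x)) \<partial>M)\<^sup>2"
      by (rule power_mono) simp
    also have "\<dots> \<le> (\<integral>\<^sup>+ x. (ennreal (norm (f k x - g x)))\<^sup>2 \<partial>M) * (\<integral>\<^sup>+ x. (ennreal (norm (\<phi> x)))\<^sup>2 \<partial>M)"
      by (rule Cauchy_Schwarz_nn_integral) measurable
    finally show ?thesis by (simp add: A_def C_def ennreal_power d_def)
  qed
  have "A \<longlonglongrightarrow> 0" using lim by (simp add: tendsto_L2_def A_def)
  then have "(\<lambda>k. A k * C) \<longlonglongrightarrow> 0 * C" by (intro ennreal_tendsto_cmult[of C, THEN tendsto_eq_rhs] tendsto_mult_ennreal) (use C in auto)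
  then have "(\<lambda>k. A k * C) \<longlonglongrightarrow> 0" by simp
  then have "(\<lambda>k. ennreal ((d k)\<^sup>2)) \<longlonglongrightarrow> 0"
    by (rule tendsto_sandwich[rotated 3]) (use le in auto)
  then have "(\<lambda>k. ennreal ((d k)\<^sup>2)) \<longlonglongrightarrow> ennreal 0" by simp
  then have "(\<lambda>k. (d k)\<^sup>2) \<longlonglongrightarrow> 0" by (rule tendsto_ennrealD) auto
  then have "(\<lambda>k. sqrt ((d k)\<^sup>2)) \<longlonglongrightarrow> sqrt 0" by (intro tendsto_intros)
  then have "d \<longlonglongrightarrow> 0" by (simp add: d_def)
  then have "(\<lambda>k. (LINT x|M. f k x * \<phi> x) - (LINT x|M. g x * \<phi> x)) \<longlonglongrightarrow> 0"
    unfolding d_def by (rule tendsto_norm_zero_cancel)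
  then show ?thesis by (rule LIM_zero_cancel)
qed

text \<open>The window on the frequency side tends to 1 pointwise and has values in \<open>{0..1}\<close>; its transform is
  the kernel defined next, which is an approximate identity at \<open>z0\<close>.\<close>

definition freq_window :: "nat \<Rightarrow> (int ^ 'n) \<times> (real ^ 'n) \<Rightarrow> real" where
  "freq_window l w = (\<Prod>j\<in>UNIV. vallee_poussin_coeff l (fst w $ j)) * (\<Prod>j\<in>UNIV. gauss_freq (real l) (snd w $ j))"

definition phys_kernel :: "nat \<Rightarrow> (real ^ 'n) \<times> (real ^ 'n) \<Rightarrow> (real ^ 'n) \<times> (real ^ 'n) \<Rightarrow> real" where
  "phys_kernel l z0 z = (\<Prod>j\<in>UNIV. vallee_poussin_kernel l (fst z $ j - fst z0 $ j)) *
     (\<Prod>j\<in>UNIV. gauss_kernel (real l) (snd z $ j - snd z0 $ j))"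

lemma gauss_freq_bounds: "l > 0 \<Longrightarrow> 0 \<le> gauss_freq (real l) t" "l > 0 \<Longrightarrow> gauss_freq (real l) t \<le> 1"
  by (simp_all add: gauss_freq_def)

lemma freq_window_bounds:
  assumes "l > 0" shows "0 \<le> freq_window l w" "freq_window l w \<le> 1"
  unfolding freq_window_def using assms
  by (auto intro!: mult_nonneg_nonneg prod_nonneg mult_le_one prod_le_1 simp: vallee_poussin_coeff_bounds gauss_freq_bounds)

definition int_box :: "nat \<Rightarrow> (int ^ 'n) set" where
  "int_box l = {n. \<forall>j. n $ j \<in> {- int l..int l}}"

lemma int_box_altdef: "int_box l = (\<lambda>f. \<chi> j. f j) ` PiE UNIV (\<lambda>_. {- int l..int l})"
proof safe
  fix n :: "int ^ 'n" assume "n \<in> int_box l"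
  then have "(\<lambda>j. n $ j) \<in> PiE UNIV (\<lambda>_. {- int l..int l})" by (auto simp: int_box_def)
  moreover have "n = (\<chi> j. n $ j)" by (simp add: vec_eq_iff)
  ultimately show "n \<in> (\<lambda>f. \<chi> j. f j) ` PiE UNIV (\<lambda>_. {- int l..int l})" by blast
qed (auto simp: int_box_def PiE_iff)

lemma finite_int_box: "finite (int_box l :: (int ^ 'n) set)"
  unfolding int_box_altdef by (intro finite_imageI finite_PiE) auto

lemma sum_int_box_prod:
  fixes g :: "'n::finite \<Rightarrow> int \<Rightarrow> complex"
  shows "(\<Sum>n\<in>int_box l. \<Prod>j\<in>UNIV. g j (n $ j)) = (\<Prod>j\<in>UNIV. \<Sum>k\<in>{- int l..int l}. g j k)"
proof -
  have inj: "inj_on (\<lambda>f. (\<chi> j. f j) :: int ^ 'n) (PiE UNIV (\<lambda>_. {- int l..int l}))"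
    by (auto simp: inj_on_def vec_eq_iff)
  show ?thesis unfolding int_box_altdef
    by (subst sum.reindex[OF inj]) (simp add: prod_sum_PiE)
qed

lemma
  fixes A :: "(int ^ 'n) \<Rightarrow> complex"
  assumes A: "\<And>n. n \<notin> int_box l \<Longrightarrow> A n = 0"
  shows integrable_int_box: "integrable (count_space UNIV) A"
    and integral_int_box: "integral\<^sup>L (count_space UNIV) A = (\<Sum>n\<in>int_box l. A n)"
proof -
  have eq: "A = (\<lambda>n. \<Sum>m\<in>int_box l. indicator {m} n *\<^sub>R A m)"
  proof
    fix n
    have "(\<Sum>m\<in>int_box l. indicator {m} n *\<^sub>R A m) = (\<Sum>m\<in>int_box l. if m = n then A n else 0)"
      by (rule sum.cong) (auto simp: indicator_def)
    also have "\<dots> = A n" using A[of n] by (simp add: sum.delta[OF finite_int_box])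
    finally show "A n = (\<Sum>m\<in>int_box l. indicator {m} n *\<^sub>R A m)" by (rule sym)
  qed
  show "integrable (count_space UNIV) A"
    by (subst eq) (intro Bochner_Integration.integrable_sum integrable_scaleR_left integrable_real_indicator; simp)
  have fin: "finite {n\<in>UNIV. A n \<noteq> 0}" using A by (auto intro: finite_subset[OF _ finite_int_box[of l]])
  show "integral\<^sup>L (count_space UNIV) A = (\<Sum>n\<in>int_box l. A n)"
    unfolding lebesgue_integral_count_space_finite_support[OF fin]
    using A by (intro sum.mono_neutral_left finite_int_box) auto
qed

lemma
  fixes z0 z :: "(real ^ 'n) \<times> (real ^ 'n)"
  assumes l: "l > 0"
  shows integrable_window_phase: "integrable frequency_measure (\<lambda>w. of_real (freq_window l w) * (phase w z0 * cnj (phase w z)))"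
    and integral_window_phase: "(LINT w|frequency_measure. of_real (freq_window l w) * (phase w z0 * cnj (phase w z))) = of_real (phys_kernel l z0 z)"
proof -
  obtain \<theta>0 s0 \<theta> s where z: "z0 = (\<theta>0, s0)" "z = (\<theta>, s)" by (cases z0, cases z) blast
  define A where "A = (\<lambda>n::int^'n. \<Prod>j\<in>UNIV. of_real (vallee_poussin_coeff l (n $ j)) * cis (2 * pi * (of_int (n $ j) * (\<theta>0 $ j - \<theta> $ j))))"
  define B where "B = (\<lambda>t::real^'n. \<Prod>j\<in>UNIV. of_real (gauss_freq (real l) (t $ j)) * cis (2 * pi * (t $ j * (s0 $ j - s $ j))))"
  have eq: "(\<lambda>w. of_real (freq_window l w) * (phase w z0 * cnj (phase w z))) = (\<lambda>(n, t). A n * B t)"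
  proof
    fix w :: "(int ^ 'n) \<times> (real ^ 'n)"
    obtain n t where w: "w = (n, t)" by (cases w)
    show "of_real (freq_window l w) * (phase w z0 * cnj (phase w z)) = (case w of (n, t) \<Rightarrow> A n * B t)"
      unfolding w z phase_mult_cnj_phase freq_window_def A_def B_def
      by (simp add: prod.distrib mult_ac)
  qed
  have A0: "A n = 0" if n: "n \<notin> int_box l" for n
  proof -
    have "\<exists>j. \<not> \<bar>n $ j\<bar> \<le> int l" using n unfolding int_box_def by (auto simp: abs_le_iff minus_le_iff)
    then obtain j where "\<not> \<bar>n $ j\<bar> \<le> int l" by blast
    then have "vallee_poussin_coeff l (n $ j) = 0" by (simp add: vallee_poussin_coeff_def)
    then show ?thesis unfolding A_def by (intro prod_zero) auto
  qed
  have lpos: "real l > 0" using l by simp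
  have Ai: "integrable (count_space UNIV) A" and As: "integral\<^sup>L (count_space UNIV) A = (\<Sum>n\<in>int_box l. A n)"
    by (rule integrable_int_box, erule A0) (rule integral_int_box, erule A0)
  have Bi: "integrable lborel B" unfolding B_def
    by (rule integrable_lborel_vec_prod[OF integrable_gauss_freq_cis[OF lpos]])
  show "integrable frequency_measure (\<lambda>w. of_real (freq_window l w) * (phase w z0 * cnj (phase w z)))"
    unfolding eq by (rule integrable_pair_mult[OF sigma_finite_count sigma_finite_lborel Ai Bi])
  have "(\<Sum>n\<in>int_box l. A n) = (\<Prod>j\<in>UNIV. of_real (vallee_poussin_kernel l (\<theta>0 $ j - \<theta> $ j)))"
    unfolding A_def
      sum_int_box_prod[where g = "\<lambda>j k. of_real (vallee_poussin_coeff l k) * cis (2 * pi * (of_int k * (\<theta>0 $ j - \<theta> $ j)))"]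
      vallee_poussin_kernel_expansion ..
  also have "\<dots> = (\<Prod>j\<in>UNIV. of_real (vallee_poussin_kernel l (\<theta> $ j - \<theta>0 $ j)))"
    by (intro prod.cong refl) (metis vallee_poussin_kernel_minus minus_diff_eq)
  finally have Av: "(\<Sum>n\<in>int_box l. A n) = (\<Prod>j\<in>UNIV. of_real (vallee_poussin_kernel l (\<theta> $ j - \<theta>0 $ j)))" .
  have "integral\<^sup>L lborel B = (\<Prod>j\<in>UNIV. of_real (gauss_kernel (real l) (s0 $ j - s $ j)))"
    unfolding B_def integral_lborel_vec_prod[OF integrable_gauss_freq_cis[OF lpos]] integral_gauss_freq_cis[OF lpos] ..
  also have "\<dots> = (\<Prod>j\<in>UNIV. of_real (gauss_kernel (real l) (s $ j - s0 $ j)))"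
    by (intro prod.cong refl) (simp add: gauss_kernel_def power2_commute)
  finally have Bv: "integral\<^sup>L lborel B = (\<Prod>j\<in>UNIV. of_real (gauss_kernel (real l) (s $ j - s0 $ j)))" .
  show "(LINT w|frequency_measure. of_real (freq_window l w) * (phase w z0 * cnj (phase w z))) = of_real (phys_kernel l z0 z)"
    unfolding eq integral_pair_mult[OF sigma_finite_count sigma_finite_lborel Ai Bi] As Av Bv
    by (simp add: phys_kernel_def z)
qed

lemma
  fixes z0 :: "(real ^ 'n) \<times> (real ^ 'n)"
  assumes l: "l > 0"
  shows integrable_phys_kernel: "integrable physical_measure (phys_kernel l z0)"
    and integral_phys_kernel: "integral\<^sup>L physical_measure (phys_kernel l z0) = 1"
proof -
  have lpos: "real l > 0" using l by simp
  define A where "A = (\<lambda>\<theta>::real^'n. \<Prod>j\<in>UNIV. vallee_poussin_kernel l (\<theta> $ j - fst z0 $ j))"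
  define B where "B = (\<lambda>s::real^'n. \<Prod>j\<in>UNIV. gauss_kernel (real l) (s $ j - snd z0 $ j))"
  have eq: "phys_kernel l z0 = (\<lambda>(\<theta>, s). A \<theta> * B s)"
    by (auto simp: phys_kernel_def A_def B_def fun_eq_iff)
  have Ai: "integrable torus A" unfolding A_def
    by (rule integrable_torus_prod[OF integrable_vallee_poussin_kernel])
  have Bi: "integrable lborel B" unfolding B_def
    by (rule integrable_lborel_vec_prod[OF integrable_gauss_kernel[OF lpos]])
  show "integrable physical_measure (phys_kernel l z0)"
    unfolding eq by (rule integrable_pair_mult[OF sigma_finite_torus sigma_finite_lborel Ai Bi])
  have "integral\<^sup>L torus A = 1" unfolding A_def integral_torus_prod[OF integrable_vallee_poussin_kernel] integral_vallee_poussin_kernel by simp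
  moreover have "integral\<^sup>L lborel B = 1"
    unfolding B_def integral_lborel_vec_prod[OF integrable_gauss_kernel[OF lpos]] integral_gauss_kernel[OF lpos] by simp
  ultimately show "integral\<^sup>L physical_measure (phys_kernel l z0) = 1"
    unfolding eq integral_pair_mult[OF sigma_finite_torus sigma_finite_lborel Ai Bi] by simp
qed

lemma phys_kernel_nonneg: "l > 0 \<Longrightarrow> phys_kernel l z0 z \<ge> 0"
  unfolding phys_kernel_def
  by (intro mult_nonneg_nonneg prod_nonneg ballI vallee_poussin_kernel_nonneg less_imp_le gauss_kernel_pos) simp

definition phys_kernel_sup :: "nat \<Rightarrow> nat \<Rightarrow> real" where
  "phys_kernel_sup N l = (4 ^ l / real ((2 * l) choose l) * sqrt (real l)) ^ N"

lemma vallee_poussin_kernel_le: "vallee_poussin_kernel l x \<le> 4 ^ l / real ((2 * l) choose l)"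
proof -
  have "cos (pi * x) ^ (2 * l) \<le> 1" by (simp add: power_mult power_le_one abs_square_le_1)
  then show ?thesis unfolding vallee_poussin_kernel_def by (intro mult_left_le) auto
qed

lemma gauss_kernel_le: "m > 0 \<Longrightarrow> gauss_kernel m s \<le> sqrt m"
  unfolding gauss_kernel_def by (intro mult_left_le) auto

lemma phys_kernel_le:
  fixes z :: "(real ^ 'n) \<times> (real ^ 'n)"
  assumes l: "l > 0"
  shows "phys_kernel l z0 z \<le> phys_kernel_sup (CARD('n)) l"
proof -
  have "phys_kernel l z0 z \<le> (\<Prod>j\<in>(UNIV::'n set). 4 ^ l / real ((2 * l) choose l)) * (\<Prod>j\<in>(UNIV::'n set). sqrt (real l))"
    unfolding phys_kernel_def using l
    by (intro mult_mono prod_mono conjI vallee_poussin_kernel_le gauss_kernel_le prod_nonneg ballI vallee_poussin_kernel_nonneg less_imp_le[OF gauss_kernel_pos]) auto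
  then show ?thesis unfolding phys_kernel_sup_def power_mult_distrib by (simp only: prod_constant)
qed

text \<open>The multiplication formula for the approximating sequence passes to the limit because window and
  kernel are square integrable.\<close>

lemma pairing_identity:
  fixes F :: "(real ^ 'n) \<times> (real ^ 'n) \<Rightarrow> complex"
  assumes FG: "is_fourier_L2 F G" and G: "integrable frequency_measure G" and l: "l > 0"
  shows "integrable physical_measure (\<lambda>z. F z * of_real (phys_kernel l z0 z))"
    and "(LINT w|frequency_measure. G w * (of_real (freq_window l w) * phase w z0)) =
      (LINT z|physical_measure. F z * of_real (phys_kernel l z0 z))"
proof -
  define \<psi> where "\<psi> = (\<lambda>w. complex_of_real (freq_window l w) * phase w z0)"
  define K where "K = (\<lambda>z. complex_of_real (phys_kernel l z0 z))"
  obtain f where f1: "\<And>k. integrable physical_measure (f k)" and f2: "\<And>k. square_integrable physical_measure (f k)"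
    and fF: "tendsto_L2 physical_measure f F" and fG: "tendsto_L2 frequency_measure (\<lambda>k. fourier_L1 (f k)) G"
    using FG unfolding is_fourier_L2_def by blast
  have F2: "square_integrable physical_measure F" using FG by (simp add: is_fourier_L2_def)
  have Gm: "G \<in> borel_measurable frequency_measure" using borel_measurable_integrable[OF G] .
  have \<psi>1: "norm (\<psi> w) \<le> 1" for w using freq_window_bounds[OF l, of w] by (simp add: \<psi>_def norm_mult)
  have "integrable frequency_measure (\<lambda>w. of_real (freq_window l w) * (phase w z0 * cnj (phase w 0)))"
    by (rule integrable_window_phase[OF l])
  moreover have "phase w 0 = 1" for w :: "(int ^ 'n) \<times> (real ^ 'n)" by (simp add: phase_def)
  ultimately have \<psi>i: "integrable frequency_measure \<psi>" by (simp add: \<psi>_def)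
  note \<psi>m = borel_measurable_integrable[OF \<psi>i]
  have \<psi>2: "integrable frequency_measure (\<lambda>w. (norm (\<psi> w))\<^sup>2)"
  proof (rule Bochner_Integration.integrable_bound[OF \<psi>i])
    show "(\<lambda>w. (norm (\<psi> w))\<^sup>2) \<in> borel_measurable frequency_measure" using \<psi>m by measurable
    show "AE w in frequency_measure. norm ((norm (\<psi> w))\<^sup>2) \<le> norm (\<psi> w)"
    proof (rule AE_I2)
      fix w show "norm ((norm (\<psi> w))\<^sup>2) \<le> norm (\<psi> w)"
        using mult_left_le[OF \<psi>1[of w] norm_ge_zero[of "\<psi> w"]] by (simp add: power2_eq_square)
    qed
  qed
  have tr: "(LINT w|frequency_measure. \<psi> w * cnj (phase w z)) = K z" for z
    using integral_window_phase[OF l, of z0 z] by (simp add: \<psi>_def K_def mult.assoc)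
  note Kri = integrable_phys_kernel[OF l, of z0]
  have Km: "K \<in> borel_measurable physical_measure" unfolding K_def using borel_measurable_integrable[OF Kri] by measurable
  define c where "c = phys_kernel_sup (CARD('n)) l"
  have K2: "integrable physical_measure (\<lambda>z. (norm (K z))\<^sup>2)"
  proof (rule Bochner_Integration.integrable_bound[OF integrable_mult_right[OF Kri, of c]])
    show "(\<lambda>z. (norm (K z))\<^sup>2) \<in> borel_measurable physical_measure" using Km by measurable
    show "AE z in physical_measure. norm ((norm (K z))\<^sup>2) \<le> norm (c * phys_kernel l z0 z)"
    proof (rule AE_I2)
      fix z
      have p: "0 \<le> phys_kernel l z0 z" "phys_kernel l z0 z \<le> c"
        unfolding c_def by (rule phys_kernel_nonneg[OF l] phys_kernel_le[OF l])+
      then have "(phys_kernel l z0 z)\<^sup>2 \<le> c * phys_kernel l z0 z"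
        unfolding power2_eq_square by (intro mult_right_mono)
      then show "norm ((norm (K z))\<^sup>2) \<le> norm (c * phys_kernel l z0 z)" using p by (simp add: K_def)
    qed
  qed
  have prod_int: "integrable physical_measure (\<lambda>z. g z * K z)" if g: "square_integrable physical_measure g" for g
  proof (rule Bochner_Integration.integrable_bound)
    have gm: "g \<in> borel_measurable physical_measure" using g by (simp add: square_integrable_def)
    show "integrable physical_measure (\<lambda>z. (norm (g z))\<^sup>2 + (norm (K z))\<^sup>2)"
      using g K2 by (simp add: square_integrable_def)
    show "(\<lambda>z. g z * K z) \<in> borel_measurable physical_measure" using gm Km by measurable
    show "AE z in physical_measure. norm (g z * K z) \<le> norm ((norm (g z))\<^sup>2 + (norm (K z))\<^sup>2)"
    proof (rule AE_I2)
      fix z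
      have "2 * (norm (g z) * norm (K z)) \<le> (norm (g z))\<^sup>2 + (norm (K z))\<^sup>2"
        using sum_squares_bound[of "norm (g z)" "norm (K z)"] by simp
      moreover have "0 \<le> norm (g z) * norm (K z)" by (intro mult_nonneg_nonneg norm_ge_zero)
      ultimately show "norm (g z * K z) \<le> norm ((norm (g z))\<^sup>2 + (norm (K z))\<^sup>2)"
        unfolding norm_mult real_norm_def by linarith
    qed
  qed
  show FK: "integrable physical_measure (\<lambda>z. F z * of_real (phys_kernel l z0 z))"
    using prod_int[OF F2] by (simp add: K_def)
  have eq: "(LINT w|frequency_measure. fourier_L1 (f k) w * \<psi> w) = (LINT z|physical_measure. f k z * K z)" for k
    using fourier_L1_mult[OF f1 \<psi>i, of k] by (simp add: tr)
  have l1: "(\<lambda>k. LINT w|frequency_measure. fourier_L1 (f k) w * \<psi> w) \<longlonglongrightarrow> (LINT w|frequency_measure. G w * \<psi> w)"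
  proof (rule tendsto_L2_imp_tendsto_integral[OF fG fourier_L1_measurable[OF f1 \<psi>i] Gm \<psi>m \<psi>2 fourier_L1_mult_integrable[OF f1 \<psi>i]])
    show "integrable frequency_measure (\<lambda>w. G w * \<psi> w)"
    proof (rule Bochner_Integration.integrable_bound[OF G])
      show "(\<lambda>w. G w * \<psi> w) \<in> borel_measurable frequency_measure" using Gm \<psi>m by measurable
      show "AE w in frequency_measure. norm (G w * \<psi> w) \<le> norm (G w)"
        by (rule AE_I2) (simp add: norm_mult mult_left_le \<psi>1)
    qed
  qed
  have l2: "(\<lambda>k. LINT z|physical_measure. f k z * K z) \<longlonglongrightarrow> (LINT z|physical_measure. F z * K z)"
    using f2 F2 by (intro tendsto_L2_imp_tendsto_integral[OF fF _ _ Km K2] prod_int) (auto simp: square_integrable_def)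
  show "(LINT w|frequency_measure. G w * (of_real (freq_window l w) * phase w z0)) =
      (LINT z|physical_measure. F z * of_real (phys_kernel l z0 z))"
    using LIMSEQ_unique[OF l1[unfolded eq] l2] by (simp only: \<psi>_def K_def)
qed

text \<open>Closeness on the quotient by the periods of the angles.\<close>

definition near_mod_periods :: "real \<Rightarrow> (real ^ 'n) \<times> (real ^ 'n) \<Rightarrow> (real ^ 'n) \<times> (real ^ 'n) \<Rightarrow> bool" where
  "near_mod_periods \<delta> z0 z \<longleftrightarrow> (\<forall>j. \<bar>snd z $ j - snd z0 $ j\<bar> < \<delta>) \<and>
     (\<forall>j. \<exists>k::int. \<bar>fst z $ j - fst z0 $ j - of_int k\<bar> < \<delta>)"

lemma periodic_continuous_near:
  fixes F :: "(real ^ 'n) \<times> (real ^ 'n) \<Rightarrow> complex"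
  assumes per: "torus_periodic F" and cont: "continuous_on UNIV F" and e: "\<eta> > 0"
  obtains \<delta> where "0 < \<delta>" "\<delta> \<le> 1/2" "\<forall>z. near_mod_periods \<delta> z0 z \<longrightarrow> norm (F z - F z0) < \<eta>"
proof -
  define N where "N = real (CARD('n))"
  have N: "N \<ge> 1" by (simp add: N_def Suc_leI)
  obtain d where d: "d > 0" "\<And>z. dist z z0 < d \<Longrightarrow> dist (F z) (F z0) < \<eta>"
    using cont e unfolding continuous_on_iff by (metis UNIV_I)
  define \<delta> where "\<delta> = min (1/2) (d / (2 * N))"
  have dp: "0 < \<delta>" "\<delta> \<le> 1/2" using d N by (auto simp: \<delta>_def)
  have dN: "2 * N * \<delta> \<le> d"
  proof -
    have "\<delta> \<le> d / (2 * N)" by (simp add: \<delta>_def)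
    then show ?thesis using N by (simp add: field_simps)
  qed
  have l1: "norm x < N * \<delta>" if "\<And>j. \<bar>x $ j\<bar> < \<delta>" for x :: "real ^ 'n"
  proof -
    have "norm x \<le> (\<Sum>j\<in>UNIV. \<bar>x $ j\<bar>)" by (rule norm_le_l1_cart)
    also have "\<dots> < (\<Sum>j\<in>(UNIV :: 'n set). \<delta>)" by (rule sum_strict_mono) (use that in auto)
    finally show ?thesis by (simp add: N_def)
  qed
  have "norm (F z - F z0) < \<eta>" if near: "near_mod_periods \<delta> z0 z" for z
  proof -
    obtain k :: "'n \<Rightarrow> int" where k: "\<And>j. \<bar>fst z $ j - fst z0 $ j - of_int (k j)\<bar> < \<delta>"
      using near unfolding near_mod_periods_def by metis
    define \<theta> where "\<theta> = fst z + (\<chi> j. of_int ((\<chi> j. - k j) $ j))"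
    have "F (\<theta>, snd z) = F (fst z, snd z)"
      using per unfolding torus_periodic_def \<theta>_def by blast
    then have Fz: "F (\<theta>, snd z) = F z" by simp
    have "dist (\<theta>, snd z) z0 \<le> dist \<theta> (fst z0) + dist (snd z) (snd z0)"
      by (simp add: dist_prod_def sqrt_sum_squares_le_sum)
    also have "dist \<theta> (fst z0) < N * \<delta>"
      unfolding dist_norm by (rule l1) (use k in \<open>simp add: \<theta>_def algebra_simps\<close>)
    also have "dist (snd z) (snd z0) < N * \<delta>"
      unfolding dist_norm by (rule l1) (use near in \<open>simp add: near_mod_periods_def\<close>)
    finally have "dist (\<theta>, snd z) z0 < d" using dN by simp
    from d(2)[OF this] show ?thesis by (simp add: Fz dist_norm)
  qed
  then show thesis using that dp by blast
qed

lemma cos_sq_away_from_int: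
  assumes d: "0 < \<delta>" "\<delta> \<le> 1/2" and x: "\<And>k::int. \<bar>x - of_int k\<bar> \<ge> \<delta>"
  shows "(cos (pi * x))\<^sup>2 \<le> (cos (pi * \<delta>))\<^sup>2"
proof -
  define k where "k = round x"
  define y where "y = \<bar>x - of_int k\<bar>"
  have y: "\<delta> \<le> y" "y \<le> 1/2"
    using x[of k] of_int_round_abs_le[of x] by (auto simp: y_def k_def abs_minus_commute)
  have "(cos (pi * x))\<^sup>2 = (1 + cos (2 * (pi * x))) / 2" by (simp add: cos_double_cos)
  also have "cos (2 * (pi * x)) = cos (2 * (pi * (x - of_int k)))"
  proof -
    have "2 * (pi * x) = 2 * (pi * (x - of_int k)) + 2 * pi * of_int k" by (simp add: algebra_simps)
    then show ?thesis by (simp add: cos_add)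
  qed
  also have "(1 + cos (2 * (pi * (x - of_int k)))) / 2 = (cos (pi * (x - of_int k)))\<^sup>2" by (simp add: cos_double_cos)
  also have "cos (pi * (x - of_int k)) = cos (pi * y)"
    unfolding y_def by (cases "x - of_int k \<ge> 0") (simp_all add: right_diff_distrib cos_diff mult.commute)
  also have "(cos (pi * y))\<^sup>2 \<le> (cos (pi * \<delta>))\<^sup>2"
  proof (rule power_mono)
    have py: "pi * y \<le> pi / 2" "0 \<le> pi * y" using y d by auto
    then have "- (pi / 2) \<le> pi * y" using pi_gt_zero by linarith
    then show "0 \<le> cos (pi * y)" using py(1) by (rule cos_ge_zero)
    show "cos (pi * y) \<le> cos (pi * \<delta>)" by (rule cos_monotone_0_pi_le) (use y d in auto)
  qed
  finally show ?thesis .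
qed

lemma central_binomial_lower: "4 ^ l \<le> (2 * real l + 1) * real ((2 * l) choose l)"
proof -
  have "(4::real) ^ l = real (2 ^ (2 * l))" by (simp add: power_mult)
  also have "(2::nat) ^ (2 * l) = (\<Sum>i\<le>2 * l. (2 * l) choose i)" by (rule choose_row_sum[symmetric])
  also have "real \<dots> \<le> (\<Sum>i\<le>2 * l. real ((2 * l) choose l))"
    unfolding of_nat_sum using binomial_maximum[of "2 * l"] by (intro sum_mono) simp
  finally show ?thesis by (simp add: add.commute)
qed

lemma central_binomial_upper: "real ((2 * l) choose l) \<le> 4 ^ l"
proof -
  have "(2 * l) choose l \<le> (\<Sum>i\<le>2 * l. (2 * l) choose i)" by (rule member_le_sum) auto
  also have "\<dots> = 2 ^ (2 * l)" by (rule choose_row_sum)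
  finally have "real ((2 * l) choose l) \<le> real (2 ^ (2 * l))" by (rule of_nat_mono)
  then show ?thesis by (simp add: power_mult)
qed

text \<open>Away from its peak, the kernel of index \<open>2 l\<close> is smaller than that of index \<open>l\<close> by an exponential
  factor. This bounds its mass far from the peak by that of a kernel whose total mass is 1, on a domain
  of infinite measure.\<close>

lemma vallee_poussin_kernel_double:
  "vallee_poussin_kernel (2 * l) x \<le> (4 * real l + 1) * ((cos (pi * x))\<^sup>2) ^ l * vallee_poussin_kernel l x"
proof -
  let ?c = "(cos (pi * x))\<^sup>2"
  have "4 ^ (2 * l) / real ((2 * (2 * l)) choose (2 * l)) \<le> 4 * real l + 1"
    using central_binomial_lower[of "2 * l"] by (simp add: divide_le_eq)
  moreover have "1 \<le> 4 ^ l / real ((2 * l) choose l)"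
    using central_binomial_upper[of l] by (simp add: le_divide_eq)
  ultimately have "4 ^ (2 * l) / real ((2 * (2 * l)) choose (2 * l)) * 1 \<le> (4 * real l + 1) * (4 ^ l / real ((2 * l) choose l))"
    by (intro mult_mono) auto
  then have "4 ^ (2 * l) / real ((2 * (2 * l)) choose (2 * l)) * (?c ^ l * ?c ^ l) \<le> (4 * real l + 1) * (4 ^ l / real ((2 * l) choose l)) * (?c ^ l * ?c ^ l)"
    by (intro mult_right_mono) auto
  moreover have "cos (pi * x) ^ (2 * (2 * l)) = ?c ^ l * ?c ^ l"
    by (simp only: power_mult[of _ 2] mult_2[of l] power_add)
  moreover have "cos (pi * x) ^ (2 * l) = ?c ^ l" by (rule power_mult)
  ultimately show ?thesis
    unfolding vallee_poussin_kernel_def by (simp only: ac_simps)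
qed

lemma gauss_kernel_double:
  assumes l: "l > 0"
  shows "gauss_kernel (real (2 * l)) s \<le> 2 * exp (- (pi * s\<^sup>2)) ^ l * gauss_kernel (real l) s"
proof -
  have "exp (- (pi * real (2 * l) * s\<^sup>2)) = exp (- (pi * s\<^sup>2)) ^ l * exp (- (pi * real l * s\<^sup>2))"
    unfolding exp_of_nat_mult[symmetric] exp_add[symmetric] by (simp add: algebra_simps)
  moreover have "sqrt (real (2 * l)) \<le> 2 * sqrt (real l)"
  proof -
    have "sqrt 2 \<le> (2::real)" by (rule real_le_lsqrt) auto
    then have "sqrt 2 * sqrt (real l) \<le> 2 * sqrt (real l)" by (intro mult_right_mono) auto
    then show ?thesis by (simp add: real_sqrt_mult)
  qed
  then have "sqrt (real (2 * l)) * (exp (- (pi * s\<^sup>2)) ^ l * exp (- (pi * real l * s\<^sup>2))) \<le>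
     2 * sqrt (real l) * (exp (- (pi * s\<^sup>2)) ^ l * exp (- (pi * real l * s\<^sup>2)))"
    by (intro mult_right_mono) auto
  ultimately show ?thesis unfolding gauss_kernel_def by (simp add: mult_ac)
qed

lemma prod_le_of_factor_le:
  fixes c :: "'a \<Rightarrow> real"
  assumes "finite A" "a \<in> A" "c a \<le> r" "\<And>x. x \<in> A \<Longrightarrow> 0 \<le> c x \<and> c x \<le> 1"
  shows "prod c A \<le> r"
proof -
  have "prod c A = c a * prod c (A - {a})" by (rule prod.remove[OF assms(1,2)])
  also have "\<dots> \<le> c a * 1" using assms by (intro mult_left_mono prod_le_1) auto
  finally show ?thesis using assms by simp
qed

text \<open>A common majorant, exponentially small in \<open>l\<close>, for the ratio of the two kernels and for the kernel
  itself in the far region.\<close>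

definition far_bound :: "nat \<Rightarrow> real \<Rightarrow> nat \<Rightarrow> real" where
  "far_bound N r l = (3 * (real l + 1)) ^ (3 * N) * r ^ l"

lemma far_bound_tendsto:
  assumes r: "0 < r" "r < 1" and N: "N > 0"
  shows "(\<lambda>l. far_bound N r l) \<longlonglongrightarrow> 0"
proof -
  define q where "q = root (3 * N) r"
  have q: "0 < q" "q < 1" "q ^ (3 * N) = r" using r N by (auto simp: q_def)
  have "(\<lambda>l. real l * q ^ l) \<longlonglongrightarrow> 0" using powser_times_n_limit_0[of q] q by simp
  moreover have "(\<lambda>l. q ^ l) \<longlonglongrightarrow> 0" using LIMSEQ_power_zero[of q] q by simp
  ultimately have "(\<lambda>l. (3 * (real l * q ^ l + q ^ l)) ^ (3 * N)) \<longlonglongrightarrow> (3 * (0 + 0)) ^ (3 * N)"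
    by (intro tendsto_power tendsto_mult tendsto_add tendsto_const)
  moreover have "(3 * (real l * q ^ l + q ^ l)) ^ (3 * N) = far_bound N r l" for l
  proof -
    have "3 * (real l * q ^ l + q ^ l) = (3 * (real l + 1)) * q ^ l" by (simp add: algebra_simps)
    then show ?thesis unfolding far_bound_def q(3)[symmetric]
      by (simp only: power_mult_distrib power_mult[symmetric] mult.commute)
  qed
  ultimately have "(\<lambda>l. far_bound N r l) \<longlonglongrightarrow> (3 * (0 + 0)) ^ (3 * N)" by (simp only:)
  then show ?thesis using N by (simp add: power_0_left)
qed

text \<open>Each of the factors gained by doubling is at most 1, and in the far region at least one is at most
  \<open>r\<close>.\<close>

lemma phys_kernel_far:
  fixes z0 z :: "(real ^ 'n) \<times> (real ^ 'n)"
  assumes d: "0 < \<delta>" "\<delta> \<le> 1/2" and r: "(cos (pi * \<delta>))\<^sup>2 \<le> r" "exp (- (pi * \<delta>\<^sup>2)) \<le> r"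
    and l: "l > 0" and far: "\<not> near_mod_periods \<delta> z0 z"
  shows "phys_kernel (2 * l) z0 z \<le> far_bound (CARD('n)) r l * phys_kernel l z0 z"
    and "phys_kernel (2 * l) z0 z \<le> far_bound (CARD('n)) r l"
proof -
  let ?N = "CARD('n)"
  define a where "a = (\<lambda>j. (cos (pi * (fst z $ j - fst z0 $ j)))\<^sup>2)"
  define b where "b = (\<lambda>j. exp (- (pi * (snd z $ j - snd z0 $ j)\<^sup>2)))"
  have a01: "0 \<le> a j \<and> a j \<le> 1" for j unfolding a_def by (simp add: abs_square_le_1)
  have b01: "0 \<le> b j \<and> b j \<le> 1" for j unfolding b_def by simp
  have r0: "r \<ge> 0" using r(2) exp_ge_zero order_trans by blast
  have ab: "prod a UNIV * prod b UNIV \<le> r"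
  proof -
    have pa: "0 \<le> prod a UNIV" "prod a UNIV \<le> 1" using a01 by (auto intro!: prod_nonneg prod_le_1)
    have pb: "0 \<le> prod b UNIV" "prod b UNIV \<le> 1" using b01 by (auto intro!: prod_nonneg prod_le_1)
    consider j where "\<bar>snd z $ j - snd z0 $ j\<bar> \<ge> \<delta>" | j where "\<And>k::int. \<bar>fst z $ j - fst z0 $ j - of_int k\<bar> \<ge> \<delta>"
      using far unfolding near_mod_periods_def by (meson not_less)
    then show ?thesis
    proof cases
      case 1
      then have "\<delta>\<^sup>2 \<le> (snd z $ j - snd z0 $ j)\<^sup>2" using d by (metis abs_le_square_iff abs_of_pos)
      then have "b j \<le> exp (- (pi * \<delta>\<^sup>2))" unfolding b_def by simp
      then have "b j \<le> r" using r(2) by linarith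
      then have "prod b UNIV \<le> r" using prod_le_of_factor_le[of UNIV j b r] b01 by simp
      then show ?thesis using mult_mono[of "prod a UNIV" 1 "prod b UNIV" r] pa pb by simp
    next
      case 2
      have "a j \<le> r" using cos_sq_away_from_int[OF d 2] r(1) unfolding a_def by linarith
      then have "prod a UNIV \<le> r" using prod_le_of_factor_le[of UNIV j a r] a01 by simp
      then show ?thesis using mult_mono[of "prod a UNIV" r "prod b UNIV" 1] pa pb r0 by simp
    qed
  qed
  define D where "D = (4 * real l + 1) ^ ?N * 2 ^ ?N * r ^ l"
  have K0: "phys_kernel l z0 z \<ge> 0" by (rule phys_kernel_nonneg[OF l])
  have "phys_kernel (2 * l) z0 z \<le>
    (\<Prod>j\<in>UNIV. (4 * real l + 1) * a j ^ l * vallee_poussin_kernel l (fst z $ j - fst z0 $ j)) *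
    (\<Prod>j\<in>UNIV. 2 * b j ^ l * gauss_kernel (real l) (snd z $ j - snd z0 $ j))"
    unfolding phys_kernel_def a_def b_def using l
    by (intro mult_mono prod_mono conjI vallee_poussin_kernel_double gauss_kernel_double[OF l] prod_nonneg ballI
        vallee_poussin_kernel_nonneg mult_nonneg_nonneg less_imp_le[OF gauss_kernel_pos]) auto
  also have "\<dots> = (4 * real l + 1) ^ ?N * 2 ^ ?N * (prod a UNIV * prod b UNIV) ^ l * phys_kernel l z0 z"
    unfolding phys_kernel_def by (simp add: prod.distrib prod_power_distrib power_mult_distrib mult_ac)
  also have "\<dots> \<le> D * phys_kernel l z0 z"
    unfolding D_def using ab a01 b01 K0
    by (intro mult_right_mono mult_left_mono power_mono mult_nonneg_nonneg prod_nonneg) auto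
  finally have 1: "phys_kernel (2 * l) z0 z \<le> D * phys_kernel l z0 z" .
  define u where "u = real l + 1"
  have u1: "u \<ge> 1" by (simp add: u_def)
  have D0: "D \<ge> 0" using r0 by (simp add: D_def)
  have Deq: "D = ((4 * real l + 1) * 2) ^ ?N * r ^ l" unfolding D_def power_mult_distrib ..
  have fb: "far_bound ?N r l = (27 * u ^ 3) ^ ?N * r ^ l"
    unfolding far_bound_def u_def[symmetric] power_mult by (simp add: power_mult_distrib)
  have u3: "u \<le> u ^ 3" using u1 power_increasing[of 1 3 u] by simp
  have "(4 * real l + 1) * 2 \<le> 8 * u" by (simp add: u_def)
  also have "\<dots> \<le> 27 * u ^ 3" using u3 u1 by linarith
  finally have "D \<le> far_bound ?N r l"
    unfolding Deq fb using r0 by (intro mult_right_mono power_mono) auto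
  then show "phys_kernel (2 * l) z0 z \<le> far_bound ?N r l * phys_kernel l z0 z"
    using 1 K0 by (meson mult_right_mono order_trans)
  have "phys_kernel l z0 z \<le> phys_kernel_sup ?N l" by (rule phys_kernel_le[OF l])
  also have "\<dots> \<le> ((2 * real l + 1) * u) ^ ?N"
    unfolding phys_kernel_sup_def
  proof (intro power_mono mult_mono)
    show "4 ^ l / real ((2 * l) choose l) \<le> 2 * real l + 1"
      using central_binomial_lower[of l] by (simp add: divide_le_eq)
    have "real l \<le> u\<^sup>2" by (simp add: u_def power2_eq_square algebra_simps)
    then show "sqrt (real l) \<le> u" using u1 by (intro real_le_lsqrt) auto
  qed auto
  finally have "D * phys_kernel l z0 z \<le> D * ((2 * real l + 1) * u) ^ ?N" using D0 by (intro mult_left_mono)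
  also have "\<dots> = ((4 * real l + 1) * 2 * ((2 * real l + 1) * u)) ^ ?N * r ^ l"
    unfolding Deq by (simp add: power_mult_distrib mult_ac)
  also have "\<dots> \<le> far_bound ?N r l"
    unfolding fb
  proof (intro mult_right_mono power_mono)
    have p2: "(2 * real l + 1) * u \<le> (2 * u) * u" using u1 by (intro mult_right_mono) (auto simp: u_def)
    have p1: "(4 * real l + 1) * 2 \<le> 8 * u" by (simp add: u_def)
    have "(4 * real l + 1) * 2 * ((2 * real l + 1) * u) \<le> (8 * u) * ((2 * u) * u)"
      by (rule mult_mono[OF p1 p2]) (use u1 in auto)
    also have "\<dots> \<le> 27 * u ^ 3" using u1 by (simp add: power3_eq_cube)
    finally show "(4 * real l + 1) * 2 * ((2 * real l + 1) * u) \<le> 27 * u ^ 3" .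
  qed (use r0 u1 in auto)
  finally show "phys_kernel (2 * l) z0 z \<le> far_bound ?N r l" using 1 by simp
qed

text \<open>Near the point \<open>F\<close> is almost constant. Far from it \<open>F\<close> may be unbounded, but it is square
  integrable, and \<open>\<bar>F\<bar> * K\<close> is split by the inequality of the arithmetic and geometric mean with weights
  chosen so that both parts tend to 0.\<close>

lemma phys_kernel_approximate_identity:
  fixes F :: "(real ^ 'n) \<times> (real ^ 'n) \<Rightarrow> complex"
  assumes per: "torus_periodic F" and cont: "continuous_on UNIV F" and sq: "square_integrable physical_measure F"
    and FK: "\<And>l. l > 0 \<Longrightarrow> integrable physical_measure (\<lambda>z. F z * of_real (phys_kernel l z0 z))"
  shows "(\<lambda>l. LINT z|physical_measure. F z * of_real (phys_kernel (2 * Suc l) z0 z)) \<longlonglongrightarrow> F z0"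
proof -
  define Q where "Q = (LINT z|physical_measure. (norm (F z))\<^sup>2)"
  have iQ: "integrable physical_measure (\<lambda>z. (norm (F z))\<^sup>2)" using sq by (simp add: square_integrable_def)
  have bound: "\<exists>E. E \<longlonglongrightarrow> 0 \<and> (\<forall>l. norm ((LINT z|physical_measure. F z * of_real (phys_kernel (2 * Suc l) z0 z)) - F z0) \<le>
      \<eta> + E l)" if e: "\<eta> > 0" for \<eta>
  proof -
    obtain \<delta> where d: "0 < \<delta>" "\<delta> \<le> 1/2" "\<forall>z. near_mod_periods \<delta> z0 z \<longrightarrow> norm (F z - F z0) < \<eta>"
      using periodic_continuous_near[OF per cont e] .
    define r where "r = max ((cos (pi * \<delta>))\<^sup>2) (exp (- (pi * \<delta>\<^sup>2)))"
    have r: "(cos (pi * \<delta>))\<^sup>2 \<le> r" "exp (- (pi * \<delta>\<^sup>2)) \<le> r" by (auto simp: r_def)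
    have r0: "r > 0" using r(2) exp_gt_zero less_le_trans by blast
    have "(cos (pi * \<delta>))\<^sup>2 < 1"
    proof -
      have "sin (pi * \<delta>) > 0" using d by (intro sin_gt_zero) auto
      then have "(sin (pi * \<delta>))\<^sup>2 > 0" by simp
      then show ?thesis using sin_cos_squared_add[of "pi * \<delta>"] by linarith
    qed
    then have r1: "r < 1" using d by (simp add: r_def)
    define B where "B = (\<lambda>l. far_bound (CARD('n)) r (Suc l))"
    have B0: "B l > 0" for l using r0 by (simp add: B_def far_bound_def)
    have "(\<lambda>l. far_bound (CARD('n)) r l) \<longlonglongrightarrow> 0" by (rule far_bound_tendsto[OF r0 r1]) simp
    then have Blim: "B \<longlonglongrightarrow> 0" unfolding B_def by (rule LIMSEQ_Suc)
    define E where "E = (\<lambda>l. sqrt (B l) / 2 * (Q + 1) + norm (F z0) * B l)"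
    have "E \<longlonglongrightarrow> sqrt 0 / 2 * (Q + 1) + norm (F z0) * 0"
      unfolding E_def by (intro tendsto_intros Blim) simp
    then have Elim: "E \<longlonglongrightarrow> 0" by simp
    have "norm ((LINT z|physical_measure. F z * of_real (phys_kernel (2 * Suc l) z0 z)) - F z0) \<le> \<eta> + E l" for l
    proof -
      define K where "K = phys_kernel (2 * Suc l) z0"
      define K1 where "K1 = phys_kernel (Suc l) z0"
      have iK: "integrable physical_measure K" "integral\<^sup>L physical_measure K = 1"
        unfolding K_def by (rule integrable_phys_kernel integral_phys_kernel, simp)+
      have iK1: "integrable physical_measure K1" "integral\<^sup>L physical_measure K1 = 1"
        unfolding K1_def by (rule integrable_phys_kernel integral_phys_kernel, simp)+
      have Kn: "K z \<ge> 0" "K1 z \<ge> 0" for z unfolding K_def K1_def by (rule phys_kernel_nonneg, simp)+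
      have far: "K z \<le> B l * K1 z" "K z \<le> B l" if "\<not> near_mod_periods \<delta> z0 z" for z
        using phys_kernel_far[OF d(1,2) r _ that, of "Suc l"] by (simp_all add: K_def K1_def B_def)
      have iFK: "integrable physical_measure (\<lambda>z. F z * of_real (K z))" unfolding K_def by (rule FK) simp
      have pt: "norm ((F z - F z0) * of_real (K z)) \<le>
         \<eta> * K z + (sqrt (B l) / 2 * (norm (F z))\<^sup>2 + sqrt (B l) / 2 * K z) + norm (F z0) * (B l * K1 z)" for z
      proof (cases "near_mod_periods \<delta> z0 z")
        case True
        then have "norm (F z - F z0) \<le> \<eta>" using d(3) by (blast intro: less_imp_le)
        then have "norm (F z - F z0) * K z \<le> \<eta> * K z" using Kn(1) by (rule mult_right_mono)
        moreover have "0 \<le> (sqrt (B l) / 2 * (norm (F z))\<^sup>2 + sqrt (B l) / 2 * K z) + norm (F z0) * (B l * K1 z)"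
          using Kn B0[of l] by (intro add_nonneg_nonneg mult_nonneg_nonneg) auto
        ultimately show ?thesis using Kn by (simp add: norm_mult)
      next
        case False
        define t where "t = sqrt (B l)"
        have t: "t > 0" "t * t = B l" using B0[of l] by (simp_all add: t_def)
        have "2 * norm (F z) * (K z / t) \<le> (norm (F z))\<^sup>2 + (K z / t)\<^sup>2" by (rule sum_squares_bound)
        then have "t / 2 * (2 * norm (F z) * (K z / t)) \<le> t / 2 * ((norm (F z))\<^sup>2 + (K z / t)\<^sup>2)"
          using t by (intro mult_left_mono) auto
        then have 1: "norm (F z) * K z \<le> t / 2 * (norm (F z))\<^sup>2 + t / 2 * (K z / t)\<^sup>2"
          using t by (simp add: distrib_left)
        have "K z * K z \<le> (t * t) * K z" using far(2)[OF False] Kn unfolding t(2) by (intro mult_right_mono)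
        moreover have "(K z / t)\<^sup>2 = K z * K z / (t * t)" by (simp add: power2_eq_square)
        moreover have "t * t > 0" using t(1) by simp
        ultimately have "(K z / t)\<^sup>2 \<le> K z" by (simp only: pos_divide_le_eq mult.commute)
        from mult_left_mono[OF this, of "t / 2"] have "t / 2 * (K z / t)\<^sup>2 \<le> t / 2 * K z" using t(1) by simp
        then have 2: "norm (F z) * K z \<le> t / 2 * (norm (F z))\<^sup>2 + t / 2 * K z"
          using 1 by linarith
        have 3: "norm (F z0) * K z \<le> norm (F z0) * (B l * K1 z)" using far(1)[OF False] by (intro mult_left_mono) auto
        have "norm ((F z - F z0) * of_real (K z)) = norm (F z - F z0) * K z" using Kn by (simp add: norm_mult)
        also have "\<dots> \<le> (norm (F z) + norm (F z0)) * K z" using Kn by (intro mult_right_mono norm_triangle_ineq4)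
        also have "\<dots> \<le> (t / 2 * (norm (F z))\<^sup>2 + t / 2 * K z) + norm (F z0) * (B l * K1 z)"
          unfolding distrib_right using 2 3 by (rule add_mono)
        also have "\<dots> \<le> \<eta> * K z + ((t / 2 * (norm (F z))\<^sup>2 + t / 2 * K z) + norm (F z0) * (B l * K1 z))"
          using e Kn by simp
        finally show ?thesis by (simp add: t_def)
      qed
      have iK': "integrable physical_measure (\<lambda>z. complex_of_real (K z))" using iK by simp
      have "(LINT z|physical_measure. F z * of_real (K z)) - F z0 = (LINT z|physical_measure. F z * of_real (K z) - F z0 * of_real (K z))"
        using iFK iK' iK(2) by (simp add: integral_complex_of_real)
      also have "\<dots> = (LINT z|physical_measure. (F z - F z0) * of_real (K z))" by (simp add: left_diff_distrib)
      also have "norm \<dots> \<le> (LINT z|physical_measure. \<eta> * K z + (sqrt (B l) / 2 * (norm (F z))\<^sup>2 + sqrt (B l) / 2 * K z) + norm (F z0) * (B l * K1 z))"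
      proof -
        have "integrable physical_measure (\<lambda>z. F z * of_real (K z) - F z0 * of_real (K z))"
          by (intro Bochner_Integration.integrable_diff integrable_mult_right iFK iK')
        then have i1: "integrable physical_measure (\<lambda>z. (F z - F z0) * of_real (K z))" by (simp add: left_diff_distrib)
        have i2: "integrable physical_measure (\<lambda>z. \<eta> * K z + (sqrt (B l) / 2 * (norm (F z))\<^sup>2 + sqrt (B l) / 2 * K z) + norm (F z0) * (B l * K1 z))"
          by (intro Bochner_Integration.integrable_add integrable_mult_right iK iK1 iQ)
        have "norm (LINT z|physical_measure. (F z - F z0) * of_real (K z)) \<le> (LINT z|physical_measure. norm ((F z - F z0) * of_real (K z)))"
          by (rule Bochner_Integration.integral_norm_bound)
        also have "\<dots> \<le> (LINT z|physical_measure. \<eta> * K z + (sqrt (B l) / 2 * (norm (F z))\<^sup>2 + sqrt (B l) / 2 * K z) + norm (F z0) * (B l * K1 z))"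
          by (rule integral_mono[OF integrable_norm[OF i1] i2 pt])
        finally show ?thesis .
      qed
      also have "\<dots> = \<eta> * 1 + (sqrt (B l) / 2 * Q + sqrt (B l) / 2 * 1) + norm (F z0) * (B l * 1)"
      proof -
        note i1 = integrable_mult_right[OF iK(1)] integrable_mult_right[OF iK1(1)] integrable_mult_right[OF iQ]
        show ?thesis
          by (simp add: i1 Bochner_Integration.integral_add Bochner_Integration.integrable_add iK iK1 iQ Q_def[symmetric])
      qed
      finally show ?thesis unfolding K_def E_def by (simp add: algebra_simps add_divide_distrib)
    qed
    then show ?thesis using Elim by blast
  qed
  show ?thesis
  proof (rule LIMSEQ_I)
    fix \<epsilon> :: real assume ep: "\<epsilon> > 0"
    obtain E where E: "E \<longlonglongrightarrow> 0" "\<forall>l. norm ((LINT z|physical_measure. F z * of_real (phys_kernel (2 * Suc l) z0 z)) - F z0) \<le> \<epsilon> / 2 + E l"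
      using bound[of "\<epsilon> / 2"] ep by auto
    have "\<epsilon> / 2 > 0" using ep by simp
    from LIMSEQ_D[OF E(1) this] obtain n0 where n0: "\<And>l. l \<ge> n0 \<Longrightarrow> norm (E l - 0) < \<epsilon> / 2" by blast
    show "\<exists>n0. \<forall>l\<ge>n0. norm ((LINT z|physical_measure. F z * of_real (phys_kernel (2 * Suc l) z0 z)) - F z0) < \<epsilon>"
    proof (intro exI allI impI)
      fix l assume "l \<ge> n0"
      from n0[OF this] have "E l < \<epsilon> / 2" by simp
      then show "norm ((LINT z|physical_measure. F z * of_real (phys_kernel (2 * Suc l) z0 z)) - F z0) < \<epsilon>"
        using E(2)[rule_format, of l] by linarith
    qed
  qed
qed

text \<open>Let the index tend to infinity in the pairing identity: by dominated convergence on the frequency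
  side, and because the kernel is an approximate identity on the other.\<close>

theorem fourier_inversion:
  fixes F :: "(real ^ 'n) \<times> (real ^ 'n) \<Rightarrow> complex"
  assumes test: "test_function F G"
  shows "F z0 = (LINT w|frequency_measure. G w * phase w z0)"
proof -
  have per: "torus_periodic F" and cont: "continuous_on UNIV F" and sq: "square_integrable physical_measure F"
    and FG: "is_fourier_L2 F G" and G: "integrable frequency_measure G"
    using test by (auto simp: test_function_def)
  define W where "W = (\<lambda>l (w :: (int ^ 'n) \<times> (real ^ 'n)). complex_of_real (freq_window (2 * Suc l) w))"
  have Wlim: "(\<lambda>l. W l w) \<longlonglongrightarrow> 1" for w :: "(int ^ 'n) \<times> (real ^ 'n)"
  proof -
    have g: "(\<lambda>l. gauss_freq (real l) t) \<longlonglongrightarrow> 1" for t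
    proof -
      have "(\<lambda>l. pi * t\<^sup>2 * inverse (real l)) \<longlonglongrightarrow> pi * t\<^sup>2 * 0"
        by (rule tendsto_mult[OF tendsto_const lim_inverse_n])
      from tendsto_exp[OF tendsto_minus[OF this]]
      have "(\<lambda>l. exp (- (pi * t\<^sup>2 * inverse (real l)))) \<longlonglongrightarrow> exp (- (pi * t\<^sup>2 * 0))" .
      then show ?thesis by (simp add: gauss_freq_def divide_inverse)
    qed
    have "(\<lambda>l. \<Prod>j\<in>(UNIV::'n set). vallee_poussin_coeff l (fst w $ j)) \<longlonglongrightarrow> (\<Prod>j\<in>(UNIV::'n set). 1)"
      by (rule tendsto_prod) (rule vallee_poussin_coeff_tendsto)
    moreover have "(\<lambda>l. \<Prod>j\<in>(UNIV::'n set). gauss_freq (real l) (snd w $ j)) \<longlonglongrightarrow> (\<Prod>j\<in>(UNIV::'n set). 1)"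
      by (rule tendsto_prod) (rule g)
    ultimately have "(\<lambda>l. freq_window l w) \<longlonglongrightarrow> (\<Prod>j\<in>(UNIV::'n set). 1) * (\<Prod>j\<in>(UNIV::'n set). 1)"
      unfolding freq_window_def by (rule tendsto_mult)
    then have "(\<lambda>l. freq_window l w) \<longlonglongrightarrow> 1" by simp
    moreover have "strict_mono (\<lambda>l. 2 * Suc l)" by (rule strict_monoI) simp
    ultimately have "((\<lambda>l. freq_window l w) \<circ> (\<lambda>l. 2 * Suc l)) \<longlonglongrightarrow> 1" by (rule LIMSEQ_subseq_LIMSEQ)
    then have "(\<lambda>l. complex_of_real (freq_window (2 * Suc l) w)) \<longlonglongrightarrow> of_real 1"
      unfolding o_def by (rule tendsto_of_real)
    then show ?thesis by (simp add: W_def)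
  qed
  have Gm: "G \<in> borel_measurable frequency_measure" by (rule borel_measurable_integrable[OF G])
  have phm: "(\<lambda>w. phase w z0) \<in> borel_measurable frequency_measure"
    using phase_measurable[of "\<lambda>w. w" frequency_measure "\<lambda>_. fst z0" "\<lambda>_. snd z0"] by simp
  have wm: "(\<lambda>w. W l w * phase w z0) \<in> borel_measurable frequency_measure" for l
  proof -
    have "integrable frequency_measure (\<lambda>w. of_real (freq_window (2 * Suc l) w) * (phase w z0 * cnj (phase w 0)))"
      by (rule integrable_window_phase) simp
    moreover have "phase w 0 = 1" for w :: "(int ^ 'n) \<times> (real ^ 'n)" by (simp add: phase_def)
    ultimately show ?thesis using borel_measurable_integrable by (fastforce simp: W_def)
  qed
  have "(\<lambda>l. LINT w|frequency_measure. G w * (W l w * phase w z0)) \<longlonglongrightarrow> (LINT w|frequency_measure. G w * phase w z0)"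
  proof (rule integral_dominated_convergence[where w = "\<lambda>w. norm (G w)"])
    show "(\<lambda>w. G w * phase w z0) \<in> borel_measurable frequency_measure" by (intro borel_measurable_times Gm phm)
    show "(\<lambda>w. G w * (W l w * phase w z0)) \<in> borel_measurable frequency_measure" for l
      by (intro borel_measurable_times Gm wm)
    show "integrable frequency_measure (\<lambda>w. norm (G w))" using G by simp
    show "AE w in frequency_measure. (\<lambda>l. G w * (W l w * phase w z0)) \<longlonglongrightarrow> G w * phase w z0"
    proof (rule AE_I2)
      fix w
      have "(\<lambda>l. G w * (W l w * phase w z0)) \<longlonglongrightarrow> G w * (1 * phase w z0)" by (intro tendsto_intros Wlim)
      then show "(\<lambda>l. G w * (W l w * phase w z0)) \<longlonglongrightarrow> G w * phase w z0" by simp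
    qed
    show "AE w in frequency_measure. norm (G w * (W l w * phase w z0)) \<le> norm (G w)" for l
    proof (rule AE_I2)
      fix w
      have "norm (W l w) \<le> 1" using freq_window_bounds[of "2 * Suc l" w] by (simp add: W_def)
      then show "norm (G w * (W l w * phase w z0)) \<le> norm (G w)" by (simp add: norm_mult mult_left_le)
    qed
  qed
  moreover have "(\<lambda>l. LINT w|frequency_measure. G w * (W l w * phase w z0)) \<longlonglongrightarrow> F z0"
  proof -
    have "(LINT w|frequency_measure. G w * (W l w * phase w z0)) =
       (LINT z|physical_measure. F z * of_real (phys_kernel (2 * Suc l) z0 z))" for l
      unfolding W_def by (rule pairing_identity(2)[OF FG G]) simp
    then show ?thesis
      using phys_kernel_approximate_identity[OF per cont sq pairing_identity(1)[OF FG G]] by simp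
  qed
  ultimately show ?thesis by (rule LIMSEQ_unique[symmetric])
qed

section \<open>The equidistribution estimate\<close>

lemma sgn_prod: "sgn (\<Prod>i\<in>I. f i) = (\<Prod>i\<in>I. sgn (f i))" for f :: "'a \<Rightarrow> complex"
  by (induction I rule: infinite_finite_induct) (simp_all add: sgn_mult)

lemma sgn_inverse_complex: "sgn (inverse z) = inverse (sgn z)" for z :: complex
proof (cases "z = 0")
  case False
  have "sgn z * sgn (inverse z) = sgn (z * inverse z)" by (simp only: sgn_mult)
  also have "\<dots> = 1" using False by simp
  finally have "sgn z * sgn (inverse z) = 1" .
  then show ?thesis by (rule inverse_unique[symmetric])
qed simp

lemma sgn_powi_complex: "sgn (z powi k) = sgn z powi k" for z :: complex
proof -
  have "sgn (z ^ m) = sgn z ^ m" for z :: complex and m by (induction m) (simp_all add: sgn_mult)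
  then show ?thesis by (simp add: power_int_def sgn_inverse_complex flip: power_inverse)
qed

text \<open>The characters of the torus, at the arguments of the point, give the argument of its monomial.\<close>

lemma phase_orbit_point:
  fixes \<alpha> :: "complex ^ 'n"
  assumes nz: "\<And>j. \<alpha> $ j \<noteq> 0"
  shows "phase (n, t) (angle_vec \<alpha>, log_vec \<alpha>) = sgn (monomial n \<alpha>) * cis (2 * pi * (t \<bullet> log_vec \<alpha>))"
proof -
  have "2 * pi * (\<Sum>j\<in>UNIV. of_int (n $ j) * angle_vec \<alpha> $ j) = (\<Sum>j\<in>UNIV. of_int (n $ j) * Arg (\<alpha> $ j))"
    by (simp add: angle_vec_def sum_distrib_left)
  then have "cis (2 * pi * (\<Sum>j\<in>UNIV. of_int (n $ j) * angle_vec \<alpha> $ j)) = (\<Prod>j\<in>UNIV. cis (of_int (n $ j) * Arg (\<alpha> $ j)))"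
    by (simp add: cis_sum)
  also have "\<dots> = (\<Prod>j\<in>UNIV. sgn (\<alpha> $ j) powi (n $ j))"
    by (simp add: cis_Arg nz flip: cis_power_int)
  also have "\<dots> = sgn (monomial n \<alpha>)" by (simp add: monomial_def sgn_prod sgn_powi_complex)
  finally show ?thesis by (simp add: phase_def)
qed

lemma norm_cis_minus_one_le: "norm (cis x - 1) \<le> \<bar>x\<bar>"
proof -
  have "norm (cis x - 1) = 2 * \<bar>sin (x / 2)\<bar>" using dist_exp_i_1[of x] by (simp add: cis_conv_exp)
  also have "\<dots> \<le> 2 * \<bar>x / 2\<bar>" by (intro mult_left_mono abs_sin_x_le_abs_x) auto
  finally show ?thesis by simp
qed

lemma ln_over_decreasing:
  assumes "1 \<le> a" "a \<le> b"
  shows "ln (2 * real b) / real b \<le> ln (2 * real a) / real a"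
  using assms(2,1)
proof (induction b rule: dec_induct)
  case base show ?case by simp
next
  case (step k)
  then have k: "real k \<ge> 1" by simp
  have l2: "ln 2 \<ge> (2/3 :: real)" by (rule ln2_ge_two_thirds)
  have "real k * ln (1 + 1 / real k) \<le> ln (2 * real k)"
  proof (cases "k = 1")
    case False
    then have "real k \<ge> 2" using k by linarith
    have "ln (1 + 1 / real k) \<le> 1 / real k" using k by (intro ln_add_one_self_le_self) simp
    then have "real k * ln (1 + 1 / real k) \<le> 1" using k by (simp add: field_simps)
    also have "1 \<le> ln 2 + ln (real k)"
    proof -
      have "ln 2 \<le> ln (real k)" using \<open>real k \<ge> 2\<close> by (subst ln_le_cancel_iff) auto
      then show ?thesis using l2 by linarith
    qed
    finally show ?thesis using k by (simp add: ln_mult)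
  qed simp
  moreover have "ln (2 * real (Suc k)) = ln (2 * real k) + ln (1 + 1 / real k)"
  proof -
    have "2 * real (Suc k) = 2 * real k * (1 + 1 / real k)" using k by (simp add: field_simps)
    then show ?thesis using k by (simp only:) (rule ln_mult_pos, auto intro: add_pos_nonneg)
  qed
  ultimately have "real k * ln (2 * real (Suc k)) \<le> (real k + 1) * ln (2 * real k)"
    by (simp add: algebra_simps)
  then have "ln (2 * real (Suc k)) / real (Suc k) \<le> ln (2 * real k) / real k"
    using k by (simp add: field_simps)
  then show ?case using step by linarith
qed

lemma l1_norm_nonneg: "l1_norm (x :: 'a::{comm_monoid_add,abs,ordered_ab_group_add_abs} ^ 'n) \<ge> 0"
  by (simp add: l1_norm_def sum_nonneg)

lemma l1_norm_pos_int:
  fixes n :: "int ^ 'n"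
  assumes "n \<noteq> 0" shows "l1_norm n \<ge> 1"
proof -
  obtain j where "n $ j \<noteq> 0" using assms by (auto simp: vec_eq_iff)
  then have "1 \<le> \<bar>n $ j\<bar>" by linarith
  also have "\<dots> \<le> l1_norm n" unfolding l1_norm_def by (rule member_le_sum) auto
  finally show ?thesis .
qed

lemma gen_degree_le:
  "n \<noteq> 0 \<Longrightarrow> gen_degree \<xi> \<le> nat (l1_norm n) * alg_degree (monomial n \<xi>)"
  unfolding gen_degree_def by (rule cINF_lower) auto

context
  fixes \<xi> :: "complex ^ 'n"
  assumes alg: "\<And>j. algebraic (\<xi> $ j)" and nz: "\<And>j. \<xi> $ j \<noteq> 0"
begin

lemma gen_degree_pos: "gen_degree \<xi> \<ge> 1"
proof -
  let ?A = "(\<lambda>n. nat (l1_norm n) * alg_degree (monomial n \<xi>)) ` {n. n \<noteq> 0}"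
  have "axis undefined 1 \<noteq> (0 :: int ^ 'n)" by (simp add: axis_eq_0_iff)
  then have "?A \<noteq> {}" by blast
  then have "Inf ?A \<in> ?A" by (rule Inf_nat_def1)
  then obtain n where n: "n \<noteq> 0" "gen_degree \<xi> = nat (l1_norm n) * alg_degree (monomial n \<xi>)"
    unfolding gen_degree_def by blast
  have "algebraic (monomial n \<xi>)" by (rule monomial_algebraic[OF alg nz self_mem_galois_orbit])
  then have "alg_degree (monomial n \<xi>) \<ge> 1" using degree_int_min_poly_pos by (simp add: alg_degree_def Suc_leI)
  moreover have "nat (l1_norm n) \<ge> 1" using l1_norm_pos_int[OF n(1)] by linarith
  ultimately show ?thesis using n(2) mult_le_mono[of 1 _ 1] by simp
qed

lemma height_nonneg: "height \<xi> \<ge> 0"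
  unfolding height_def by (intro sum_nonneg weil_height_nonneg alg)

lemma weil_height_le_height: "weil_height (\<xi> $ j) \<le> height \<xi>"
  unfolding height_def by (rule member_le_sum) (auto intro: weil_height_nonneg alg)

lemma height_D_pos: "height_D \<xi> > 0"
proof -
  have "ln (2 * real (gen_degree \<xi>)) > 0" using gen_degree_pos by simp
  then show ?thesis using height_nonneg gen_degree_pos by (simp add: height_D_def add_nonneg_pos)
qed

lemma height_le_height_D: "height \<xi> \<le> height_D \<xi>"
  using gen_degree_pos by (simp add: height_D_def)

lemma monomial_height_le: "monomial_height \<xi> n \<le> of_int (l1_norm n) * height \<xi>"
proof -
  have "monomial_height \<xi> n \<le> (\<Sum>j\<in>UNIV. real_of_int \<bar>n $ j\<bar> * height \<xi>)"
    unfolding monomial_height_def[OF alg nz] expo_def[OF alg nz]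
    by (intro sum_mono mult_mono weil_height_le_height height_nonneg weil_height_nonneg alg) auto
  then show ?thesis by (simp add: l1_norm_def sum_distrib_right)
qed

definition orbit_average :: "(int ^ 'n) \<times> (real ^ 'n) \<Rightarrow> complex" where
  "orbit_average w = (\<Sum>\<alpha>\<in>galois_orbit \<xi>. phase w (angle_vec \<alpha>, log_vec \<alpha>)) / of_nat (card (galois_orbit \<xi>))"

lemma card_orbit_pos: "card (galois_orbit \<xi>) > 0"
  by (rule card_galois_orbit_pos[OF alg])

lemma norm_orbit_average_le_1: "norm (orbit_average w) \<le> 1"
proof -
  have "norm (\<Sum>\<alpha>\<in>galois_orbit \<xi>. phase w (angle_vec \<alpha>, log_vec \<alpha>)) \<le> (\<Sum>\<alpha>\<in>galois_orbit \<xi>. 1)"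
    by (rule order_trans[OF norm_sum]) (simp)
  then show ?thesis using card_orbit_pos by (simp add: orbit_average_def norm_divide divide_le_eq)
qed

lemma average_log_phase_le:
  "(\<Sum>\<alpha>\<in>galois_orbit \<xi>. norm (cis (2 * pi * (t \<bullet> log_vec \<alpha>)) - 1)) / card (galois_orbit \<xi>) \<le> 4 * pi * (l1_norm t * height \<xi>)"
proof -
  let ?S = "galois_orbit \<xi>"
  have "norm (cis (2 * pi * (t \<bullet> log_vec \<alpha>)) - 1) \<le> 2 * pi * (\<Sum>j\<in>UNIV. \<bar>t $ j\<bar> * \<bar>ln (norm (\<alpha> $ j))\<bar>)" for \<alpha> :: "complex ^ 'n"
  proof -
    have "norm (cis (2 * pi * (t \<bullet> log_vec \<alpha>)) - 1) \<le> \<bar>2 * pi * (t \<bullet> log_vec \<alpha>)\<bar>" by (rule norm_cis_minus_one_le)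
    also have "\<dots> = 2 * pi * \<bar>\<Sum>j\<in>UNIV. t $ j * ln (norm (\<alpha> $ j))\<bar>" by (simp add: abs_mult inner_vec_def log_vec_def)
    also have "\<dots> \<le> 2 * pi * (\<Sum>j\<in>UNIV. \<bar>t $ j * ln (norm (\<alpha> $ j))\<bar>)" by (intro mult_left_mono sum_abs) simp
    finally show ?thesis by (simp add: abs_mult)
  qed
  then have "(\<Sum>\<alpha>\<in>?S. norm (cis (2 * pi * (t \<bullet> log_vec \<alpha>)) - 1)) / card ?S \<le>
    (\<Sum>\<alpha>\<in>?S. 2 * pi * (\<Sum>j\<in>UNIV. \<bar>t $ j\<bar> * \<bar>ln (norm (\<alpha> $ j))\<bar>)) / card ?S"
    by (intro divide_right_mono sum_mono) auto
  also have "\<dots> = 2 * pi * (\<Sum>j\<in>UNIV. \<bar>t $ j\<bar> * ((\<Sum>\<alpha>\<in>?S. \<bar>ln (norm (\<alpha> $ j))\<bar>) / card ?S))"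
    unfolding sum_distrib_left[symmetric] by (subst sum.swap) (simp add: sum_divide_distrib sum_distrib_left)
  also have "\<dots> \<le> 2 * pi * (\<Sum>j\<in>UNIV. \<bar>t $ j\<bar> * (2 * height \<xi>))"
  proof (intro mult_left_mono sum_mono)
    fix j
    have "(\<Sum>\<alpha>\<in>?S. \<bar>ln (norm (\<alpha> $ j))\<bar>) / card ?S = (\<Sum>y\<in>conjugates (\<xi> $ j). \<bar>ln (norm y)\<bar>) / card (conjugates (\<xi> $ j))"
      by (rule galois_orbit_average[OF alg, of "\<lambda>\<alpha>. \<alpha> $ j" "\<lambda>y. \<bar>ln (norm y)\<bar>", OF alg]) simp
    also have "\<dots> \<le> 2 * weil_height (\<xi> $ j)" by (rule sum_abs_ln_conjugates_le[OF alg nz])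
    also have "\<dots> \<le> 2 * height \<xi>" using weil_height_le_height by simp
    finally show "(\<Sum>\<alpha>\<in>?S. \<bar>ln (norm (\<alpha> $ j))\<bar>) / card ?S \<le> 2 * height \<xi>" .
  qed auto
  also have "\<dots> = 4 * pi * (l1_norm t * height \<xi>)" by (simp add: l1_norm_def sum_distrib_right sum_distrib_left mult_ac)
  finally show ?thesis .
qed

text \<open>The generalized degree \<open>D\<close> is at most \<open>\<parallel>n\<parallel> d\<close>, and \<open>log (2 k) / k\<close> decreases over the positive
  integers, so the error term at \<open>d\<close> is at most \<open>\<parallel>n\<parallel>\<close> times the one at \<open>D\<close>.\<close>

lemma average_sgn_monomial_height_D:
  assumes n: "n \<noteq> 0" and y: "of_int (l1_norm n) \<le> y"
  defines "x \<equiv> height_D \<xi> * y"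
  shows "norm (\<Sum>\<alpha>\<in>galois_orbit \<xi>. sgn (monomial n \<alpha>)) / card (galois_orbit \<xi>) \<le> 2 * x + sqrt 6 * sqrt x"
proof -
  define d where "d = alg_degree (monomial n \<xi>)"
  define m where "m = nat (l1_norm n)"
  define D where "D = gen_degree \<xi>"
  have l1: "l1_norm n \<ge> 1" by (rule l1_norm_pos_int[OF n])
  have m: "m \<ge> 1" "real m = of_int (l1_norm n)" using l1 by (simp_all add: m_def)
  have D1: "D \<ge> 1" unfolding D_def by (rule gen_degree_pos)
  have Dm: "D \<le> m * d" unfolding D_def m_def d_def by (rule gen_degree_le[OF n])
  have d0: "d > 0" using D1 Dm by (cases d) auto
  have "ln (2 * real d) / d \<le> ln (2 * real (m * d)) / d"
    using d0 m by (intro divide_right_mono) (auto simp: ln_mono)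
  also have "\<dots> = m * (ln (2 * real (m * d)) / real (m * d))" using m(1) by simp
  also have "\<dots> \<le> m * (ln (2 * real D) / real D)"
    by (intro mult_left_mono ln_over_decreasing D1 Dm) simp
  finally have "ln (2 * real d) / d / 3 \<le> m * (ln (2 * real D) / real D) / 3" by (rule divide_right_mono) simp
  then have "ln (2 * real d) / (3 * real d) \<le> m * (ln (2 * real D) / (3 * real D))" by (simp add: mult.commute)
  moreover have H: "monomial_height \<xi> n \<le> m * height \<xi>" using monomial_height_le m by simp
  ultimately have "monomial_height \<xi> n + ln (2 * real d) / (3 * real d) \<le> m * height_D \<xi>"
    by (simp add: height_D_def D_def distrib_left)
  also have "m * height_D \<xi> \<le> x" unfolding x_def
    using y m(2) height_D_pos by (simp add: mult.commute)
  finally have 1: "monomial_height \<xi> n + ln (2 * real d) / (3 * real d) \<le> x" .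
  have "monomial_height \<xi> n \<le> x"
    using 1 d0 by (smt (verit) divide_nonneg_nonneg ln_ge_zero of_nat_0_le_iff of_nat_le_iff of_nat_1 Suc_leI One_nat_def)
  moreover have "sqrt 6 * sqrt (monomial_height \<xi> n + ln (2 * real d) / (3 * real d)) \<le> sqrt 6 * sqrt x"
    by (intro mult_left_mono real_sqrt_le_mono 1) simp
  ultimately show ?thesis
    using average_sgn_monomial_le[OF alg nz, of n] unfolding d_def by linarith
qed

text \<open>The linear term is absorbed into the square root when \<open>x < 1 / 4\<close>; otherwise the bound exceeds the
  trivial one, which is 2.\<close>

lemma orbit_average_deviation:
  fixes n :: "int ^ 'n" and t :: "real ^ 'n"
  assumes y: "of_int (l1_norm n) + l1_norm t \<le> y"
  defines "x \<equiv> height_D \<xi> * y"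
  shows "norm (orbit_average (n, t) - (if n = 0 then 1 else 0)) \<le> 2 * (sqrt (8 * pi) + sqrt 6) * sqrt x"
proof -
  let ?S = "galois_orbit \<xi>" and ?B = "norm (orbit_average (n, t) - (if n = 0 then 1 else 0))"
  define s where "s = real (card ?S)"
  have s0: "s > 0" using card_orbit_pos by (simp add: s_def)
  have ln: "of_int (l1_norm n) \<ge> (0::real)" by (simp add: l1_norm_nonneg)
  have lt: "l1_norm t \<ge> 0" by (rule l1_norm_nonneg)
  have y0: "y \<ge> 0" and ny: "of_int (l1_norm n) \<le> y" and ty: "l1_norm t \<le> y" using y ln lt by linarith+
  have x0: "x \<ge> 0" unfolding x_def using height_D_pos y0 by simp
  define T where "T = (\<Sum>\<alpha>\<in>?S. norm (cis (2 * pi * (t \<bullet> log_vec \<alpha>)) - 1)) / s"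
  have "l1_norm t * height \<xi> \<le> x"
    unfolding x_def mult.commute[of "height_D \<xi>"] by (intro mult_mono ty height_le_height_D lt height_nonneg y0)
  then have "4 * pi * (l1_norm t * height \<xi>) \<le> 4 * pi * x" by (intro mult_left_mono) auto
  then have T: "T \<le> 4 * pi * x"
    using average_log_phase_le[of t] unfolding T_def s_def by linarith
  have onz: "\<alpha> $ j \<noteq> 0" if "\<alpha> \<in> ?S" for \<alpha> :: "complex ^ 'n" and j using orbit_nonzero[OF alg nz that] .
  define A where "A = (\<Sum>\<alpha>\<in>?S. sgn (monomial n \<alpha>))"
  define X where "X = (\<Sum>\<alpha>\<in>?S. sgn (monomial n \<alpha>) * (cis (2 * pi * (t \<bullet> log_vec \<alpha>)) - 1)) / of_real s"
  have main: "orbit_average (n, t) = X + A / of_real s"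
  proof -
    have "(\<Sum>\<alpha>\<in>?S. phase (n, t) (angle_vec \<alpha>, log_vec \<alpha>)) = (\<Sum>\<alpha>\<in>?S. sgn (monomial n \<alpha>) * cis (2 * pi * (t \<bullet> log_vec \<alpha>)))"
      by (rule sum.cong[OF refl]) (rule phase_orbit_point[OF onz])
    also have "\<dots> = (\<Sum>\<alpha>\<in>?S. sgn (monomial n \<alpha>) * (cis (2 * pi * (t \<bullet> log_vec \<alpha>)) - 1)) + A"
      unfolding A_def sum.distrib[symmetric] by (simp add: algebra_simps)
    finally show ?thesis by (simp add: orbit_average_def s_def X_def add_divide_distrib)
  qed
  have first: "norm X \<le> T"
  proof -
    have "norm (\<Sum>\<alpha>\<in>?S. sgn (monomial n \<alpha>) * (cis (2 * pi * (t \<bullet> log_vec \<alpha>)) - 1)) \<le>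
       (\<Sum>\<alpha>\<in>?S. norm (cis (2 * pi * (t \<bullet> log_vec \<alpha>)) - 1))"
      by (rule order_trans[OF norm_sum sum_mono]) (simp add: norm_mult norm_sgn)
    then show ?thesis using s0 by (simp add: T_def X_def norm_divide divide_right_mono)
  qed
  have B: "?B \<le> (4 * pi + 2) * x + sqrt 6 * sqrt x"
  proof (cases "n = 0")
    case True
    have "A = of_real s" using True by (simp add: A_def s_def monomial_def)
    then have A1: "A / of_real s = 1" using s0 by simp
    have "?B \<le> T" unfolding main A1 using first True by simp
    also note T
    also have "4 * pi * x \<le> (4 * pi + 2) * x + sqrt 6 * sqrt x" using x0 by (simp add: distrib_right)
    finally show ?thesis .
  next
    case False
    have "?B \<le> T + norm (A / of_real s)"
      unfolding main using False first by (simp) (meson add_right_mono norm_triangle_ineq order_trans)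
    also have "norm (A / of_real s) \<le> 2 * x + sqrt 6 * sqrt x"
      using average_sgn_monomial_height_D[OF False ny] s0 by (simp add: A_def s_def x_def norm_divide)
    finally show ?thesis using T by (simp add: distrib_right)
  qed
  have pi8: "4 \<le> sqrt (8 * pi)" by (rule real_le_rsqrt) (use pi_ge_two in auto)
  have r6: "2 \<le> sqrt 6" by (rule real_le_rsqrt) auto
  show ?thesis
  proof (cases "x \<ge> 1/4")
    case True
    have "1/2 \<le> sqrt x" by (rule real_le_rsqrt) (use True in \<open>simp add: power2_eq_square\<close>)
    have "?B \<le> norm (orbit_average (n, t)) + norm (if n = 0 then 1 else 0 :: complex)" by (rule norm_triangle_ineq4)
    also have "\<dots> \<le> 1 + 1" by (intro add_mono norm_orbit_average_le_1) simp
    also have "\<dots> \<le> 2 * (4 + 2) * (1/2 :: real)" by simp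
    also have "\<dots> \<le> 2 * (sqrt (8 * pi) + sqrt 6) * sqrt x"
      using pi8 r6 \<open>1/2 \<le> sqrt x\<close> by (intro mult_mono add_mono) auto
    finally show ?thesis .
  next
    case False
    have "sqrt x \<le> 1/2" by (rule real_le_lsqrt) (use False x0 in \<open>auto simp: power2_eq_square\<close>)
    then have "sqrt x * sqrt x \<le> 1/2 * sqrt x" using x0 by (intro mult_right_mono) auto
    then have "x \<le> 1/2 * sqrt x" using x0 by simp
    then have "(4 * pi + 2) * x \<le> (4 * pi + 2) * (1/2 * sqrt x)" by (intro mult_left_mono) auto
    also have "\<dots> = (2 * pi + 1) * sqrt x" by (simp add: algebra_simps)
    also have "\<dots> \<le> (2 * sqrt (8 * pi) + sqrt 6) * sqrt x"
      using pi8 r6 pi_less_4 x0 by (intro mult_right_mono) auto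
    finally show ?thesis using B by (simp add: algebra_simps)
  qed
qed

end

text \<open>Fubini identifies the sum of integrals with one integral over the product measure.\<close>

lemma tail_freq_integral:
  fixes G :: "(int ^ 'n) \<times> (real ^ 'n) \<Rightarrow> complex" and y :: real
  assumes G: "integrable frequency_measure G"
  defines "U \<equiv> {w :: (int ^ 'n) \<times> (real ^ 'n). of_int (l1_norm (fst w)) + l1_norm (snd w) > y}"
  shows "integrable frequency_measure (\<lambda>w. indicator U w * norm (G w))"
    and "tail_freq G y = (LINT w|frequency_measure. indicator U w * norm (G w))"
    and "tail_freq G y \<ge> 0"
proof -
  interpret C: sigma_finite_measure "count_space UNIV :: (int ^ 'n) measure" by (rule sigma_finite_count)
  interpret L: sigma_finite_measure "lborel :: (real ^ 'n) measure" by (rule sigma_finite_lborel)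
  interpret pair_sigma_finite "count_space UNIV :: (int ^ 'n) measure" "lborel :: (real ^ 'n) measure" ..
  have m1: "(\<lambda>w. real_of_int (l1_norm (fst w))) \<in> borel_measurable (frequency_measure :: ((int ^ 'n) \<times> (real ^ 'n)) measure)"
    by (rule measurable_compose[OF measurable_fst]) simp
  have m2: "(\<lambda>w. l1_norm (snd w)) \<in> borel_measurable (frequency_measure :: ((int ^ 'n) \<times> (real ^ 'n)) measure)"
    unfolding l1_norm_def
    by (intro borel_measurable_sum borel_measurable_abs borel_measurable_vec_component measurable_snd_frequency)
  have U: "U \<in> sets frequency_measure"
  proof -
    have "{w \<in> space (frequency_measure :: ((int ^ 'n) \<times> (real ^ 'n)) measure). y < of_int (l1_norm (fst w)) + l1_norm (snd w)} \<in> sets frequency_measure"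
      by (intro borel_measurable_less borel_measurable_const borel_measurable_add m1 m2)
    then show ?thesis by (simp add: U_def space_pair_measure)
  qed
  have "integrable frequency_measure (\<lambda>w. indicator U w *\<^sub>R norm (G w))"
    using G U by (intro integrable_mult_indicator integrable_norm)
  then show i: "integrable frequency_measure (\<lambda>w. indicator U w * norm (G w))" by simp
  have eq: "(LINT t:{t. of_int (l1_norm n) + l1_norm t > y}|lborel. norm (G (n, t))) = (LINT t|lborel. indicator U (n, t) * norm (G (n, t)))" for n
    unfolding set_lebesgue_integral_def by (intro Bochner_Integration.integral_cong refl) (simp add: U_def indicator_def)
  have "integrable (count_space UNIV) (\<lambda>n. LINT t|lborel. indicator U (n, t) * norm (G (n, t)))"
    using integrable_fst'[OF i] .
  then have s: "Infinite_Set_Sum.abs_summable_on (\<lambda>n. LINT t|lborel. indicator U (n, t) * norm (G (n, t))) UNIV"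
    by (simp add: Infinite_Set_Sum.abs_summable_on_def)
  have "tail_freq G y = infsetsum (\<lambda>n. LINT t|lborel. indicator U (n, t) * norm (G (n, t))) UNIV"
    unfolding tail_freq_def eq by (rule infsetsum_infsum[OF s, symmetric])
  also have "\<dots> = (LINT w|frequency_measure. indicator U w * norm (G w))"
    unfolding infsetsum_def using integral_fst'[OF i] by simp
  finally show t: "tail_freq G y = (LINT w|frequency_measure. indicator U w * norm (G w))" .
  show "tail_freq G y \<ge> 0" unfolding t by (rule Bochner_Integration.integral_nonneg) simp
qed

lemma integral_torus_phase:
  "(LINT \<theta>|torus. phase (n, t) (\<theta> :: real ^ 'n, 0)) = (if n = 0 then 1 else 0)"
proof -
  have "phase (n, t) (\<theta>, 0) = (\<Prod>j\<in>UNIV. cis (2 * pi * (of_int (n $ j) * \<theta> $ j)))" for \<theta> :: "real ^ 'n"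
    by (simp add: phase_def cis_sum sum_distrib_left)
  then have "(LINT \<theta>|torus. phase (n, t) (\<theta> :: real ^ 'n, 0)) = (\<Prod>j\<in>UNIV. if n $ j = 0 then 1 else 0)"
    using integral_torus_prod[of "\<lambda>j x. cis (2 * pi * (of_int (n $ j) * x))", OF integrable_unit_cis]
    by (simp add: integral_unit_cis)
  also have "\<dots> = (if n = 0 then 1 else 0)"
    by (auto simp: vec_eq_iff prod_zero_iff)
  finally show ?thesis .
qed

lemma torus_average_inversion:
  fixes F :: "(real ^ 'n) \<times> (real ^ 'n) \<Rightarrow> complex"
  assumes test: "test_function F G"
  shows "(LINT \<theta>|torus. F (\<theta>, 0)) = (LINT w|frequency_measure. G w * (if fst w = 0 then 1 else 0))"
proof -
  have G: "integrable frequency_measure G" using test by (simp add: test_function_def)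
  interpret X: sigma_finite_measure "torus :: (real ^ 'n) measure" by (rule sigma_finite_torus)
  interpret Y: sigma_finite_measure "frequency_measure :: ((int ^ 'n) \<times> (real ^ 'n)) measure" by (rule sigma_finite_frequency)
  interpret Z: finite_measure "torus :: (real ^ 'n) measure" by (rule finite_measure_torus)
  interpret pair_sigma_finite "torus :: (real ^ 'n) measure" "frequency_measure :: ((int ^ 'n) \<times> (real ^ 'n)) measure" ..
  have one: "integrable torus (\<lambda>\<theta> :: real ^ 'n. 1 :: complex)" by simp
  have i: "integrable (torus \<Otimes>\<^sub>M frequency_measure) (\<lambda>(\<theta> :: real ^ 'n, w). G w * phase w (\<theta>, 0))"
  proof (rule Bochner_Integration.integrable_bound[OF integrable_pair_mult[OF sigma_finite_torus sigma_finite_frequency one G]])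
    have "(\<lambda>p. G (snd p) * phase (snd p) (fst p, 0)) \<in> borel_measurable (torus \<Otimes>\<^sub>M (frequency_measure :: ((int ^ 'n) \<times> (real ^ 'n)) measure))"
      by (intro borel_measurable_times phase_measurable measurable_snd borel_measurable_const
          measurable_compose[OF measurable_fst measurable_torus_component] measurable_compose[OF measurable_snd borel_measurable_integrable[OF G]])
    then show "(\<lambda>(\<theta> :: real ^ 'n, w). G w * phase w (\<theta>, 0)) \<in> borel_measurable (torus \<Otimes>\<^sub>M frequency_measure)"
      by (simp add: case_prod_unfold)
  qed (auto simp: norm_mult)
  have "(LINT \<theta>|torus. F (\<theta>, 0)) = (LINT \<theta>|torus. LINT w|frequency_measure. G w * phase w (\<theta>, 0))"
    by (simp add: fourier_inversion[OF test])
  also have "\<dots> = (LINT w|frequency_measure. LINT \<theta>|torus. G w * phase w (\<theta>, 0))"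
    by (rule Fubini_integral[OF i, symmetric])
  also have "\<dots> = (LINT w|frequency_measure. G w * (if fst w = 0 then 1 else 0))"
  proof (rule Bochner_Integration.integral_cong[OF refl])
    fix w :: "(int ^ 'n) \<times> (real ^ 'n)"
    obtain n t where w: "w = (n, t)" by (cases w)
    have "(LINT \<theta>|torus. G w * phase w (\<theta>, 0)) = G w * (LINT \<theta>|torus. phase w (\<theta>, 0))" by (rule integral_mult_right_zero)
    then show "(LINT \<theta>|torus. G w * phase w (\<theta>, 0)) = G w * (if fst w = 0 then 1 else 0)"
      by (simp add: w integral_torus_phase)
  qed
  finally show ?thesis .
qed

theorem theorem4:
  fixes W :: "real \<Rightarrow> real"
    and \<xi> :: "complex ^ 'n"
    and F :: "(real ^ 'n) \<times> (real ^ 'n) \<Rightarrow> complex"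
    and Fhat :: "(int ^ 'n) \<times> (real ^ 'n) \<Rightarrow> complex"
  assumes W_pos: "\<And>x. x > 0 \<Longrightarrow> W x > 0"
    and W_mono: "mono_on {0<..} W"
    and W_at_top: "filterlim W at_top at_top"
    and W_sublinear: "((\<lambda>x. W x / x) \<longlongrightarrow> 0) at_top"
    and \<xi>: "\<And>j. \<xi> $ j \<in> algebraic_numbers - {0}"
    and F: "test_function F Fhat"
  shows "equidist_error F \<xi> \<le>
           2 * (sqrt (8 * pi) + sqrt 6) * sqrt (height_D \<xi> * W (inverse (height_D \<xi>)))
             * L1_norm_freq Fhat
           + 3 * tail_freq Fhat (W (inverse (height_D \<xi>)))"
proof -
  have alg: "\<And>j. algebraic (\<xi> $ j)" and nz: "\<And>j. \<xi> $ j \<noteq> 0" using \<xi> by (auto simp: algebraic_numbers_def)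
  let ?S = "galois_orbit \<xi>"
  define y where "y = W (inverse (height_D \<xi>))"
  define C where "C = 2 * (sqrt (8 * pi) + sqrt 6) * sqrt (height_D \<xi> * y)"
  define U where "U = {w :: (int ^ 'n) \<times> (real ^ 'n). of_int (l1_norm (fst w)) + l1_norm (snd w) > y}"
  define B where "B = (\<lambda>w :: (int ^ 'n) \<times> (real ^ 'n). orbit_average \<xi> w - (if fst w = 0 then 1 else 0))"
  have G: "integrable frequency_measure Fhat" using F by (simp add: test_function_def)
  have y0: "y > 0" unfolding y_def using height_D_pos[OF alg nz] by (intro W_pos) simp
  have C0: "C \<ge> 0" unfolding C_def using height_D_pos[OF alg nz] y0 by simp
  have phm: "(\<lambda>w. phase w z) \<in> borel_measurable (frequency_measure :: ((int ^ 'n) \<times> (real ^ 'n)) measure)" for z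
    using phase_measurable[of "\<lambda>w. w" frequency_measure "\<lambda>_. fst z" "\<lambda>_. snd z"] by simp
  have Gp: "integrable frequency_measure (\<lambda>w. Fhat w * phase w z)" for z
    by (rule Bochner_Integration.integrable_bound[OF G]) (auto simp: norm_mult intro!: borel_measurable_times phm borel_measurable_integrable[OF G])
  have av: "(\<Sum>\<alpha>\<in>?S. F (angle_vec \<alpha>, log_vec \<alpha>)) / of_nat (card ?S) = (LINT w|frequency_measure. Fhat w * orbit_average \<xi> w)"
  proof -
    have "(\<Sum>\<alpha>\<in>?S. F (angle_vec \<alpha>, log_vec \<alpha>)) = (LINT w|frequency_measure. (\<Sum>\<alpha>\<in>?S. Fhat w * phase w (angle_vec \<alpha>, log_vec \<alpha>)))"
      unfolding fourier_inversion[OF F] by (rule Bochner_Integration.integral_sum[symmetric]) (rule Gp)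
    then show ?thesis
      unfolding orbit_average_def[OF alg nz] times_divide_eq_right sum_distrib_left integral_divide_zero by simp
  qed
  have Ga: "integrable frequency_measure (\<lambda>w. Fhat w * orbit_average \<xi> w)"
  proof -
    have "integrable frequency_measure (\<lambda>w. (\<Sum>\<alpha>\<in>?S. Fhat w * phase w (angle_vec \<alpha>, log_vec \<alpha>)) / of_nat (card ?S))"
      by (intro integrable_divide Bochner_Integration.integrable_sum Gp)
    then show ?thesis unfolding orbit_average_def[OF alg nz] by (simp add: sum_distrib_left)
  qed
  have G0: "integrable frequency_measure (\<lambda>w. Fhat w * (if fst w = 0 then 1 else 0))"
  proof (rule Bochner_Integration.integrable_bound[OF G])
    have "(\<lambda>w. if fst w = 0 then 1 else 0 :: complex) \<in> borel_measurable (frequency_measure :: ((int ^ 'n) \<times> (real ^ 'n)) measure)"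
      by (rule measurable_compose[OF measurable_fst]) simp
    then show "(\<lambda>w. Fhat w * (if fst w = 0 then 1 else 0)) \<in> borel_measurable frequency_measure"
      by (intro borel_measurable_times borel_measurable_integrable[OF G])
  qed auto
  have GB: "integrable frequency_measure (\<lambda>w. Fhat w * B w)"
    using Bochner_Integration.integrable_diff[OF Ga G0] by (simp only: B_def right_diff_distrib)
  have err: "equidist_error F \<xi> = norm (LINT w|frequency_measure. Fhat w * B w)"
    unfolding equidist_error_def av torus_average_inversion[OF F] B_def right_diff_distrib
    by (simp only: Bochner_Integration.integral_diff[OF Ga G0])
  have pt: "norm (Fhat w * B w) \<le> C * norm (Fhat w) + 2 * (indicator U w * norm (Fhat w))" for w
  proof (cases "w \<in> U")
    case True
    have "norm (B w) \<le> norm (orbit_average \<xi> w) + norm (if fst w = 0 then 1 else 0 :: complex)"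
      unfolding B_def by (rule norm_triangle_ineq4)
    also have "\<dots> \<le> 1 + 1" by (intro add_mono norm_orbit_average_le_1[OF alg nz]) simp
    finally have "norm (Fhat w) * norm (B w) \<le> norm (Fhat w) * 2" by (intro mult_left_mono) auto
    then show ?thesis using True C0 by (simp add: norm_mult add_increasing)
  next
    case False
    obtain n t where w: "w = (n, t)" by (cases w)
    have "of_int (l1_norm n) + l1_norm t \<le> y" using False by (simp add: U_def w)
    from orbit_average_deviation[OF alg nz this] have "norm (B w) \<le> C"
      by (simp add: B_def w C_def)
    then have "norm (Fhat w) * norm (B w) \<le> norm (Fhat w) * C" by (intro mult_left_mono) auto
    then show ?thesis using False by (simp add: norm_mult mult.commute)
  qed
  note tail = tail_freq_integral[OF G, of y, folded U_def]
  have Gn: "integrable frequency_measure (\<lambda>w. norm (Fhat w))" using G by simp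
  have "equidist_error F \<xi> \<le> (LINT w|frequency_measure. norm (Fhat w * B w))"
    unfolding err by (rule Bochner_Integration.integral_norm_bound)
  also have "\<dots> \<le> (LINT w|frequency_measure. C * norm (Fhat w) + 2 * (indicator U w * norm (Fhat w)))"
    by (rule integral_mono[OF integrable_norm[OF GB] _ pt])
       (intro Bochner_Integration.integrable_add integrable_mult_right Gn tail(1))
  also have "\<dots> = C * L1_norm_freq Fhat + 2 * tail_freq Fhat y"
    unfolding L1_norm_freq_def tail(2)
      Bochner_Integration.integral_add[OF integrable_mult_right[OF Gn] integrable_mult_right[OF tail(1)]]
    by simp
  also have "\<dots> \<le> C * L1_norm_freq Fhat + 3 * tail_freq Fhat y" using tail(3) by simp
  finally show ?thesis unfolding C_def y_def .
qed

end
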